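(* Assume $s=n-1$. Let $(i_1,j_1),\dots,(i_m,j_m)$ be pairs of integers with $2\le i_t\le j_t\le n$. Let $D$ be the set of pairs $(i,j)$ with $2\le i\le j\le n$ such that $i\le i_t$ and $j\ge j_t$ for some $t\in\{1,\dots,m\}$. Then the Borel–Moore homology of $X=\bigcup_{t=1}^m K^{i_t,j_t}$ is free and concentrated in even degrees, and \[ \sum_{k\ge 0}\mathrm{rk}\,H^{BM}_{2k}(X)\,q^k=[n-1]_q!\sum_{(i,j)\in D}q^{(i-2)+(n-j)}. \] (Equivalently, with $a(c)=i-2$ the arm and $\ell(c)=n-j$ the leg of the cell $c=(i,j)$ lying above the Dyck path $D$, the sum is $[n-1]_q!\sum_{c\in D}q^{a(c)+\ell(c)}$.)
   Context: Let $n\ge 2$, $s=n-1$, $N=n+s-1=2n-2$, and let $e_1,\dots,e_N$ be the standard basis of $\mathbb{C}^N$. Let $x:\mathbb{C}^N\to\mathbb{C}^N$ be the linear map with $xe_m=e_{m-(n-1)}$ for $n\le m\le 2n-2$ and $xe_m=0$ otherwise; then $\mathrm{im}(x)=\ker(x)=\mathrm{span}(e_1,\dots,e_{n-1})$. Let $\mathrm{Fl}(1^n,n-2)$ be the variety of partial flags $V_\bullet=(0=V_0\subset V_1\subset\cdots\subset V_n\subset\mathbb{C}^N)$ with $\dim V_j=j$, and let $Y=Y_{n,n-1}=\{V_\bullet\mid \ker(x)\subseteq V_n,\ xV_j\subseteq V_j\text{ for all }j\}$. For distinct $w_1,\dots,w_n\in\{1,\dots,N\}$, the Schubert cell $X_w^\circ$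 is the set of flags with $\dim(V_j\cap\mathrm{span}(e_1,\dots,e_m))=\#\{l\le j: w_l\le m\}$ for all $j,m$. For $2\le i\le n$ put $w^{(i)}=(n-1,n-2,\dots,n-i+1,\,N,\,n-i,\dots,1)$ and let $K^i$ be the closure in $Y$ of $X^\circ_{w^{(i)}}\cap Y$ (the irreducible components of $Y$). For $2\le i<j\le n$ let $K^{i,j}=K^i\cap K^j$, and set $K^{i,i}=K^i$. $H^{BM}_*$ denotes integral Borel–Moore homology. $[m]_q=1+q+\cdots+q^{m-1}$ and $[m]_q!=[1]_q[2]_q\cdots[m]_q$. *)

theory Defs
  imports "HOL-Homology.Homology" "HOL-Library.Function_Algebras"
          "HOL-Computational_Algebra.Polynomial"
begin

(* Vectors of C^N are functions nat => complex supported in {1..N};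
   e_m is the m-th standard basis vector. *)
type_synonym cvec = "nat \<Rightarrow> complex"

definition Ndim :: "nat \<Rightarrow> nat" where "Ndim n = 2*n - 2"

definition cscale :: "complex \<Rightarrow> cvec \<Rightarrow> cvec" where
  "cscale c v = (\<lambda>i. c * v i)"

definition cdim :: "cvec set \<Rightarrow> nat" where
  "cdim V = vector_space.dim cscale V"

definition Espan :: "nat \<Rightarrow> cvec set" where
  "Espan m = {v. \<forall>i. (i < 1 \<or> m < i) \<longrightarrow> v i = 0}"

definition basis_vec :: "nat \<Rightarrow> cvec" where
  "basis_vec m = (\<lambda>i. if i = m then 1 else 0)"

(* the nilpotent map x : x e_m = e_{m-(n-1)} for n <= m <= 2n-2, x e_m = 0 otherwise *)
definition xmap :: "nat \<Rightarrow> cvec \<Rightarrow> cvec" where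
  "xmap n v = (\<lambda>a. if 1 \<le> a \<and> a \<le> n - 1 then v (a + (n - 1)) else 0)"

(* A partial flag V_1 \<subset> ... \<subset> V_n in C^N is encoded by the orthogonal projections
   P_j onto V_j: a point F, with F (j,a,b) the (a,b) entry of P_j (1<=j<=n, 1<=a,b<=N),
   all other coordinates 0.  The flag variety carries the subspace topology of the
   product (Euclidean) topology, which is the usual complex-analytic topology. *)
type_synonym flagpt = "nat \<times> nat \<times> nat \<Rightarrow> complex"

definition flagtop :: "flagpt topology" where
  "flagtop = product_topology (\<lambda>_. euclidean) UNIV"

definition projapp :: "nat \<Rightarrow> flagpt \<Rightarrow> nat \<Rightarrow> cvec \<Rightarrow> cvec" where
  "projapp n F j v = (\<lambda>a. \<Sum>b\<in>{1..Ndim n}. F (j, a, b) * v b)"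

definition Vsp :: "nat \<Rightarrow> flagpt \<Rightarrow> nat \<Rightarrow> cvec set" where
  "Vsp n F j = projapp n F j ` Espan (Ndim n)"

definition FlagVar :: "nat \<Rightarrow> flagpt set" where
  "FlagVar n = {F.
     (\<forall>j a b. \<not> (1 \<le> j \<and> j \<le> n \<and> 1 \<le> a \<and> a \<le> Ndim n \<and> 1 \<le> b \<and> b \<le> Ndim n)
              \<longrightarrow> F (j, a, b) = 0) \<and>
     (\<forall>j\<in>{1..n}. \<forall>a\<in>{1..Ndim n}. \<forall>b\<in>{1..Ndim n}.
        F (j, a, b) = cnj (F (j, b, a)) \<and>
        (\<Sum>c\<in>{1..Ndim n}. F (j, a, c) * F (j, c, b)) = F (j, a, b)) \<and>
     (\<forall>j\<in>{1..n}. cdim (Vsp n F j) = j) \<and>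
     (\<forall>j\<in>{1..<n}. Vsp n F j \<subseteq> Vsp n F (Suc j))}"

definition Yvar :: "nat \<Rightarrow> flagpt set" where
  "Yvar n = {F \<in> FlagVar n. Espan (n - 1) \<subseteq> Vsp n F n \<and>
                (\<forall>j\<in>{1..n}. xmap n ` Vsp n F j \<subseteq> Vsp n F j)}"

definition SchubertCell :: "nat \<Rightarrow> (nat \<Rightarrow> nat) \<Rightarrow> flagpt set" where
  "SchubertCell n w = {F \<in> FlagVar n. \<forall>j\<in>{0..n}. \<forall>m\<in>{0..Ndim n}.
      cdim (Vsp n F j \<inter> Espan m) = card {l\<in>{1..j}. w l \<le> m}}"

definition wperm :: "nat \<Rightarrow> nat \<Rightarrow> nat \<Rightarrow> nat" where
  "wperm n i l = (if l < i then n - l else if l = i then Ndim n else n + 1 - l)"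

definition Kcomp :: "nat \<Rightarrow> nat \<Rightarrow> flagpt set" where
  "Kcomp n i = (subtopology flagtop (Yvar n)) closure_of (SchubertCell n (wperm n i) \<inter> Yvar n)"

definition Kint :: "nat \<Rightarrow> nat \<Rightarrow> nat \<Rightarrow> flagpt set" where
  "Kint n i j = Kcomp n i \<inter> Kcomp n j"

definition qint :: "nat \<Rightarrow> int poly" where
  "qint m = (\<Sum>i<m. monom 1 i)"

definition qfact :: "nat \<Rightarrow> int poly" where
  "qfact m = (\<Prod>i\<in>{1..m}. qint i)"

end

theory Submission
  imports Defs
begin

text \<open>
  Write \<open>E = ker x\<close> and \<open>L = x V\<^sub>n\<close>, a line in \<open>E\<close> that determines \<open>V\<^sub>n\<close>. The component \<open>K\<^sup>i\<close> turns
  out to be \<open>L \<subseteq> V\<^bsub>i-1\<^esub> \<subseteq> E\<close>, so \<open>K\<^sup>i \<inter> K\<^sup>j\<close> for \<open>i \<le> j\<close> is \<open>L \<subseteq> V\<^bsub>i-1\<^esub>\<close>, \<open>V\<^bsub>j-1\<^esub> \<subseteq> E\<close>.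
  A flag is an orthonormal frame of \<open>V\<^sub>n\<close> up to phases. If the frame is
  \<open>(w\<^sub>1, \<dots>, w\<^bsub>n-1\<^esub>, y w\<^sub>1)\<close> with \<open>w\<close> an orthonormal basis of \<open>E\<close>, \<open>w\<^sub>1 \<in> L\<close> and \<open>y\<close> the isometric
  section of \<open>x\<close>, then rotating neighbouring columns, upwards from column \<open>1\<close> and downwards from
  column \<open>n\<close>, by SU(2) matrices with parameters in the closed unit disc produces all points of
  \<open>K\<^sup>i \<inter> K\<^sup>j\<close>; a parameter on the unit circle only changes phases, that is, drops the point into
  a smaller \<open>K\<^bsup>i'\<^esup> \<inter> K\<^bsup>j'\<^esup>\<close>. Full flags of \<open>E\<close> are treated in the same way. Hence the stratum of
  \<open>(i, j)\<close> consists of the \<open>(n-1)!\<close> cells of the flag variety of \<open>E\<close>, each multiplied by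
  \<open>(i-2) + (n-j)\<close> complex discs, and all cells have even real dimension, so the homology is free on them.

  Spaces here are compact, so Borel--Moore homology is singular homology. The characteristic maps
  are defined on closed polydiscs; they make each cell an honest attached cell, whose relative
  homology is computed by excision.
\<close>

section \<open>Attaching a polydisc\<close>

text \<open>A closed disc with its boundary circle collapsed is a projective line, and
  \<open>rot\<close> realises this collapse modulo phases; chains of rotations therefore behave like
  Bott-Samelson towers. Working with frames instead of flags gives continuous formulas on closed
  polydiscs: these are contractible, so phases can be chosen globally there, although not on the
  flag variety. Interior and boundary are told apart by one number: a vector seen only by the first
  column of a chain is seen by the last one with coefficient the product of the sines
  \<open>sn\<close>, which vanishes exactly when some parameter has modulus 1. The same formula
  sends boundaries into earlier strata and keeps interiors out of them. The obstacle is that K^i is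
  given as a closure, not by equations. Closedness of the set cut out by the equations comes from
  the cells, since a finite cellular set is compact. Density is harder: points must be approximated
  by points satisfying all rank conditions of the Schubert cell, so transversality to the standard
  flag is carried through rotations with interior parameters, and the remaining data are then
  perturbed.\<close>

definition pdisc :: "nat \<Rightarrow> (nat \<Rightarrow> complex) set" where
  "pdisc d = {z. \<forall>i. cmod (z i) \<le> (if i < d then 1 else 0)}"

definition odisc :: "nat \<Rightarrow> (nat \<Rightarrow> complex) set" where
  "odisc d = {z \<in> pdisc d. \<forall>i<d. cmod (z i) < 1}"

text \<open>The polydisc is the unit ball of this norm, so radial arguments for balls apply although
  it is a product of discs.\<close>

primrec supnorm :: "nat \<Rightarrow> (nat \<Rightarrow> complex) \<Rightarrow> real" where
  "supnorm 0 z = 0"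
| "supnorm (Suc d) z = max (supnorm d z) (cmod (z d))"

lemma supnorm_le_iff: "supnorm d z \<le> r \<longleftrightarrow> 0 \<le> r \<and> (\<forall>i<d. cmod (z i) \<le> r)"
  by (induction d) (auto simp: less_Suc_eq)

lemma supnorm_nonneg [simp]: "0 \<le> supnorm d z"
  by (induction d) auto

lemma supnorm_less_iff: "supnorm d z < r \<longleftrightarrow> 0 < r \<and> (\<forall>i<d. cmod (z i) < r)"
  by (induction d) (auto simp: less_Suc_eq)

lemma continuous_on_supnorm: "continuous_on S (supnorm d)"
proof (induction d)
  case (Suc d)
  have "continuous_on S (\<lambda>z. max (supnorm d z) (cmod (z d)))"
    by (intro continuous_on_max continuous_on_norm Suc
        continuous_on_product_then_coordinatewise[OF continuous_on_id])
  moreover have "supnorm (Suc d) = (\<lambda>z. max (supnorm d z) (cmod (z d)))"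
    by (rule ext) simp
  ultimately show ?case by simp
qed (simp add: supnorm.simps(1)[abs_def])

lemma pdisc_alt: "pdisc d = {z. supnorm d z \<le> 1 \<and> (\<forall>i\<ge>d. z i = 0)}"
  by (auto simp: pdisc_def supnorm_le_iff not_less split: if_splits)

lemma odisc_alt: "odisc d = {z. supnorm d z < 1 \<and> (\<forall>i\<ge>d. z i = 0)}"
  by (force simp: odisc_def pdisc_alt supnorm_less_iff supnorm_le_iff)

lemma supnorm_eq_0: "z \<in> pdisc d \<Longrightarrow> supnorm d z = 0 \<longleftrightarrow> z = (\<lambda>_. 0)"
proof -
  assume z: "z \<in> pdisc d"
  have "supnorm d z = 0 \<longleftrightarrow> supnorm d z \<le> 0" using supnorm_nonneg[of d z] by linarith
  also have "\<dots> \<longleftrightarrow> (\<forall>i<d. z i = 0)" by (simp add: supnorm_le_iff)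
  also have "\<dots> \<longleftrightarrow> z = (\<lambda>_. 0)"
    using z unfolding fun_eq_iff pdisc_alt by (metis (mono_tags, lifting) linorder_not_le mem_Collect_eq)
  finally show ?thesis .
qed

lemma supnorm_scale: "0 \<le> c \<Longrightarrow> supnorm d (\<lambda>i. of_real c * z i) = c * supnorm d z"
  by (induction d) (auto simp: norm_mult max_mult_distrib_left)

lemma compact_pdisc: "compact (pdisc d)"
proof -
  have "pdisc d = PiE UNIV (\<lambda>i. cball 0 (if i < d then 1 else 0))"
    by (auto simp: pdisc_def PiE_def Pi_def)
  moreover have "compactin (product_topology (\<lambda>i::nat. euclidean :: complex topology) UNIV)
     (PiE UNIV (\<lambda>i. cball 0 (if i < d then 1 else 0)))"
    by (subst compactin_PiE) auto
  ultimately show ?thesis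
    by (simp add: euclidean_product_topology)
qed

lemma zero_odisc [simp]: "(\<lambda>_. 0) \<in> odisc d"
  by (auto simp: odisc_def pdisc_def)

lemma odisc_subset: "odisc d \<subseteq> pdisc d" by (auto simp: odisc_def)

lemma zero_pdisc [simp]: "(\<lambda>_. 0) \<in> pdisc d"
  by (auto simp: pdisc_def)

text \<open>A map from a compact to a Hausdorff space is closed, and it stays closed onto its image
  when restricted to a full preimage, so continuity can be tested upstairs. The intended
  \<open>S\<close> is a cylinder over a punctured polydisc, which is not compact itself.\<close>

lemma continuous_on_factor_compact:
  fixes f :: "'a::t2_space \<Rightarrow> 'b::t2_space" and g :: "'b \<Rightarrow> 'c::topological_space"
  assumes "compact K" "continuous_on K f" "S \<subseteq> K" "\<And>x. x \<in> K \<Longrightarrow> f x \<in> f ` S \<Longrightarrow> x \<in> S"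
    and gf: "continuous_on S (\<lambda>x. g (f x))"
  shows "continuous_on (f ` S) g"
proof (subst continuous_on_closed_invariant, intro allI impI)
  fix C :: "'c set" assume "closed C"
  then obtain M where M: "closed M" "M \<inter> S = (\<lambda>x. g (f x)) -` C \<inter> S"
    using gf unfolding continuous_on_closed_invariant by metis
  have "compact (f ` (K \<inter> M))"
    using assms M by (intro compact_continuous_image compact_Int_closed) (auto intro: continuous_on_subset)
  moreover have "f ` (K \<inter> M) \<inter> f ` S = g -` C \<inter> f ` S"
  proof
    show "f ` (K \<inter> M) \<inter> f ` S \<subseteq> g -` C \<inter> f ` S"
    proof
      fix y assume "y \<in> f ` (K \<inter> M) \<inter> f ` S"
      then obtain x where "x \<in> K" "x \<in> M" "y = f x" "f x \<in> f ` S" by blast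
      then show "y \<in> g -` C \<inter> f ` S" using M(2) assms(4)[of x] by blast
    qed
    show "g -` C \<inter> f ` S \<subseteq> f ` (K \<inter> M) \<inter> f ` S"
    proof
      fix y assume "y \<in> g -` C \<inter> f ` S"
      then obtain x where "x \<in> S" "y = f x" "g (f x) \<in> C" by blast
      then show "y \<in> f ` (K \<inter> M) \<inter> f ` S" using M(2) assms(3) by blast
    qed
  qed
  ultimately show "\<exists>A. closed A \<and> A \<inter> f ` S = g -` C \<inter> f ` S"
    using compact_imp_closed by blast
qed

text \<open>Identifications on the boundary are unrestricted. As the polydisc is compact and the
  target Hausdorff, this much already gives the union of a closed \<open>A\<close> with the image of
  the polydisc the topology of an attached cell.\<close>

definition cell_attach :: "nat \<Rightarrow> 'a::t2_space set \<Rightarrow> ((nat \<Rightarrow> complex) \<Rightarrow> 'a) \<Rightarrow> bool" where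
  "cell_attach d A \<phi> \<longleftrightarrow> continuous_on (pdisc d) \<phi> \<and> \<phi> ` (pdisc d - odisc d) \<subseteq> A \<and>
     \<phi> ` odisc d \<inter> A = {} \<and> inj_on \<phi> (odisc d)"

section \<open>The radial deformation of a punctured cell\<close>

definition push :: "nat \<Rightarrow> real \<Rightarrow> (nat \<Rightarrow> complex) \<Rightarrow> nat \<Rightarrow> complex" where
  "push d t z = (\<lambda>i. of_real ((1 - t) + t / supnorm d z) * z i)"

lemma supnorm_push:
  assumes "0 \<le> t" "t \<le> 1" "z \<in> pdisc d" "z \<noteq> (\<lambda>_. 0)"
  shows "supnorm d (push d t z) = (1 - t) * supnorm d z + t"
proof -
  have "supnorm d z > 0" using assms supnorm_eq_0[of z d] supnorm_nonneg[of d z] by linarith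
  moreover have "0 \<le> (1 - t) + t / supnorm d z"
    using assms by (intro add_nonneg_nonneg divide_nonneg_nonneg) auto
  ultimately show ?thesis unfolding push_def by (subst supnorm_scale) (auto simp: field_simps)
qed

lemma push_pdisc:
  assumes "0 \<le> t" "t \<le> 1" "z \<in> pdisc d" "z \<noteq> (\<lambda>_. 0)"
  shows "push d t z \<in> pdisc d" "push d t z \<noteq> (\<lambda>_. 0)"
proof -
  have "supnorm d z > 0" "supnorm d z \<le> 1"
    using assms supnorm_eq_0[of z d] by (auto simp: order_less_le pdisc_alt)
  then have "(1 - t) * supnorm d z + t \<le> 1" 
    using assms mult_left_mono[of "supnorm d z" 1 "1-t"] by auto
  moreover have "(1 - t) * supnorm d z + t > 0"
    using assms \<open>supnorm d z > 0\<close> by (cases "t = 0") (auto simp: add_nonneg_pos)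
  ultimately have 1: "supnorm d (push d t z) \<le> 1" "supnorm d (push d t z) > 0"
    using supnorm_push[OF assms] by auto
  then show 2: "push d t z \<in> pdisc d"
    using assms by (auto simp: pdisc_alt push_def)
  show "push d t z \<noteq> (\<lambda>_. 0)"
    using 1 supnorm_eq_0[OF 2] by auto
qed

lemma push_boundary:
  assumes "z \<in> pdisc d - odisc d" shows "push d t z = z"
proof -
  have "supnorm d z = 1" using assms by (force simp: pdisc_alt odisc_alt)
  then show ?thesis by (simp add: push_def)
qed

lemma continuous_on_push:
  "continuous_on (UNIV \<times> (pdisc d - {\<lambda>_. 0})) (\<lambda>(t, z). push d t z)"
proof -
  have *: "continuous_on (UNIV \<times> (pdisc d - {\<lambda>_. 0})) (\<lambda>x. supnorm d (snd x))"
    by (rule continuous_on_compose2[OF continuous_on_supnorm[of UNIV]]) (auto intro: continuous_intros)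
  show ?thesis unfolding push_def case_prod_beta
    by (intro continuous_on_coordinatewise_then_product continuous_on_mult continuous_on_of_real
        continuous_on_add continuous_on_diff continuous_on_divide continuous_on_const
        continuous_on_fst[OF continuous_on_id] *
      continuous_on_product_then_coordinatewise[OF continuous_on_snd[OF continuous_on_id]])
      (auto simp: supnorm_eq_0)
qed

lemma cell_attach_inj:
  assumes "cell_attach d A \<phi>" "z \<in> odisc d" "z' \<in> pdisc d" "\<phi> z = \<phi> z'" shows "z = z'"
  using assms unfolding cell_attach_def inj_on_def by (metis DiffI IntI empty_iff image_eqI subsetD)

text \<open>Radial pushing away from the centre empties the cell into \<open>A\<close>. It descends
  from the polydisc because boundary points, the only ones that \<open>\<phi>\<close> may identify,
  stay fixed; continuity is checked separately on two closed pieces, \<open>A\<close> and the image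
  of the cell.\<close>

lemma cell_attach_deformation:
  fixes A :: "'a::t2_space set"
  assumes cell: "cell_attach d A \<phi>" and "closed A" and X: "X = A \<union> \<phi> ` pdisc d"
  shows "\<exists>h. continuous_on ({0..1::real} \<times> (X - {\<phi> (\<lambda>_. 0)})) h \<and>
    h ` ({0..1} \<times> (X - {\<phi> (\<lambda>_. 0)})) \<subseteq> X - {\<phi> (\<lambda>_. 0)} \<and>
    (\<forall>x \<in> X - {\<phi> (\<lambda>_. 0)}. h (0, x) = x \<and> h (1, x) \<in> A) \<and> (\<forall>t. \<forall>x\<in>A. h (t, x) = x)"
proof -
  let ?o = "\<lambda>_::nat. 0::complex"
  let ?B = "X - {\<phi> ?o}"
  \<comment> \<open>\<open>inv_into\<close> matters only off \<open>A\<close>, where a point of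
    \<open>X\<close> has exactly one preimage in the open polydisc.\<close>
  define h where "h = (\<lambda>(t, x). if x \<in> A then x else \<phi> (push d t (inv_into (odisc d) \<phi> x)))"
  have cont: "continuous_on (pdisc d) \<phi>" and bd: "\<phi> ` (pdisc d - odisc d) \<subseteq> A"
    and int: "\<phi> ` odisc d \<inter> A = {}" and inj: "inj_on \<phi> (odisc d)"
    using cell by (auto simp: cell_attach_def)
  have o: "\<phi> ?o \<notin> A" using int zero_odisc by blast
  have hphi: "h (t, \<phi> z) = \<phi> (push d t z)" if "z \<in> pdisc d" for t z
  proof (cases "z \<in> odisc d")
    case True
    then show ?thesis using int inj by (auto simp: h_def)
  next
    case False
    then show ?thesis using that bd push_boundary[of z d t] by (auto simp: h_def)
  qed
  have ne: "\<phi> z = \<phi> ?o \<longleftrightarrow> z = ?o" if "z \<in> pdisc d" for z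
    using cell_attach_inj[OF cell zero_odisc that] by auto
  have Beq: "?B = A \<union> \<phi> ` (pdisc d - {?o})" 
  proof (intro Set.set_eqI iffI)
    fix x assume "x \<in> ?B"
    then consider "x \<in> A" | z where "z \<in> pdisc d" "x = \<phi> z" "z \<noteq> ?o" using X by blast
    then show "x \<in> A \<union> \<phi> ` (pdisc d - {?o})" by cases auto
  next
    fix x assume "x \<in> A \<union> \<phi> ` (pdisc d - {?o})"
    then consider "x \<in> A" | z where "z \<in> pdisc d" "x = \<phi> z" "z \<noteq> ?o" by blast
    then show "x \<in> ?B" using o ne X by cases auto
  qed
  have clC: "closed (\<phi> ` pdisc d)"
    by (intro compact_imp_closed compact_continuous_image cont compact_pdisc)
  have "continuous_on ({0..1} \<times> A) h"
    by (rule continuous_on_eq[where f = snd]) (auto simp: h_def intro: continuous_intros)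
  moreover have "continuous_on ({0..1} \<times> \<phi> ` (pdisc d - {?o})) h"
  proof -
    let ?f = "\<lambda>(t::real, z). (t, \<phi> z)"
    have "continuous_on (?f ` ({0..1} \<times> (pdisc d - {?o}))) h"
    proof (rule continuous_on_factor_compact[where K = "{0..1} \<times> pdisc d"])
      show "compact ({0..1::real} \<times> pdisc d)" by (intro compact_Times compact_pdisc) auto
      show "continuous_on ({0..1::real} \<times> pdisc d) ?f"
        unfolding case_prod_beta
        by (intro continuous_intros continuous_on_compose2[OF cont]) auto
      have "continuous_on ({0..1} \<times> (pdisc d - {?o})) (\<lambda>x. \<phi> (case x of (t,z) \<Rightarrow> push d t z))"
        by (rule continuous_on_compose2[OF cont])
           (auto intro: continuous_on_subset[OF continuous_on_push] push_pdisc)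
      then show "continuous_on ({0..1} \<times> (pdisc d - {?o})) (\<lambda>x. h (?f x))"
        by (rule continuous_on_eq) (auto simp: hphi)
      show "x \<in> {0..1} \<times> (pdisc d - {?o})"
        if x: "x \<in> {0..1} \<times> pdisc d" and im: "?f x \<in> ?f ` ({0..1} \<times> (pdisc d - {?o}))" for x
      proof -
        obtain z' where "z' \<in> pdisc d" "z' \<noteq> ?o" "\<phi> (snd x) = \<phi> z'" using im by (cases x) auto
        then have "snd x \<noteq> ?o" using ne[of z'] by metis
        then show ?thesis using x by (cases x) auto
      qed
    qed auto
    moreover have "?f ` ({0..1} \<times> (pdisc d - {?o})) = {0..1} \<times> \<phi> ` (pdisc d - {?o})" by force
    ultimately show ?thesis by simp
  qed
  ultimately have "continuous_on ({0..1} \<times> A \<union> {0..1} \<times> \<phi> ` (pdisc d - {?o})) h"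
  proof (rule continuous_on_Un_local[rotated 2])
    have *: "{0..1} \<times> A \<union> {0..1} \<times> \<phi> ` (pdisc d - {?o}) = {0..1::real} \<times> ?B"
      using Beq by auto
    show "closedin (top_of_set ({0..1} \<times> A \<union> {0..1} \<times> \<phi> ` (pdisc d - {?o}))) ({0..1::real} \<times> A)"
      unfolding closedin_closed using \<open>closed A\<close>
      by (intro exI[of _ "UNIV \<times> A"]) (auto simp: closed_Times Beq)
    show "closedin (top_of_set ({0..1} \<times> A \<union> {0..1} \<times> \<phi> ` (pdisc d - {?o}))) ({0..1::real} \<times> \<phi> ` (pdisc d - {?o}))"
      unfolding closedin_closed * using clC X ne
      by (intro exI[of _ "UNIV \<times> \<phi> ` pdisc d"]) (auto simp: closed_Times)
  qed
  then have 1: "continuous_on ({0..1} \<times> ?B) h"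
    unfolding Beq by (simp add: Sigma_Un_distrib2)
  have im: "h (t, x) \<in> ?B" if "t \<in> {0..1}" "x \<in> ?B" for t x
  proof (cases "x \<in> A")
    case True
    then show ?thesis using that by (auto simp: h_def)
  next
    case False
    then have "x \<in> \<phi> ` (pdisc d - {?o})" using that(2) unfolding Beq by simp
    then obtain z where z: "z \<in> pdisc d" "z \<noteq> ?o" "x = \<phi> z" by blast
    then have "h (t, x) \<in> A \<union> \<phi> ` (pdisc d - {?o})"
      using push_pdisc[of t z d] that(1) by (auto simp: hphi)
    then show ?thesis unfolding Beq .
  qed
  have h0: "h (0, x) = x" if "x \<in> ?B" for x
  proof -
    have "x \<in> A \<union> \<phi> ` (pdisc d - {?o})" using that unfolding Beq .
    then show ?thesis by (elim UnE imageE) (auto simp: hphi push_def, auto simp: h_def)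
  qed
  have h1: "h (1, x) \<in> A" if "x \<in> ?B" for x
  proof (cases "x \<in> A")
    case False
    then have "x \<in> \<phi> ` (pdisc d - {?o})" using that unfolding Beq by simp
    then obtain z where z: "z \<in> pdisc d" "z \<noteq> ?o" "x = \<phi> z" by blast
    have "push d 1 z \<in> pdisc d - odisc d"
      using push_pdisc[of 1 z d] z supnorm_push[of 1 z d] by (auto simp: odisc_alt)
    then show ?thesis using z bd by (auto simp: hphi)
  qed (auto simp: h_def)
  show ?thesis
  proof (intro exI[of _ h] conjI ballI allI)
    show "h ` ({0..1} \<times> ?B) \<subseteq> ?B"
    proof (rule image_subsetI)
      fix y assume "y \<in> {0..1::real} \<times> ?B"
      then show "h y \<in> ?B" using im[of "fst y" "snd y"] by (cases y) simp
    qed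
    show "h (0, x) = x" if "x \<in> ?B" for x using h0[OF that] .
    show "h (1, x) \<in> A" if "x \<in> ?B" for x using h1[OF that] .
    show "h (t, x) = x" if "x \<in> A" for t x using that by (simp add: h_def)
  qed (rule 1)
qed

text \<open>Exact sequence of the triple with the punctured space in the middle: the latter deforms
  onto \<open>A\<close>, so its homology relative to \<open>A\<close> vanishes and it may replace
  \<open>A\<close>.\<close>

lemma relative_homology_cell_attach_punctured:
  fixes A :: "'a::t2_space set"
  assumes cell: "cell_attach d A \<phi>" and "closed A" and X: "X = A \<union> \<phi> ` pdisc d"
  shows "relative_homology_group p (top_of_set X) A
     \<cong> relative_homology_group p (top_of_set X) (X - {\<phi> (\<lambda>_. 0)})"
proof -
  let ?B = "X - {\<phi> (\<lambda>_. 0)}"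
  obtain h where h0: "continuous_on ({0..1::real} \<times> ?B) h \<and> h ` ({0..1} \<times> ?B) \<subseteq> ?B \<and>
    (\<forall>x \<in> ?B. h (0, x) = x \<and> h (1, x) \<in> A) \<and> (\<forall>t. \<forall>x\<in>A. h (t, x) = x)"
    using cell_attach_deformation[OF assms] by (rule exE)
  note h = h0[THEN conjunct1] h0[THEN conjunct2, THEN conjunct1]
    h0[THEN conjunct2, THEN conjunct2, THEN conjunct1, rule_format, THEN conjunct1]
    h0[THEN conjunct2, THEN conjunct2, THEN conjunct1, rule_format, THEN conjunct2]
    h0[THEN conjunct2, THEN conjunct2, THEN conjunct2, rule_format]
  have AB: "A \<subseteq> ?B"
    using cell zero_odisc[of d] X unfolding cell_attach_def by blast
  have sub: "subtopology (top_of_set X) ?B = top_of_set ?B"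
    by (simp add: subtopology_subtopology Int_absorb1)
  have subA: "subtopology (top_of_set ?B) A = top_of_set A"
    using AB by (simp add: subtopology_subtopology Int_absorb1)
  have triv: "trivial_group (relative_homology_group p (top_of_set ?B) A)" for p
  proof (rule trivial_relative_homology_group_gen[where f = "\<lambda>x. h (1, x)"], unfold subA)
    have c1: "continuous_on ?B (\<lambda>x. h (1, x))"
      by (rule continuous_on_compose2[OF h(1)]) (auto intro: continuous_intros)
    then show "continuous_map (top_of_set ?B) (top_of_set A) (\<lambda>x. h (1, x))"
      using h(4) by auto
    show "homotopic_with (\<lambda>h. True) (top_of_set A) (top_of_set A) (\<lambda>x. h (1, x)) id"
      using h(5) by (intro homotopic_with_equal) (auto intro!: continuous_on_eq[OF continuous_on_id])
    have "homotopic_with (\<lambda>h. True) (top_of_set ?B) (top_of_set ?B) id (\<lambda>x. h (1, x))"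
    proof (subst homotopic_with, simp, intro exI[of _ h] conjI ballI)
      show "h (0, x) = id x" if "x \<in> topspace (top_of_set ?B)" for x using that h(3) by simp
    qed (use h(1,2) in auto)
    then show "homotopic_with (\<lambda>k. True) (top_of_set ?B) (top_of_set ?B) (\<lambda>x. h (1, x)) id"
      by (rule homotopic_with_symD)
  qed
  have "hom_induced p (top_of_set X) A (top_of_set X) ?B id \<in>
     iso (relative_homology_group p (top_of_set X) A) (relative_homology_group p (top_of_set X) ?B)"
  proof (rule very_short_exact_sequence)
    show "exact_seq ([relative_homology_group (p-1) (subtopology (top_of_set X) ?B) A,
      relative_homology_group p (top_of_set X) ?B, relative_homology_group p (top_of_set X) A,
      relative_homology_group p (subtopology (top_of_set X) ?B) A],
      [hom_relboundary p (top_of_set X) ?B A, hom_induced p (top_of_set X) A (top_of_set X) ?B id,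
       hom_induced p (subtopology (top_of_set X) ?B) A (top_of_set X) A id])"
      using homology_exactness_triple_1[OF AB, of p "top_of_set X"]
        homology_exactness_triple_3[OF AB, of p "top_of_set X"]
      by (metis exact_seq_cons_iff)
  qed (use triv sub in auto)
  then show ?thesis by (rule is_isoI)
qed

text \<open>Excision down to a smaller closed polydisc inside the cell. There the characteristic map
  is injective, hence a homeomorphism onto its image by compactness, and the way in which the
  boundary is glued disappears from the relative group.\<close>

lemma relative_homology_cell_attach:
  fixes A :: "'a::t2_space set"
  assumes cell: "cell_attach d A \<phi>" and "closed A" and X: "X = A \<union> \<phi> ` pdisc d"
  shows "relative_homology_group p (top_of_set X) A
     \<cong> relative_homology_group p (top_of_set (pdisc d)) (pdisc d - {\<lambda>_. 0})"
proof -
  let ?o = "\<lambda>_::nat. 0::complex"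
  let ?B = "X - {\<phi> ?o}"
  \<comment> \<open>Shrinking moves the closed polydisc into the open one, where
    \<open>\<phi>\<close> is injective.\<close>
  define hf where "hf = (\<lambda>z::nat \<Rightarrow> complex. \<lambda>i. of_real (1/2) * z i)"
  have cont: "continuous_on (pdisc d) \<phi>" and bd: "\<phi> ` (pdisc d - odisc d) \<subseteq> A"
    and int: "\<phi> ` odisc d \<inter> A = {}" and inj: "inj_on \<phi> (odisc d)"
    using cell by (auto simp: cell_attach_def)
  have sn: "supnorm d (hf z) = supnorm d z / 2" for z
    using supnorm_scale[of "1/2" d z] by (simp add: hf_def)
  have hfo: "hf z \<in> odisc d" if "z \<in> pdisc d" for z
    using that sn[of z] by (auto simp: pdisc_alt odisc_alt) (auto simp: hf_def)
  have hfc: "continuous_on S hf" for S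
    unfolding hf_def by (intro continuous_on_coordinatewise_then_product continuous_on_mult
        continuous_on_const continuous_on_product_then_coordinatewise[OF continuous_on_id])
  have hfinj: "inj hf" unfolding hf_def inj_def fun_eq_iff by simp
  let ?\<psi> = "\<lambda>z. \<phi> (hf z)"
  have \<psi>c: "continuous_on (pdisc d) ?\<psi>"
    by (rule continuous_on_compose2[OF cont hfc]) (use hfo odisc_subset in blast)
  have \<psi>i: "inj_on ?\<psi> (pdisc d)"
    using inj hfo hfinj unfolding inj_on_def by blast
  let ?H = "?\<psi> ` pdisc d" and ?Ho = "?\<psi> ` odisc d"
  have hf_surj: "\<exists>w. z = hf w \<and> w \<in> odisc d" if "z \<in> pdisc d" "supnorm d z < 1/2" for z
  proof -
    let ?w = "\<lambda>i. of_real 2 * z i"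
    have "z = hf ?w" by (simp add: hf_def)
    moreover have "?w \<in> odisc d"
      using that supnorm_scale[of 2 d z] by (auto simp: odisc_alt pdisc_alt)
    ultimately show ?thesis by blast
  qed
  have HX: "?H \<subseteq> X" using hfo odisc_subset X by blast
  have o: "hf ?o = ?o" by (simp add: hf_def)
  let ?U = "X - ?H"
  have open_Ho: "closed (X - ?Ho)"
  proof -
    \<comment> \<open>The complement of the small open polydisc is \<open>A\<close> together with
      the image of this compact shell, hence closed. It keeps the excised set away from the
      centre.\<close>
    let ?R = "pdisc d \<inter> {z. 1/2 \<le> supnorm d z}"
    have "compact ?R"
      by (intro compact_Int_closed compact_pdisc closed_Collect_le continuous_on_supnorm continuous_on_const)
    then have "closed (\<phi> ` ?R)"
      by (intro compact_imp_closed compact_continuous_image continuous_on_subset[OF cont]) auto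
    moreover have "X - ?Ho = A \<union> \<phi> ` ?R"
    proof (intro Set.set_eqI iffI)
      fix x assume "x \<in> X - ?Ho"
      then consider "x \<in> A" | z where "z \<in> pdisc d" "x = \<phi> z" "\<phi> z \<notin> ?Ho" using X by blast
      then show "x \<in> A \<union> \<phi> ` ?R"
      proof cases
        case 2
        then have "\<not> supnorm d z < 1/2" using hf_surj[of z] by blast
        then show ?thesis using 2 by auto
      qed auto
    next
      fix x assume "x \<in> A \<union> \<phi> ` ?R"
      then consider "x \<in> A" | z where "z \<in> pdisc d" "x = \<phi> z" "1/2 \<le> supnorm d z" by blast
      then show "x \<in> X - ?Ho"
      proof cases
        case 1
        moreover have "hf w \<in> odisc d" if "w \<in> odisc d" for w using hfo that odisc_subset by blast
        ultimately show ?thesis using X int by blast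
      next
        case 2
        have False if "w \<in> odisc d" "\<phi> z = \<phi> (hf w)" for w
        proof -
          have "hf w = z" 
            using cell_attach_inj[OF cell hfo[OF subsetD[OF odisc_subset that(1)]] 2(1)] that(2) by simp
          then have "supnorm d z < 1/2" using sn[of w] that(1) by (auto simp: odisc_alt)
          then show False using 2 by simp
        qed
        then have "x \<notin> ?Ho" unfolding 2(2) by blast
        moreover have "x \<in> X" unfolding X 2(2) using 2(1) by simp
        ultimately show ?thesis by simp
      qed
    qed
    ultimately show ?thesis using \<open>closed A\<close> by auto
  qed
  have "closedin (top_of_set X) (X - ?Ho)" using open_Ho by (auto intro: closed_subset)
  moreover have "?U \<subseteq> X - ?Ho" using odisc_subset by blast
  ultimately have cl: "(top_of_set X) closure_of ?U \<subseteq> X - ?Ho"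
    by (rule closure_of_minimal[rotated])
  have opB: "openin (top_of_set X) ?B"
    by (simp add: openin_delete)
  have "\<phi> ?o \<in> ?Ho" using o zero_odisc by (metis image_eqI)
  then have "X - ?Ho \<subseteq> ?B" by blast
  then have exc: "(top_of_set X) closure_of ?U \<subseteq> (top_of_set X) interior_of ?B"
    using cl opB by (simp add: interior_of_openin)
  have "relative_homology_group p (subtopology (top_of_set X) (X - ?U)) (?B - ?U) \<cong>
        relative_homology_group p (subtopology (top_of_set X) X) ?B"
    using homology_excision_axiom[OF exc, of X p] by (auto intro: is_isoI)
  moreover have "subtopology (top_of_set X) (X - ?U) = top_of_set ?H"
    using HX by (simp add: subtopology_subtopology double_diff Int_absorb1)
  moreover have "?B - ?U = ?H - {\<phi> ?o}" using HX by blast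
  ultimately have e1: "relative_homology_group p (top_of_set ?H) (?H - {\<phi> ?o}) \<cong>
        relative_homology_group p (top_of_set X) ?B"
    by (simp add: subtopology_subtopology)
  have "homeomorphic_map (top_of_set (pdisc d)) (top_of_set ?H) ?\<psi>"
  proof (rule continuous_imp_homeomorphic_map)
    show "compact_space (top_of_set (pdisc d))" using compact_pdisc by (simp add: compact_space_subtopology)
    show "Hausdorff_space (top_of_set ?H)"
      by (intro Hausdorff_space_subtopology) (simp add: Hausdorff_space_def disjnt_def, metis hausdorff)
  qed (use \<psi>c \<psi>i in auto)
  moreover have "?\<psi> ` (pdisc d - {?o}) = ?H - {\<phi> ?o}"
    using \<psi>i o zero_pdisc[of d] unfolding inj_on_def by force
  ultimately have e2: "relative_homology_group p (top_of_set (pdisc d)) (pdisc d - {?o}) \<cong>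
     relative_homology_group p (top_of_set ?H) (?H - {\<phi> ?o})"
    using homeomorphic_map_relative_homology_iso[of "top_of_set (pdisc d)" "top_of_set ?H" ?\<psi> "pdisc d - {?o}"
        "?H - {\<phi> ?o}" p]
    by (intro is_isoI) simp
  show ?thesis
    using relative_homology_cell_attach_punctured[OF assms] e1 e2
    by (meson group.iso_sym group_relative_homology_group iso_trans)
qed

section \<open>Homology of the polydisc relative to its punctured part\<close>

lemma contractible_pdisc: "contractible (pdisc d)"
proof -
  have "homotopic_with_canon (\<lambda>x. True) (pdisc d) (pdisc d) id (\<lambda>x. (\<lambda>_. 0))"
    unfolding homotopic_with_def
  proof (intro exI conjI allI ballI)
    show "continuous_map (prod_topology (top_of_set {0..1}) (top_of_set (pdisc d))) (top_of_set (pdisc d))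
       (\<lambda>(t, z) i. of_real (1 - t) * z i)"
    proof -
      have "continuous_on ({0..1} \<times> pdisc d) (\<lambda>x i. complex_of_real (1 - fst x) * snd x i)"
        by (intro continuous_on_coordinatewise_then_product continuous_on_mult continuous_on_of_real
            continuous_on_diff continuous_on_const continuous_on_fst[OF continuous_on_id]
            continuous_on_product_then_coordinatewise[OF continuous_on_snd[OF continuous_on_id]])
      moreover have "(\<lambda>i. of_real (1 - t) * z i) \<in> pdisc d" if "t \<in> {0..1}" "z \<in> pdisc d" for t z
      proof -
        have "supnorm d z \<le> 1" using that by (simp add: pdisc_alt)
        then have "supnorm d (\<lambda>i. of_real (1 - t) * z i) \<le> 1"
          using that supnorm_scale[of "1-t" d z] mult_mono[of "1 - t" 1 "supnorm d z" 1] by auto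
        then show ?thesis using that by (simp add: pdisc_alt)
      qed
      ultimately show ?thesis by (auto simp: case_prod_beta)
    qed
  qed auto
  then show ?thesis unfolding contractible_def by blast
qed

definition sqsum :: "nat \<Rightarrow> (nat \<Rightarrow> complex) \<Rightarrow> real" where
  "sqsum d z = (\<Sum>i<d. (cmod (z i))\<^sup>2)"

text \<open>Real and imaginary parts are interleaved, so that \<open>sqsum d\<close> becomes the sum
  of squares of the first 2d real coordinates, as in \<open>nsphere\<close>.\<close>

definition re_im :: "(nat \<Rightarrow> complex) \<Rightarrow> nat \<Rightarrow> real" where
  "re_im z i = (if even i then Re (z (i div 2)) else Im (z (i div 2)))"

definition of_re_im :: "(nat \<Rightarrow> real) \<Rightarrow> nat \<Rightarrow> complex" where
  "of_re_im x i = Complex (x (2 * i)) (x (2 * i + 1))"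

lemma of_re_im_re_im [simp]: "of_re_im (re_im z) = z"
  by (simp add: fun_eq_iff of_re_im_def re_im_def)

lemma re_im_of_re_im [simp]: "re_im (of_re_im x) = x"
proof
  fix i show "re_im (of_re_im x) i = x i"
    by (cases "even i") (auto simp: re_im_def of_re_im_def elim!: evenE oddE)
qed

lemma sum_sq_re_im: "(\<Sum>i<2*d. (re_im z i)\<^sup>2) = sqsum d z"
  by (induction d) (auto simp: sqsum_def re_im_def cmod_power2)

lemma sqsum_pos: "z \<in> pdisc d \<Longrightarrow> z \<noteq> (\<lambda>_. 0) \<Longrightarrow> sqsum d z > 0"
proof -
  assume z: "z \<in> pdisc d" "z \<noteq> (\<lambda>_. 0)"
  then obtain i where "z i \<noteq> 0" by blast
  then have "i < d" using z by (force simp: pdisc_alt not_less)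
  with \<open>z i \<noteq> 0\<close> show ?thesis unfolding sqsum_def by (intro sum_pos2[of _ i]) auto
qed

lemma continuous_on_component: "continuous_on S f \<Longrightarrow> continuous_on S (\<lambda>x. f x i)"
  for f :: "'a::topological_space \<Rightarrow> 'b \<Rightarrow> 'c::topological_space"
  by (rule continuous_on_product_then_coordinatewise)

lemma continuous_on_sqsum: "continuous_on S (sqsum d)"
  unfolding sqsum_def
  by (intro continuous_on_sum continuous_on_power continuous_on_norm continuous_on_component[OF continuous_on_id])

lemma nsphere_odd:
  assumes "d > 0"
  shows "nsphere (2 * d - 1) = top_of_set {x. sqsum d (of_re_im x) = 1 \<and> (\<forall>i\<ge>2*d. x i = 0)}"
proof -
  have "{..2 * d - 1} = {..<2*d}" using assms by auto
  then have 1: "(\<Sum>i\<le>2*d-1. (x i)\<^sup>2) = sqsum d (of_re_im x)" for x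
    using sum_sq_re_im[where d=d and z="of_re_im x"] by simp
  have 2: "powertop_real (UNIV :: nat set) = euclidean" by (rule euclidean_product_topology)
  show ?thesis using assms unfolding nsphere 1 2
    by (intro arg_cong[where f = "top_of_set"]) auto
qed

lemma sqsum_scale: "sqsum d (\<lambda>i. of_real c * z i) = c\<^sup>2 * sqsum d z"
  by (simp add: sqsum_def norm_mult power_mult_distrib sum_distrib_left)

text \<open>Normalise to Euclidean length 1. The Euclidean unit sphere lies inside the polydisc, so
  the inverse map is an inclusion. The segment from a point to its normalisation consists of
  positive multiples of the point, hence avoids 0, and stays in the polydisc by convexity.\<close>

lemma punctured_pdisc_homotopy_equivalent_sphere:
  assumes "d > 0"
  shows "top_of_set (pdisc d - {\<lambda>_. 0}) homotopy_equivalent_space nsphere (2 * d - 1)"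
proof -
  let ?P = "pdisc d - {\<lambda>_::nat. 0::complex}"
  let ?S = "{x. sqsum d (of_re_im x) = 1 \<and> (\<forall>i\<ge>2*d. x i = 0)}"
  define nz where "nz = (\<lambda>z::nat \<Rightarrow> complex. \<lambda>i. of_real (1 / sqrt (sqsum d z)) * z i)"
  define f where "f = (\<lambda>z. re_im (nz z))"
  have sq: "sqsum d (nz z) = 1" if "z \<in> ?P" for z
    using sqsum_pos[of z d] that unfolding nz_def sqsum_scale by (auto simp: power_divide)
  have fim: "f z \<in> ?S" if "z \<in> ?P" for z
  proof -
    have "re_im (nz z) i = 0" if "i \<ge> 2 * d" for i
    proof -
      have "i div 2 \<ge> d" using that by auto
      then show ?thesis using \<open>z \<in> ?P\<close> by (auto simp: re_im_def nz_def pdisc_alt)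
    qed
    then show ?thesis using sq[OF that] by (simp add: f_def)
  qed
  have gim: "of_re_im x \<in> ?P" if "x \<in> ?S" for x
  proof -
    have "(cmod (of_re_im x i))\<^sup>2 \<le> 1" if "i < d" for i
      using member_le_sum[of i "{..<d}" "\<lambda>i. (cmod (of_re_im x i))\<^sup>2"] that \<open>x \<in> ?S\<close> by (auto simp: sqsum_def)
    then have "supnorm d (of_re_im x) \<le> 1"
      by (auto simp: supnorm_le_iff abs_square_le_1)
    moreover have "of_re_im x i = 0" if "i \<ge> d" for i
      using that \<open>x \<in> ?S\<close> by (auto simp: of_re_im_def complex_eq_iff)
    moreover have "of_re_im x \<noteq> (\<lambda>_. 0)" using that by (auto simp: sqsum_def)
    ultimately show ?thesis by (simp add: pdisc_alt)
  qed
  have csq: "continuous_on S (\<lambda>x. sqsum d (k x))" if "continuous_on S k" for k and S :: "'z::topological_space set"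
    by (rule continuous_on_compose2[OF continuous_on_sqsum that]) auto
  have cf: "continuous_on ?P f"
  proof -
    have "continuous_on ?P (\<lambda>z. nz z i)" for i
      unfolding nz_def using sqsum_pos[of _ d]
      by (intro continuous_on_mult continuous_on_of_real continuous_on_divide continuous_on_const
          continuous_on_real_sqrt csq continuous_on_id continuous_on_component[OF continuous_on_id])
         (auto simp: order_less_imp_not_eq2)
    then have "continuous_on ?P (\<lambda>z. re_im (nz z) i)" for i
      by (cases "even i") (auto simp: re_im_def intro!: continuous_on_Re continuous_on_Im)
    then show ?thesis unfolding f_def
      by (intro continuous_on_coordinatewise_then_product)
  qed
  have cg: "continuous_on ?S of_re_im"
  proof -
    have "continuous_on ?S (\<lambda>x. complex_of_real (x (2*i)) + \<i> * complex_of_real (x (2*i+1)))" for i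
      by (intro continuous_on_add continuous_on_mult continuous_on_const continuous_on_of_real
          continuous_on_component[OF continuous_on_id])
    then show ?thesis unfolding of_re_im_def Complex_eq
      by (intro continuous_on_coordinatewise_then_product)
  qed
  show ?thesis unfolding homotopy_equivalent_space_def nsphere_odd[OF assms]
  proof (intro exI conjI)
    show "continuous_map (top_of_set ?P) (top_of_set ?S) f" using cf fim by auto
    show "continuous_map (top_of_set ?S) (top_of_set ?P) of_re_im" using cg gim by auto
    show "homotopic_with (\<lambda>x. True) (top_of_set ?S) (top_of_set ?S) (f \<circ> of_re_im) id"
    proof (rule homotopic_with_equal)
      show "continuous_map (top_of_set ?S) (top_of_set ?S) (f \<circ> of_re_im)"
      proof (rule continuous_map_compose[of _ "top_of_set ?P"])
        show "continuous_map (top_of_set ?S) (top_of_set ?P) of_re_im" using cg gim by auto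
        show "continuous_map (top_of_set ?P) (top_of_set ?S) f" using cf fim by auto
      qed
    qed (auto simp: f_def nz_def)
    have "homotopic_with (\<lambda>x. True) (top_of_set ?P) (top_of_set ?P) id (of_re_im \<circ> f)"
      unfolding homotopic_with_def
    proof (intro exI conjI allI ballI)
      let ?h = "\<lambda>y::real \<times> (nat \<Rightarrow> complex). \<lambda>i. of_real ((1 - fst y) + fst y / sqrt (sqsum d (snd y))) * snd y i"
      have "continuous_on ({0..1} \<times> ?P) ?h"
        using sqsum_pos[of _ d]
        by (intro continuous_on_coordinatewise_then_product continuous_on_mult continuous_on_of_real
          continuous_on_add continuous_on_diff continuous_on_divide continuous_on_const
          continuous_on_real_sqrt csq
          continuous_on_fst[OF continuous_on_id] continuous_on_snd[OF continuous_on_id]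
        continuous_on_component[OF continuous_on_snd[OF continuous_on_id]])
        (auto simp: order_less_imp_not_eq2)
      moreover have "?h (t, z) \<in> ?P" if t: "t \<in> {0..1}" and z: "z \<in> ?P" for t z
      proof -
        let ?c = "(1 - t) + t / sqrt (sqsum d z)"
        have pos: "sqsum d z > 0" using z sqsum_pos by auto
        then have c: "?c > 0" using t by (cases "t = 0") (auto simp: add_nonneg_pos)
        have "nz z \<in> ?P" using gim[OF fim[OF z]] by (simp add: f_def)
        then have *: "supnorm d (nz z) \<le> 1" by (simp add: pdisc_alt)
        have "supnorm d (nz z) = supnorm d z / sqrt (sqsum d z)"
          unfolding nz_def by (subst supnorm_scale) (use pos in auto)
        then have "supnorm d (?h (t, z)) = (1 - t) * supnorm d z + t * supnorm d (nz z)"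
          using c by (simp only: fst_conv snd_conv, subst supnorm_scale) (auto simp: algebra_simps)
        also have "\<dots> \<le> (1 - t) * 1 + t * 1"
          using t z * by (intro add_mono mult_left_mono) (auto simp: pdisc_alt)
        finally have "?h (t, z) \<in> pdisc d" using z by (simp add: pdisc_alt)
        moreover have "?h (t, z) \<noteq> (\<lambda>_. 0)"
        proof -
          obtain i where "z i \<noteq> 0" using z by blast
          then have "?h (t, z) i \<noteq> 0" using c by (simp only: fst_conv snd_conv mult_eq_0_iff of_real_eq_0_iff) simp
          then show ?thesis by metis
        qed
        ultimately show ?thesis by simp
      qed
      ultimately show "continuous_map (prod_topology (top_of_set {0..1}) (top_of_set ?P)) (top_of_set ?P) ?h"
        by (force simp: image_subset_iff)
      show "?h (0, x) = id x" for x by simp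
      show "?h (1, x) = (of_re_im \<circ> f) x" for x by (simp add: f_def nz_def)
    qed auto
    then show "homotopic_with (\<lambda>x. True) (top_of_set ?P) (top_of_set ?P) (of_re_im \<circ> f) id"
      by (rule homotopic_with_symD)
  qed
qed

text \<open>Contractibility shifts the degree by one and leaves the reduced homology of a sphere of
  dimension 2d - 1. For d = 0 there is no sphere: the punctured part is empty and the dimension
  axiom applies.\<close>

lemma relative_homology_pdisc:
  "relative_homology_group (2 * int d) (top_of_set (pdisc d)) (pdisc d - {\<lambda>_. 0}) \<cong> integer_group"
  "p \<noteq> 2 * int d \<Longrightarrow> trivial_group (relative_homology_group p (top_of_set (pdisc d)) (pdisc d - {\<lambda>_. 0}))"
proof -
  let ?o = "\<lambda>_::nat. 0::complex"
  let ?P = "pdisc d - {?o}"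
  have "relative_homology_group (2 * int d) (top_of_set (pdisc d)) ?P \<cong> integer_group \<and>
   (p \<noteq> 2 * int d \<longrightarrow> trivial_group (relative_homology_group p (top_of_set (pdisc d)) ?P))"
  proof (cases "d = 0")
    case True
    have "pdisc d = {?o}" using True by (auto simp: pdisc_def fun_eq_iff)
    then show ?thesis using True homology_coefficients[of "top_of_set (pdisc d)" ?o]
        homology_dimension_axiom[of "top_of_set (pdisc d)" ?o p] by auto
  next
    case False
    then have d: "d > 0" by simp
    have "(\<lambda>i. if i = 0 then 1 else 0) \<in> ?P" using d by (auto simp: pdisc_def fun_eq_iff)
    then have ne: "topspace (top_of_set (pdisc d)) \<inter> ?P \<noteq> {}" by auto
    have sub: "subtopology (top_of_set (pdisc d)) ?P = top_of_set ?P"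
      by (simp add: subtopology_subtopology Int_absorb1)
    have iso: "relative_homology_group q (top_of_set (pdisc d)) ?P \<cong>
       reduced_homology_group (q - 1) (nsphere (2 * d - 1))" for q
      using isomorphic_group_relative_homology_of_contractible[OF _ ne, of q] contractible_pdisc[of d]
        homotopy_equivalent_space_imp_isomorphic_reduced_homology_groups[OF
          punctured_pdisc_homotopy_equivalent_sphere[OF d], of "q - 1"]
      unfolding sub by (auto intro: iso_trans)
    have eq: "2 * int d - 1 = int (2 * d - 1)" using d by simp
    have 1: "relative_homology_group (2 * int d) (top_of_set (pdisc d)) ?P \<cong> integer_group"
      using iso[of "2 * int d"] reduced_homology_group_nsphere(1)[of "2*d-1"] unfolding eq
      by (rule iso_trans)
    have 2: "trivial_group (relative_homology_group p (top_of_set (pdisc d)) ?P)" if "p \<noteq> 2 * int d"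
    proof -
      have "p - 1 \<noteq> int (2 * d - 1)" using that eq by linarith
      from reduced_homology_group_nsphere(2)[OF this] show ?thesis
        using isomorphic_group_triviality[OF iso[of p]] by simp
    qed
    show ?thesis using 1 2 by blast
  qed
  then show "relative_homology_group (2 * int d) (top_of_set (pdisc d)) ?P \<cong> integer_group"
  "p \<noteq> 2 * int d \<Longrightarrow> trivial_group (relative_homology_group p (top_of_set (pdisc d)) ?P)"
    by auto
qed

section \<open>Even free homology\<close>

lemma free_Abelian_group_insert:
  assumes "x \<notin> S"
  shows "free_Abelian_group S \<times>\<times> integer_group \<cong> free_Abelian_group (insert x S)"
proof -
  let ?f = "\<lambda>(u, k). u + frag_cmul k (frag_of x)"
  let ?g = "\<lambda>y. (y - frag_cmul (Poly_Mapping.lookup y x) (frag_of x), Poly_Mapping.lookup y x)"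
  have "?f \<in> iso (free_Abelian_group S \<times>\<times> integer_group) (free_Abelian_group (insert x S))"
  proof (rule isoI)
    show "?f \<in> hom (free_Abelian_group S \<times>\<times> integer_group) (free_Abelian_group (insert x S))"
    proof (rule homI)
      fix y assume "y \<in> carrier (free_Abelian_group S \<times>\<times> integer_group)"
      then show "?f y \<in> carrier (free_Abelian_group (insert x S))"
        by (auto simp: DirProd_def in_keys_iff lookup_add subset_iff split: if_splits)
    qed (auto simp: DirProd_def frag_cmul_distrib algebra_simps integer_group_def)
    show "bij_betw ?f (carrier (free_Abelian_group S \<times>\<times> integer_group)) (carrier (free_Abelian_group (insert x S)))"
    proof (rule bij_betwI[where g = ?g])
      show "?g \<in> carrier (free_Abelian_group (insert x S)) \<rightarrow> carrier (free_Abelian_group S \<times>\<times> integer_group)"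
        by (auto simp: DirProd_def in_keys_iff lookup_minus subset_iff integer_group_def split: if_splits)
      show "?g (?f y) = y" if "y \<in> carrier (free_Abelian_group S \<times>\<times> integer_group)" for y
      proof -
        obtain u k where y: "y = (u, k)" by (cases y)
        have "Poly_Mapping.lookup u x = 0"
          using that assms y by (auto simp: DirProd_def in_keys_iff subset_iff)
        then have "Poly_Mapping.lookup (u + frag_cmul k (frag_of x)) x = k"
          by (simp add: lookup_add)
        then show ?thesis using y by simp
      qed
      show "?f \<in> carrier (free_Abelian_group S \<times>\<times> integer_group) \<rightarrow> carrier (free_Abelian_group (insert x S))"
        by (auto simp: DirProd_def in_keys_iff lookup_add subset_iff split: if_splits)
    qed auto
  qed
  then show ?thesis by (rule is_isoI)
qed

text \<open>A short exact sequence ending in the integers splits: choose a preimage \<open>b\<close>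
  of a generator and send \<open>k\<close> to the k-th power of \<open>b\<close>.\<close>

lemma extension_by_integers:
  assumes "comm_group B" "group A" "group C" and f: "f \<in> hom A B" "inj_on f (carrier A)" and g: "g \<in> hom B C"
    and ker: "kernel B C g = f ` carrier A" and "g ` carrier B = carrier C" "C \<cong> integer_group"
  shows "A \<times>\<times> integer_group \<cong> B"
proof -
  interpret B: comm_group B by fact
  interpret A: group A by fact
  interpret C: group C by fact
  obtain \<gamma> where \<gamma>: "\<gamma> \<in> iso C integer_group" using assms(9) by (auto simp: is_iso_def)
  define \<delta> where "\<delta> = \<gamma> \<circ> g"
  have \<gamma>h: "\<gamma> \<in> hom C integer_group" and \<gamma>b: "bij_betw \<gamma> (carrier C) UNIV"
    using \<gamma> by (auto simp: iso_def integer_group_def)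
  have \<delta>: "\<delta> \<in> hom B integer_group"
    unfolding \<delta>_def using g \<gamma>h by (rule hom_compose)
  interpret d: group_hom B integer_group \<delta>
    by (simp add: group_hom_def group_hom_axioms_def \<delta>)
  interpret gg: group_hom C integer_group \<gamma>
    by (simp add: group_hom_def group_hom_axioms_def \<gamma>h)
  interpret f: group_hom A B f
    by (simp add: group_hom_def group_hom_axioms_def f)
  have kd: "\<delta> y = 0 \<longleftrightarrow> y \<in> f ` carrier A" if "y \<in> carrier B" for y
  proof -
    have gy: "g y \<in> carrier C" using g that by (auto simp: hom_def)
    have "\<gamma> \<one>\<^bsub>C\<^esub> = 0" using gg.hom_one by (simp add: integer_group_def)
    then have "\<delta> y = 0 \<longleftrightarrow> g y = \<one>\<^bsub>C\<^esub>"
      using \<gamma>b gy unfolding \<delta>_def bij_betw_def inj_on_def by (metis C.one_closed comp_apply)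
    then show ?thesis using ker that by (auto simp: kernel_def)
  qed
  obtain c where c: "c \<in> carrier C" "\<gamma> c = 1" using \<gamma>b unfolding bij_betw_def by (metis UNIV_I imageE)
  then obtain b where b: "b \<in> carrier B" "\<delta> b = 1" using assms(8) unfolding \<delta>_def by (metis comp_apply imageE)
  have db: "\<delta> (b [^]\<^bsub>B\<^esub> k) = k" for k :: int
    using d.hom_int_pow[of b k] b by (simp add: int_pow_int)
  let ?h = "\<lambda>(x, k::int). f x \<otimes>\<^bsub>B\<^esub> b [^]\<^bsub>B\<^esub> k"
  have car: "carrier (A \<times>\<times> integer_group) = carrier A \<times> UNIV" by (simp add: DirProd_def integer_group_def)
  have dmult: "\<delta> (x \<otimes>\<^bsub>B\<^esub> y) = \<delta> x + \<delta> y" if "x \<in> carrier B" "y \<in> carrier B" for x y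
    using d.hom_mult[OF that] by (simp add: integer_group_def)
  have fd: "\<delta> (f x) = 0" if "x \<in> carrier A" for x using kd[of "f x"] that by auto
  have "?h \<in> iso (A \<times>\<times> integer_group) B"
  proof (rule isoI)
    show hh: "?h \<in> hom (A \<times>\<times> integer_group) B"
    proof (rule homI)
      fix x y assume "x \<in> carrier (A \<times>\<times> integer_group)" "y \<in> carrier (A \<times>\<times> integer_group)"
      then show "?h (x \<otimes>\<^bsub>A \<times>\<times> integer_group\<^esub> y) = ?h x \<otimes>\<^bsub>B\<^esub> ?h y"
        using b by (auto simp: DirProd_def integer_group_def B.int_pow_mult B.m_ac)
    qed (use b in \<open>auto simp: car\<close>)
    interpret h: group_hom "A \<times>\<times> integer_group" B ?h
      by (simp add: group_hom_def group_hom_axioms_def hh DirProd_group)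
    show "bij_betw ?h (carrier (A \<times>\<times> integer_group)) (carrier B)"
      unfolding bij_betw_def
    proof
      show "inj_on ?h (carrier (A \<times>\<times> integer_group))"
      proof (rule h.inj_on_one_iff[THEN iffD2], intro allI impI)
        fix y assume y: "y \<in> carrier (A \<times>\<times> integer_group)" "?h y = \<one>\<^bsub>B\<^esub>"
        obtain x k where xk: "y = (x, k)" "x \<in> carrier A" using y by (auto simp: car)
        have "\<delta> (?h y) = k" using xk b by (simp add: dmult fd db)
        then have "k = 0" using y(2) d.hom_one by (simp add: integer_group_def)
        then have "f x = \<one>\<^bsub>B\<^esub>" using y(2) xk b by simp
        then have "x = \<one>\<^bsub>A\<^esub>" using f.inj_on_one_iff f(2) xk by blast
        then show "y = \<one>\<^bsub>A \<times>\<times> integer_group\<^esub>" using \<open>k = 0\<close> xk by (simp add: DirProd_def integer_group_def)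
      qed
      show "?h ` carrier (A \<times>\<times> integer_group) = carrier B"
      proof
        show "?h ` carrier (A \<times>\<times> integer_group) \<subseteq> carrier B" using h.hom_closed by blast
        show "carrier B \<subseteq> ?h ` carrier (A \<times>\<times> integer_group)"
        proof
          fix y assume y: "y \<in> carrier B"
          let ?k = "\<delta> y"
          have "\<delta> (y \<otimes>\<^bsub>B\<^esub> b [^]\<^bsub>B\<^esub> (- ?k)) = 0" using y b by (simp only: dmult B.int_pow_closed db)
          then obtain x where x: "x \<in> carrier A" "y \<otimes>\<^bsub>B\<^esub> b [^]\<^bsub>B\<^esub> (- ?k) = f x"
            using kd[of "y \<otimes>\<^bsub>B\<^esub> b [^]\<^bsub>B\<^esub> (- ?k)"] y b by auto
          have "f x \<otimes>\<^bsub>B\<^esub> b [^]\<^bsub>B\<^esub> ?k = y"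
            unfolding x(2)[symmetric] using y b by (simp add: B.m_assoc B.int_pow_mult[symmetric])
          then show "y \<in> ?h ` carrier (A \<times>\<times> integer_group)"
            using x(1) by (intro image_eqI[of _ _ "(x, ?k)"]) (auto simp: car)
        qed
      qed
    qed
  qed
  then show ?thesis by (rule is_isoI)
qed

definition even_free_homology :: "'a topology \<Rightarrow> (nat \<Rightarrow> nat) \<Rightarrow> bool" where
  "even_free_homology X c \<longleftrightarrow> (\<forall>p. odd p \<longrightarrow> trivial_group (homology_group p X)) \<and>
     (\<forall>k. homology_group (2 * int k) X \<cong> free_Abelian_group {..<c k})"

lemma trivial_groups_isomorphic:
  assumes "trivial_group G" "trivial_group H" shows "G \<cong> H"
proof -
  have "(\<lambda>_. \<one>\<^bsub>H\<^esub>) \<in> iso G H"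
    using assms by (auto simp: trivial_group_def iso_def hom_def bij_betw_def group.is_monoid monoid.l_one)
  then show ?thesis by (rule is_isoI)
qed

lemma even_free_homology_empty: "even_free_homology (top_of_set ({} :: 'a::topological_space set)) (\<lambda>_. 0)"
proof -
  have t: "trivial_group (free_Abelian_group ({}::nat set))"
    using group_free_Abelian_group[of "{}::nat set"] by (auto simp: trivial_group_def)
  have "trivial_group (homology_group p (top_of_set ({} :: 'a set)))" for p
    by (rule trivial_homology_group_empty) simp
  note * = this
  show ?thesis unfolding even_free_homology_def
    using * trivial_groups_isomorphic[OF *[of "2 * int _"] t] by simp
qed

text \<open>The relative homology lives in degree 2d alone. In the long exact sequence its possible
  partners are odd: the relative group in degree 2d + 1 and the homology of \<open>A\<close> in
  degree 2d - 1 both vanish. So every boundary map is zero, the other degrees are unchanged, and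
  degree 2d is an extension by the integers.\<close>

lemma even_free_homology_cell_attach:
  fixes A :: "'a::t2_space set"
  assumes ev: "even_free_homology (top_of_set A) c"
    and cell: "cell_attach d A \<phi>" and "closed A" and X: "X = A \<union> \<phi> ` pdisc d"
  shows "even_free_homology (top_of_set X) (c(d := Suc (c d)))"
proof -
  let ?X = "top_of_set X"
  have sub: "subtopology ?X A = top_of_set A"
    using X by (simp add: subtopology_subtopology Int_absorb1)
  have rel: "relative_homology_group p ?X A \<cong>
     relative_homology_group p (top_of_set (pdisc d)) (pdisc d - {\<lambda>_. 0})" for p
    by (rule relative_homology_cell_attach[OF cell \<open>closed A\<close> X])
  have relt: "trivial_group (relative_homology_group p ?X A)" if "p \<noteq> 2 * int d" for p
    using relative_homology_pdisc(2)[OF that] isomorphic_group_triviality[OF rel[of p]] by simp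
  have relZ: "relative_homology_group (2 * int d) ?X A \<cong> integer_group"
    using rel relative_homology_pdisc(1) by (rule iso_trans)
  have oddA: "trivial_group (homology_group p (top_of_set A))" if "odd p" for p
    using ev that by (simp add: even_free_homology_def)
  have evA: "homology_group (2 * int k) (top_of_set A) \<cong> free_Abelian_group {..<c k}" for k
    using ev by (simp add: even_free_homology_def)
  have ex: "exact_seq ([homology_group (p - 1) (top_of_set A), relative_homology_group p ?X A, homology_group p ?X,
       homology_group p (top_of_set A), relative_homology_group (p + 1) ?X A],
     [hom_boundary p ?X A, hom_induced p ?X {} ?X A id, hom_induced p (top_of_set A) {} ?X {} id,
       hom_boundary (p + 1) ?X A])" for p
    using homology_exactness_axiom_1[of p ?X A] homology_exactness_axiom_2[of "p + 1" ?X A]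
      homology_exactness_axiom_3[of p ?X A] unfolding sub by simp
  have odd: "trivial_group (homology_group p ?X)" if "odd p" for p
  proof -
    have "p \<noteq> 2 * int d" using that by presburger
    then have "trivial_group (relative_homology_group p ?X A)" by (rule relt)
    then have "carrier (homology_group p ?X) =
        kernel (homology_group p ?X) (relative_homology_group p ?X A) (hom_induced p ?X {} ?X A id)"
      using hom_carrier[OF hom_induced_hom, of p ?X "{}" ?X A id] by (auto simp: kernel_def trivial_group_def)
    also have "\<dots> = hom_induced p (top_of_set A) {} ?X {} id ` carrier (homology_group p (top_of_set A))"
      using ex[of p] by simp
    also have "\<dots> = {\<one>\<^bsub>homology_group p ?X\<^esub>}"
      using oddA[OF that] hom_one[OF hom_induced_hom, of p "top_of_set A" "{}" ?X "{}" id]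
      by (simp add: trivial_group_def)
    finally show ?thesis by (simp add: trivial_group_def)
  qed
  have ev1: "homology_group (2 * int k) ?X \<cong> free_Abelian_group {..<c k}" if "k \<noteq> d" for k
  proof -
    have "trivial_group (relative_homology_group (2 * int k + 1) ?X A)"
      "trivial_group (relative_homology_group (2 * int k) ?X A)"
      using that by (intro relt; presburger)+
    then have "hom_induced (2 * int k) (top_of_set A) {} ?X {} id
        \<in> iso (homology_group (2 * int k) (top_of_set A)) (homology_group (2 * int k) ?X)"
      using very_short_exact_sequence[of "relative_homology_group (2 * int k) ?X A" "homology_group (2 * int k) ?X"
         "homology_group (2 * int k) (top_of_set A)" "relative_homology_group (2 * int k + 1) ?X A"
         "hom_induced (2 * int k) ?X {} ?X A id" "hom_induced (2 * int k) (top_of_set A) {} ?X {} id"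
         "hom_boundary (2 * int k + 1) ?X A"] ex[of "2 * int k"] by simp
    then have "homology_group (2 * int k) (top_of_set A) \<cong> homology_group (2 * int k) ?X" by (rule is_isoI)
    then show ?thesis using evA[of k] by (meson group.iso_sym group_relative_homology_group iso_trans)
  qed
  have ev2: "homology_group (2 * int d) ?X \<cong> free_Abelian_group {..<Suc (c d)}"
  proof -
    let ?p = "2 * int d"
    have t1: "trivial_group (relative_homology_group (?p + 1) ?X A)" by (rule relt) presburger
    have t2: "trivial_group (homology_group (?p - 1) (top_of_set A))" by (rule oddA) simp
    have e3: "kernel (homology_group ?p ?X) (relative_homology_group ?p ?X A) (hom_induced ?p ?X {} ?X A id) =
       hom_induced ?p (top_of_set A) {} ?X {} id ` carrier (homology_group ?p (top_of_set A))"
      using ex[of ?p] by simp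
    have "homology_group ?p (top_of_set A) \<times>\<times> integer_group \<cong> homology_group ?p ?X"
    proof (rule extension_by_integers[where f = "hom_induced ?p (top_of_set A) {} ?X {} id"
            and g = "hom_induced ?p ?X {} ?X A id" and C = "relative_homology_group ?p ?X A"])
      show "inj_on (hom_induced ?p (top_of_set A) {} ?X {} id) (carrier (homology_group ?p (top_of_set A)))"
      proof -
        have "kernel (homology_group ?p (top_of_set A)) (homology_group ?p ?X) (hom_induced ?p (top_of_set A) {} ?X {} id)
          = hom_boundary (?p + 1) ?X A ` carrier (relative_homology_group (?p + 1) ?X A)"
          using ex[of ?p] by simp
        also have "\<dots> = {\<one>\<^bsub>homology_group ?p (top_of_set A)\<^esub>}"
          using t1 hom_one[OF hom_boundary_hom, of "?p + 1" ?X A] by (simp add: trivial_group_def sub)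
        finally show ?thesis
          by (intro group_hom.trivial_ker_imp_inj)
             (simp_all add: group_hom_def group_hom_axioms_def hom_induced_hom)
      qed
      show "hom_induced ?p ?X {} ?X A id ` carrier (homology_group ?p ?X) = carrier (relative_homology_group ?p ?X A)"
      proof -
        have "kernel (relative_homology_group ?p ?X A) (homology_group (?p - 1) (top_of_set A)) (hom_boundary ?p ?X A)
          = hom_induced ?p ?X {} ?X A id ` carrier (homology_group ?p ?X)"
          using ex[of ?p] by simp
        moreover have "carrier (relative_homology_group ?p ?X A) =
            kernel (relative_homology_group ?p ?X A) (homology_group (?p - 1) (top_of_set A)) (hom_boundary ?p ?X A)"
          using t2 hom_carrier[OF hom_boundary_hom, of ?p ?X A] by (auto simp: kernel_def trivial_group_def sub)
        ultimately show ?thesis by simp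
      qed
    qed (use e3 relZ in \<open>simp_all add: abelian_homology_group hom_induced_hom\<close>)
    moreover have "homology_group ?p (top_of_set A) \<times>\<times> integer_group \<cong> free_Abelian_group {..<c d} \<times>\<times> integer_group"
      using evA[of d] by (intro group.DirProd_iso_trans iso_refl) auto
    moreover have "free_Abelian_group {..<c d} \<times>\<times> integer_group \<cong> free_Abelian_group {..<Suc (c d)}"
      using free_Abelian_group_insert[of "c d" "{..<c d}"] by (simp add: lessThan_Suc)
    ultimately show ?thesis
      by (meson DirProd_group group.iso_sym group_integer_group group_relative_homology_group iso_trans)
  qed
  show ?thesis unfolding even_free_homology_def using odd ev1 ev2 by (auto simp: fun_upd_def)
qed

section \<open>Frames, phases and rotations\<close>

type_synonym frame = "nat \<Rightarrow> cvec"

definition ip :: "nat \<Rightarrow> cvec \<Rightarrow> cvec \<Rightarrow> complex" where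
  "ip N u v = (\<Sum>a\<in>{1..N}. u a * cnj (v a))"

text \<open>For orthonormal columns this is the (a, b) entry of the orthogonal projection onto their
  span, which is how frames meet the encoding of flags by projections.\<close>

definition frame_sum :: "nat set \<Rightarrow> frame \<Rightarrow> nat \<Rightarrow> nat \<Rightarrow> complex" where
  "frame_sum S F a b = (\<Sum>l\<in>S. F l a * cnj (F l b))"

text \<open>Vanishing outside \<open>S\<close> and outside 1, ..., N leaves no junk values, so
  frames can be compared as functions and \<open>phase_eq\<close> can be required for all
  columns.\<close>

definition ortho :: "nat \<Rightarrow> nat set \<Rightarrow> frame \<Rightarrow> bool" where
  "ortho N S F \<longleftrightarrow> (\<forall>l\<in>S. \<forall>l'\<in>S. ip N (F l) (F l') = (if l = l' then 1 else 0)) \<and>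
     (\<forall>l a. l \<notin> S \<or> a \<notin> {1..N} \<longrightarrow> F l a = 0)"

text \<open>Each column has its own phase: the classes are torus orbits, and on full orthonormal
  frames they are the fibres of the map to flags.\<close>

definition phase_eq :: "frame \<Rightarrow> frame \<Rightarrow> bool" where
  "phase_eq F G \<longleftrightarrow> (\<forall>l. \<exists>t. cmod t = 1 \<and> (\<forall>a. G l a = t * F l a))"

definition sn :: "complex \<Rightarrow> complex" where
  "sn z = complex_of_real (sqrt (1 - (cmod z)\<^sup>2))"

text \<open>Columns \<open>q\<close>, \<open>q'\<close> are multiplied by an SU(2) matrix, which is diagonal when \<open>\<bar>z\<bar> = 1\<close>: boundary values of \<open>z\<close> only change phases.\<close>
definition rot :: "nat \<Rightarrow> nat \<Rightarrow> complex \<Rightarrow> frame \<Rightarrow> frame" where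
  "rot q q' z F = (\<lambda>l. if l = q then (\<lambda>a. z * F q a + (- sn z) * F q' a)
     else if l = q' then (\<lambda>a. sn z * F q a + cnj z * F q' a) else F l)"

lemma ip_lin1: "ip N (\<lambda>a. x * u a + y * v a) w = x * ip N u w + y * ip N v w"
  by (simp add: ip_def sum.distrib sum_distrib_left algebra_simps)

lemma ip_lin2: "ip N w (\<lambda>a. x * u a + y * v a) = cnj x * ip N w u + cnj y * ip N w v"
  by (simp add: ip_def sum.distrib sum_distrib_left algebra_simps)

lemma ip_diff1: "ip N (\<lambda>a. x * u a - y * v a) w = x * ip N u w - y * ip N v w"
  using ip_lin1[of N x u "-y" v w] by simp

lemma ip_diff2: "ip N w (\<lambda>a. x * u a - y * v a) = cnj x * ip N w u - cnj y * ip N w v"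
  using ip_lin2[of N w x u "-y" v] by simp

lemma ip_scale1: "ip N (\<lambda>a. x * u a) w = x * ip N u w"
  using ip_lin1[of N x u 0 u w] by simp

lemma ip_scale2: "ip N w (\<lambda>a. x * u a) = cnj x * ip N w u"
  using ip_lin2[of N w x u 0 u] by simp

lemma ip_cnj: "cnj (ip N u v) = ip N v u"
  by (simp add: ip_def mult.commute)

lemma ip_sum1: "ip N (\<lambda>a. \<Sum>l\<in>S. c l * u l a) w = (\<Sum>l\<in>S. c l * ip N (u l) w)"
  unfolding ip_def by (simp add: sum_distrib_right sum_distrib_left mult.assoc) (rule sum.swap)

lemma mult_cnj_norm: "z * cnj z = complex_of_real ((cmod z)\<^sup>2)"
  by (rule complex_norm_square[symmetric])

lemma ip_self: "ip N u u = of_real (\<Sum>a\<in>{1..N}. (cmod (u a))\<^sup>2)"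
  unfolding ip_def mult_cnj_norm by (simp only: of_real_sum)

lemma sn_cnj [simp]: "cnj (sn z) = sn z"
  by (simp add: sn_def)

lemma sn_sq: "cmod z \<le> 1 \<Longrightarrow> z * cnj z + sn z * sn z = 1"
proof -
  assume "cmod z \<le> 1"
  then have "(cmod z)\<^sup>2 \<le> 1" by (simp add: abs_square_le_1)
  then have "sn z * sn z = of_real (1 - (cmod z)\<^sup>2)"
    unfolding sn_def of_real_mult[symmetric] by (simp add: power2_eq_square[symmetric])
  then show ?thesis unfolding mult_cnj_norm by simp
qed

lemma sn_1 [simp]: "cmod z = 1 \<Longrightarrow> sn z = 0" by (simp add: sn_def)

lemma sn_nonzero: "cmod z < 1 \<Longrightarrow> sn z \<noteq> 0"
  by (simp add: sn_def abs_square_eq_1 flip: abs_square_less_1)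

lemma sn_cong: "cmod z = cmod w \<Longrightarrow> sn z = sn w"
  by (simp add: sn_def)

lemma unit_cnj: "cmod t = 1 \<Longrightarrow> t * cnj t = 1"
  unfolding mult_cnj_norm by simp

lemma phase_eq_refl [simp]: "phase_eq F F"
  unfolding phase_eq_def by (intro allI exI[of _ 1]) auto

lemma phase_eq_sym: "phase_eq F G \<Longrightarrow> phase_eq G F"
  unfolding phase_eq_def
proof (intro allI)
  fix l assume "\<forall>l. \<exists>t. cmod t = 1 \<and> (\<forall>a. G l a = t * F l a)"
  then obtain t where t: "cmod t = 1" "\<forall>a. G l a = t * F l a" by blast
  have "F l a = cnj t * G l a" for a
    using t unit_cnj[OF t(1)] by (simp add: mult.assoc[symmetric] mult.commute)
  then show "\<exists>t. cmod t = 1 \<and> (\<forall>a. F l a = t * G l a)" using t(1) by (intro exI[of _ "cnj t"]) auto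
qed

lemma phase_eq_trans: "phase_eq F G \<Longrightarrow> phase_eq G H \<Longrightarrow> phase_eq F H"
  unfolding phase_eq_def
proof (intro allI)
  fix l assume "\<forall>l. \<exists>t. cmod t = 1 \<and> (\<forall>a. G l a = t * F l a)" "\<forall>l. \<exists>t. cmod t = 1 \<and> (\<forall>a. H l a = t * G l a)"
  then obtain t s where "cmod t = 1" "\<forall>a. G l a = t * F l a" "cmod s = 1" "\<forall>a. H l a = s * G l a" by metis
  then show "\<exists>t. cmod t = 1 \<and> (\<forall>a. H l a = t * F l a)" by (intro exI[of _ "s * t"]) (auto simp: norm_mult)
qed

lemma phase_eq_frame_sum: "phase_eq F G \<Longrightarrow> frame_sum S G a b = frame_sum S F a b"
  unfolding frame_sum_def
proof (rule sum.cong[OF refl])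
  fix l assume "phase_eq F G"
  then obtain t where t: "cmod t = 1" "\<forall>a. G l a = t * F l a" unfolding phase_eq_def by blast
  then show "G l a * cnj (G l b) = F l a * cnj (F l b)"
    using unit_cnj[OF t(1)] by (simp add: algebra_simps)
qed

lemma phase_eq_ip_0: "phase_eq F G \<Longrightarrow> ip N (G l) e = 0 \<longleftrightarrow> ip N (F l) e = 0"
proof -
  assume "phase_eq F G"
  then obtain t where t: "cmod t = 1" "\<forall>a. G l a = t * F l a" unfolding phase_eq_def by blast
  then have "G l = (\<lambda>a. t * F l a)" by auto
  then show ?thesis using t(1) by (auto simp: ip_scale1)
qed

lemma phase_eq_component_0: "phase_eq F G \<Longrightarrow> G l a = 0 \<longleftrightarrow> F l a = 0"
  unfolding phase_eq_def by (metis mult_eq_0_iff norm_zero zero_neq_one)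

lemma phase_eq_ortho: "phase_eq F G \<Longrightarrow> ortho N S F \<Longrightarrow> ortho N S G"
  unfolding ortho_def
proof (intro conjI ballI allI impI)
  assume fe: "phase_eq F G" and o: "(\<forall>l\<in>S. \<forall>l'\<in>S. ip N (F l) (F l') = (if l = l' then 1 else 0)) \<and>
     (\<forall>l a. l \<notin> S \<or> a \<notin> {1..N} \<longrightarrow> F l a = 0)"
  show "G l a = 0" if "l \<notin> S \<or> a \<notin> {1..N}" for l a
    using o that phase_eq_component_0[OF fe] by blast
  fix l l' assume l: "l \<in> S" "l' \<in> S"
  obtain t where t: "cmod t = 1" "\<forall>a. G l a = t * F l a" using fe unfolding phase_eq_def by blast
  obtain t' where t': "cmod t' = 1" "\<forall>a. G l' a = t' * F l' a" using fe unfolding phase_eq_def by blast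
  have "G l = (\<lambda>a. t * F l a)" "G l' = (\<lambda>a. t' * F l' a)" using t t' by auto
  then have *: "ip N (G l) (G l') = t * cnj t' * (if l = l' then 1 else 0)" using o l
    by (simp add: ip_scale1 ip_scale2)
  show "ip N (G l) (G l') = (if l = l' then 1 else 0)"
  proof (cases "l = l'")
    case True
    then have "ip N (G l) (G l') = ip N (G l) (G l)" by simp
    also have "\<dots> = t * cnj t * ip N (F l) (F l)"
      using \<open>G l = (\<lambda>a. t * F l a)\<close> by (simp add: ip_scale1 ip_scale2)
    finally show ?thesis using True o l unit_cnj[OF t(1)] by simp
  qed (use * in simp)
qed

lemma rot_1 [simp]: "rot q q' 1 F = F"
  by (auto simp: rot_def fun_eq_iff)

text \<open>Exchanging the two columns replaces the SU(2) matrix by its conjugate transpose.\<close>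

lemma rot_inverse:
  assumes "cmod z \<le> 1" "q \<noteq> q'" shows "rot q q' z (rot q' q z F) = F"
proof -
  have e: "z * cnj z + sn z * sn z = 1" using sn_sq[OF assms(1)] .
  have 1: "z * (sn z * F q' a + cnj z * F q a) + - sn z * (z * F q' a + - sn z * F q a) = F q a" for a
  proof -
    have "z * (sn z * F q' a + cnj z * F q a) + - sn z * (z * F q' a + - sn z * F q a) = (z * cnj z + sn z * sn z) * F q a"
      by (simp add: algebra_simps)
    then show ?thesis using e by simp
  qed
  have 2: "sn z * (sn z * F q' a + cnj z * F q a) + cnj z * (z * F q' a + - sn z * F q a) = F q' a" for a
  proof -
    have "sn z * (sn z * F q' a + cnj z * F q a) + cnj z * (z * F q' a + - sn z * F q a) = (z * cnj z + sn z * sn z) * F q' a"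
      by (simp add: algebra_simps)
    then show ?thesis using e by simp
  qed
  show ?thesis using assms(2) 1 2 unfolding rot_def by (auto simp: fun_eq_iff)
qed

lemma rot_frame_sum:
  assumes "finite S" "q \<in> S" "q' \<in> S" "q \<noteq> q'" "cmod z \<le> 1"
  shows "frame_sum S (rot q q' z F) a b = frame_sum S F a b"
proof -
  have S: "S = insert q (insert q' (S - {q, q'}))" using assms by auto
  have sp: "frame_sum S G a b = G q a * cnj (G q b) + G q' a * cnj (G q' b) + (\<Sum>l\<in>S-{q,q'}. G l a * cnj (G l b))" for G
    unfolding frame_sum_def using assms by (subst S) (simp add: add.assoc)
  have "rot q q' z F q a * cnj (rot q q' z F q b) + rot q q' z F q' a * cnj (rot q q' z F q' b)
     = (z * cnj z + sn z * sn z) * (F q a * cnj (F q b) + F q' a * cnj (F q' b))"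
    using assms(4) by (simp add: rot_def algebra_simps)
  then show ?thesis unfolding sp using sn_sq[OF assms(5)]
    by (auto simp: rot_def intro!: sum.cong)
qed

lemma rot_ortho:
  assumes o: "ortho N S F" and q: "q \<in> S" "q' \<in> S" "q \<noteq> q'" "cmod z \<le> 1"
  shows "ortho N S (rot q q' z F)"
  unfolding ortho_def
proof (intro conjI ballI allI impI)
  show "rot q q' z F l a = 0" if "l \<notin> S \<or> a \<notin> {1..N}" for l a
    using o q that unfolding ortho_def rot_def by (cases "a \<in> {1..N}") auto
  have e: "z * cnj z + sn z * sn z = 1" using sn_sq[OF q(4)] .
  have io: "ip N (F l) (F l') = (if l = l' then 1 else 0)" if "l \<in> S" "l' \<in> S" for l l'
    using o that unfolding ortho_def by blast
  fix l l' assume l: "l \<in> S" "l' \<in> S"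
  have rq: "rot q q' z F q = (\<lambda>a. z * F q a + (- sn z) * F q' a)"
    "rot q q' z F q' = (\<lambda>a. sn z * F q a + cnj z * F q' a)" using q(3) by (auto simp: rot_def)
  have rl: "rot q q' z F l = F l" if "l \<noteq> q" "l \<noteq> q'" for l using that by (auto simp: rot_def)
  consider "l = q" | "l = q'" | "l \<noteq> q" "l \<noteq> q'" by blast
  then show "ip N (rot q q' z F l) (rot q q' z F l') = (if l = l' then 1 else 0)"
  proof cases
    case 1
    then show ?thesis using q l e
      by (cases "l' = q"; cases "l' = q'")
         (auto simp: rq rl ip_lin1 ip_lin2 ip_diff1 ip_diff2 io mult.commute)
  next
    case 2
    then show ?thesis using q l e
      by (cases "l' = q"; cases "l' = q'")
         (auto simp: rq rl ip_lin1 ip_lin2 ip_diff1 ip_diff2 io mult.commute add.commute)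
  next
    case 3
    then show ?thesis using q l e
      by (cases "l' = q"; cases "l' = q'")
         (auto simp: rq rl ip_lin1 ip_lin2 ip_diff1 ip_diff2 io)
  qed
qed

text \<open>Moving a diagonal matrix of phases through the SU(2) matrix multiplies \<open>z\<close>
  by a unit, and the two phases come out interchanged. So rotations act on phase classes up to a
  change of parameter that preserves the modulus.\<close>

lemma rot_phase:
  assumes "phase_eq F G" "q \<noteq> q'"
  shows "\<exists>w. cmod w = cmod z \<and> phase_eq (rot q q' w F) (rot q q' z G)"
proof -
  obtain t where t: "cmod t = 1" "\<And>a. G q a = t * F q a" using assms(1) unfolding phase_eq_def by blast
  obtain t' where t': "cmod t' = 1" "\<And>a. G q' a = t' * F q' a" using assms(1) unfolding phase_eq_def by blast
  let ?w = "z * t * cnj t'"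
  have w: "cmod ?w = cmod z" using t t' by (simp add: norm_mult)
  have s: "sn ?w = sn z" using w by (rule sn_cong)
  have tt: "t' * cnj t' = 1" "t * cnj t = 1" using t t' by (simp_all add: unit_cnj)
  have "phase_eq (rot q q' ?w F) (rot q q' z G)"
    unfolding phase_eq_def
  proof
    fix l
    consider "l = q" | "l = q'" "l \<noteq> q" | "l \<noteq> q" "l \<noteq> q'" by blast
    then show "\<exists>t. cmod t = 1 \<and> (\<forall>a. rot q q' z G l a = t * rot q q' ?w F l a)"
    proof cases
      case 1
      have "rot q q' z G l a = t' * rot q q' ?w F l a" for a
      proof -
        have "t' * rot q q' ?w F l a = (t' * cnj t') * (z * t * F q a) - t' * sn z * F q' a"
          using 1 s by (simp add: rot_def algebra_simps)
        then show ?thesis using 1 tt by (simp add: rot_def t t' algebra_simps)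
      qed
      then show ?thesis using t' by blast
    next
      case 2
      have "rot q q' z G l a = t * rot q q' ?w F l a" for a
      proof -
        have "t * rot q q' ?w F l a = t * sn z * F q a + (t * cnj t) * (cnj z * t' * F q' a)"
          using 2 s by (simp add: rot_def algebra_simps)
        then show ?thesis using 2 tt by (simp add: rot_def t t' algebra_simps)
      qed
      then show ?thesis using t by blast
    next
      case 3
      then show ?thesis using assms(1) unfolding phase_eq_def rot_def by simp
    qed
  qed
  then show ?thesis using w by blast
qed

lemma continuous_on_rot:
  fixes f :: "'a::topological_space \<Rightarrow> frame"
  assumes "continuous_on S w" "continuous_on S f"
  shows "continuous_on S (\<lambda>x. rot q q' (w x) (f x))"
proof -
  have c: "continuous_on S (\<lambda>x. f x l a)" for l a
    by (rule continuous_on_component[OF continuous_on_component[OF assms(2)]])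
  have s: "continuous_on S (\<lambda>x. sn (w x))" unfolding sn_def
    by (intro continuous_on_of_real continuous_on_real_sqrt continuous_on_diff continuous_on_const
        continuous_on_power continuous_on_norm assms)
  have 1: "continuous_on S (\<lambda>x. w x * f x q a + (- sn (w x)) * f x q' a)"
    "continuous_on S (\<lambda>x. sn (w x) * f x q a + cnj (w x) * f x q' a)" for a
    by (intro continuous_on_add continuous_on_mult continuous_on_minus continuous_on_cnj c s assms)+
  have "continuous_on S (\<lambda>x. rot q q' (w x) (f x) l a)" for l a
    using 1[of a] c[of l a] unfolding rot_def
    by (cases "l = q"; cases "l = q'") (simp_all only: if_True if_False simp_thms)
  then show ?thesis
    by (rule continuous_on_coordinatewise_then_product[OF continuous_on_coordinatewise_then_product])
qed

section \<open>Chains of rotations along a sequence of columns\<close>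

primrec chain :: "(nat \<Rightarrow> nat) \<Rightarrow> nat \<Rightarrow> (nat \<Rightarrow> complex) \<Rightarrow> frame \<Rightarrow> frame" where
  "chain q 0 z F = F"
| "chain q (Suc r) z F = rot (q r) (q (Suc r)) (z r) (chain q r z F)"

lemma chain_cong: "(\<And>i. i < r \<Longrightarrow> z i = w i) \<Longrightarrow> chain q r z F = chain q r w F"
  by (induction r) auto

lemma chain_outside: "l \<notin> q ` {..r} \<Longrightarrow> chain q r z F l = F l"
  by (induction r) (auto simp: rot_def atMost_Suc)

lemma continuous_on_chain:
  fixes f :: "'a::topological_space \<Rightarrow> frame"
  assumes "continuous_on S w" "continuous_on S f"
  shows "continuous_on S (\<lambda>x. chain q r (w x) (f x))"
proof (induction r)
  case (Suc r)
  show ?case unfolding chain.simps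
    by (intro continuous_on_rot continuous_on_component[OF assms(1)] Suc)
qed (simp add: assms)

lemma inj_on_Suc_neq: "inj_on q {..r} \<Longrightarrow> i < r \<Longrightarrow> q i \<noteq> q (Suc i)"
  unfolding inj_on_def by (metis Suc_leI atMost_iff less_imp_le n_not_Suc_n)

lemma pdisc_le: "z \<in> pdisc r \<Longrightarrow> \<forall>i<r. cmod (z i) \<le> 1"
  by (auto simp: pdisc_def split: if_splits)

lemma chain_ortho:
  assumes "ortho N S F" "inj_on q {..r}" "q ` {..r} \<subseteq> S" "\<forall>i<r. cmod (z i) \<le> 1" "m \<le> r"
  shows "ortho N S (chain q m z F)"
  using \<open>m \<le> r\<close>
proof (induction m)
  case (Suc m)
  then show ?case using assms inj_on_Suc_neq[of q r m]
    by (auto intro!: rot_ortho)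
qed (use assms in simp)

lemma chain_frame_sum:
  assumes "finite S" "inj_on q {..r}" "q ` {..r} \<subseteq> S" "\<forall>i<r. cmod (z i) \<le> 1" "m \<le> r"
  shows "frame_sum S (chain q m z F) a b = frame_sum S F a b"
  using \<open>m \<le> r\<close>
proof (induction m)
  case (Suc m)
  then show ?case using assms inj_on_Suc_neq[of q r m]
    by (simp, subst rot_frame_sum) auto
qed simp

lemma chain_phase:
  assumes "phase_eq F G" "inj_on q {..r}" "z \<in> pdisc r"
  shows "\<exists>w\<in>pdisc r. (\<forall>i. cmod (w i) = cmod (z i)) \<and> phase_eq (chain q r w F) (chain q r z G)"
proof -
  have "\<exists>w. (\<forall>i. cmod (w i) = cmod (z i)) \<and> phase_eq (chain q m w F) (chain q m z G)" if "m \<le> r" for m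
    using that
  proof (induction m)
    case 0
    then show ?case using assms by auto
  next
    case (Suc m)
    then obtain w where w: "\<forall>i. cmod (w i) = cmod (z i)" "phase_eq (chain q m w F) (chain q m z G)" by auto
    obtain u where u: "cmod u = cmod (z m)"
      "phase_eq (rot (q m) (q (Suc m)) u (chain q m w F)) (rot (q m) (q (Suc m)) (z m) (chain q m z G))"
      using rot_phase[OF w(2), of "q m" "q (Suc m)"] inj_on_Suc_neq[OF assms(2), of m] Suc.prems by auto
    have "chain q m (w(m := u)) F = chain q m w F" by (rule chain_cong) auto
    then show ?case using w u by (intro exI[of _ "w(m := u)"]) (auto simp del: fun_upd_apply, auto)
  qed
  then obtain w where "\<forall>i. cmod (w i) = cmod (z i)" "phase_eq (chain q r w F) (chain q r z G)" by blast
  then show ?thesis using assms(3) by (intro bexI[of _ w]) (auto simp: pdisc_def)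
qed

lemma inj_on_notin: "inj_on q {..r} \<Longrightarrow> m < j \<Longrightarrow> j \<le> r \<Longrightarrow> q j \<notin> q ` {..m}"
  for q :: "nat \<Rightarrow> nat"
proof
  assume a: "inj_on q {..r}" "m < j" "j \<le> r" "q j \<in> q ` {..m}"
  then obtain i where "i \<le> m" "q j = q i" by auto
  moreover have "i \<le> r" using \<open>i \<le> m\<close> a(2,3) by linarith
  ultimately have "j = i" using inj_onD[OF a(1), of j i] a(3) by simp
  then show False using \<open>i \<le> m\<close> a(2) by simp
qed

lemma carry_Suc:
  assumes "inj_on q {..r}" "m < r"
  shows "chain q (Suc m) z F (q (Suc m)) = (\<lambda>a. sn (z m) * chain q m z F (q m) a + cnj (z m) * F (q (Suc m)) a)"
  using inj_on_Suc_neq[OF assms] chain_outside[OF inj_on_notin[OF assms(1), of m "Suc m"], of z F] assms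
  by (auto simp: rot_def)

text \<open>Step m is the last one to touch column \<open>q m\<close>; afterwards the vector in
  column \<open>q (Suc m)\<close> is carried on. So each final column except the last is a
  combination of one carried vector and one original column, and this makes the parameters
  recoverable.\<close>

lemma chain_column:
  assumes "inj_on q {..r}" "m < r"
  shows "chain q r z F (q m) = (\<lambda>a. z m * chain q m z F (q m) a + (- sn (z m)) * F (q (Suc m)) a)"
proof -
  have "chain q j z F (q m) = (\<lambda>a. z m * chain q m z F (q m) a + (- sn (z m)) * F (q (Suc m)) a)"
    if "Suc m \<le> j" "j \<le> r" for j
    using that
  proof (induction j rule: dec_induct)
    case base
    show ?case
      using chain_outside[OF inj_on_notin[OF assms(1), of m "Suc m"], of z F] assms
      by (simp add: rot_def)
  next
    case (step j)
    have "q m \<noteq> q j" "q m \<noteq> q (Suc j)"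
      using assms(1) step unfolding inj_on_def by (metis Suc_le_lessD Suc_leD atMost_iff less_imp_le less_irrefl
          less_or_eq_imp_le order.strict_trans2 lessI)+
    then have "chain q (Suc j) z F (q m) = chain q j z F (q m)" by (simp add: rot_def)
    then show ?case using step by simp
  qed
  then show ?thesis using assms by simp
qed

text \<open>The chain preserves orthonormality and has not yet touched column
  \<open>q j\<close>.\<close>

lemma carry_ip_ahead:
  assumes "ortho N S F" "inj_on q {..r}" "q ` {..r} \<subseteq> S" "\<forall>i<r. cmod (z i) \<le> 1" "m < j" "j \<le> r"
  shows "ip N (chain q m z F (q m)) (F (q j)) = 0"
proof -
  have "ortho N S (chain q m z F)" using assms by (intro chain_ortho) auto
  then have "ip N (chain q m z F (q m)) (chain q m z F (q j)) = 0"
    using assms unfolding ortho_def inj_on_def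
    by (smt (verit, best) atMost_iff image_subset_iff less_imp_le less_irrefl order_trans)
  then show ?thesis using chain_outside[OF inj_on_notin[OF assms(2,5,6)], of z F] by simp
qed

lemma carry_ip_self:
  assumes "ortho N S F" "inj_on q {..r}" "q ` {..r} \<subseteq> S" "\<forall>i<r. cmod (z i) \<le> 1" "m \<le> r"
  shows "ip N (chain q m z F (q m)) (chain q m z F (q m)) = 1"
  using chain_ortho[OF assms] assms unfolding ortho_def by (simp add: image_subset_iff)

text \<open>The columns ahead are orthogonal to \<open>e\<close>, so each step merely multiplies the
  coefficient of the carried vector by a sine. Whatever separates a cell from its boundary below
  comes from this formula.\<close>

lemma carry_row:
  assumes "inj_on q {..r}" "\<forall>j. 0 < j \<and> j \<le> r \<longrightarrow> ip N (F (q j)) e = 0" "m \<le> r"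
  shows "ip N (chain q m z F (q m)) e = (\<Prod>i<m. sn (z i)) * ip N (F (q 0)) e"
  using \<open>m \<le> r\<close>
proof (induction m)
  case (Suc m)
  then show ?case using carry_Suc[OF assms(1), of m z F] assms(2) by (simp add: ip_lin1)
qed simp

text \<open>The parameters are recovered step by step. Suppose the carried vectors agree up to the
  phase \<open>s\<close>. The final column \<open>q m\<close> combines the carried vector with the
  next original column, and these two are orthogonal: the component along the carried vector yields
  the parameter, and as its sine is nonzero the rest yields the next column. Both together determine
  the next carried vector up to the same \<open>s\<close>.\<close>

lemma chain_injective_aux:
  assumes o: "ortho N S F" "ortho N S F'" and q: "inj_on q {..r'}" "q ` {..r'} \<subseteq> S"
    and z: "\<forall>i<r. cmod (z i) < 1" "\<forall>i<r'. cmod (z' i) < 1" and "r \<le> r'"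
    and s: "cmod s = 1" "\<forall>a. F' (q 0) a = s * F (q 0) a"
    and fe: "phase_eq (chain q r z F) (chain q r' z' F')"
  shows "r = r' \<and> phase_eq F F' \<and> (F = F' \<longrightarrow> (\<forall>i<r. z i = z' i))"
proof -
  have qr: "inj_on q {..r}" "q ` {..r} \<subseteq> S"
    using q \<open>r \<le> r'\<close> by (auto intro: inj_on_subset)
  have z1: "\<forall>i<r. cmod (z i) \<le> 1" "\<forall>i<r'. cmod (z' i) \<le> 1" using z less_imp_le by blast+
  let ?c = "\<lambda>m. chain q m z F (q m)" and ?c' = "\<lambda>m. chain q m z' F' (q m)"
  have qS: "q i \<in> S" if "i \<le> r'" for i using q(2) that by auto
  have o1: "ip N (F l) (F l) = 1" "ip N (F' l) (F' l) = 1" if "l \<in> S" for l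
    using o that unfolding ortho_def by auto
  obtain t where t: "\<And>l. cmod (t l) = 1" "\<And>l a. chain q r' z' F' l a = t l * chain q r z F l a"
    using fe unfolding phase_eq_def by metis
  have main: "(\<forall>a. ?c' m a = s * ?c m a) \<and>
     (\<forall>i<m. z' i * s = t (q i) * z i \<and> (\<forall>a. F' (q (Suc i)) a = t (q i) * F (q (Suc i)) a))"
    if "m \<le> r" for m
    using that
  proof (induction m)
    case 0
    then show ?case using s by simp
  next
    case (Suc m)
    then have c': "?c' m = (\<lambda>a. s * ?c m a)" and m: "m < r" "m < r'" using \<open>r \<le> r'\<close> by auto
    let ?T = "t (q m)"
    have ca: "ip N (?c m) (?c m) = 1"
      using carry_ip_self[OF o(1) qr z1(1)] m by simp
    have p1: "ip N (F (q (Suc m))) (?c m) = 0"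
      using carry_ip_ahead[OF o(1) qr z1(1), of m "Suc m"] m ip_cnj by (metis Suc_leI complex_cnj_zero lessI)
    have p2': "ip N (F' (q (Suc m))) (?c' m) = 0"
      using carry_ip_ahead[OF o(2) q z1(2), of m "Suc m"] m ip_cnj by (metis Suc_leI complex_cnj_zero lessI)
    then have p2: "ip N (F' (q (Suc m))) (?c m) = 0" using s(1) unfolding c' ip_scale2 by auto
    have col: "z' m * ?c' m a + (- sn (z' m)) * F' (q (Suc m)) a
        = ?T * (z m * ?c m a + (- sn (z m)) * F (q (Suc m)) a)" for a
      using t(2)[of "q m" a] chain_column[OF qr(1) m(1), of z F] chain_column[OF q(1) m(2), of z' F'] by simp
    then have "ip N (\<lambda>a. z' m * ?c' m a + (- sn (z' m)) * F' (q (Suc m)) a) (?c m)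
        = ip N (\<lambda>a. ?T * (z m * ?c m a + (- sn (z m)) * F (q (Suc m)) a)) (?c m)" by presburger
    then have zz: "z' m * s = ?T * z m"
      unfolding ip_scale1[of N ?T] ip_lin1 p1 p2 by (simp add: c' ip_scale1 ca)
    have "cmod (z' m) * cmod s = cmod ?T * cmod (z m)" using zz by (metis norm_mult)
    then have ss: "sn (z' m) = sn (z m)" using t(1) s(1) by (intro sn_cong) simp
    have ne: "sn (z m) \<noteq> 0" using z m by (simp add: sn_nonzero)
    have F': "F' (q (Suc m)) a = ?T * F (q (Suc m)) a" for a
    proof -
      have "z' m * s * ?c m a - sn (z m) * F' (q (Suc m)) a = ?T * z m * ?c m a - sn (z m) * (?T * F (q (Suc m)) a)"
        using col[of a] c' ss by (simp add: algebra_simps)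
      then show ?thesis using zz ne by simp
    qed
    have "?c' (Suc m) a = s * ?c (Suc m) a" for a
    proof -
      have "cnj (z' m) * ?T = s * cnj (z m)"
      proof -
        have "cnj (z' m) * cnj s = cnj ?T * cnj (z m)" using zz by (metis complex_cnj_mult)
        then have "cnj (z' m) * (s * cnj s) * ?T = s * cnj (z m) * (?T * cnj ?T)"
          by (simp add: algebra_simps)
        then show ?thesis using unit_cnj[OF s(1)] unit_cnj[OF t(1)] by simp
      qed
      then have "cnj (z' m) * F' (q (Suc m)) a = s * (cnj (z m) * F (q (Suc m)) a)"
        using F' by (metis mult.assoc)
      then show ?thesis
        using carry_Suc[OF qr(1) m(1), of z F] carry_Suc[OF q(1) m(2), of z' F'] c' ss
        by (simp add: algebra_simps)
    qed
    then show ?case using Suc F' zz m by (auto simp: less_Suc_eq)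
  qed
  have rr: "r = r'"
  proof (rule ccontr)
    \<comment> \<open>In the longer chain column \<open>q r\<close> still has a component along the
      fresh column \<open>q (Suc r)\<close>, with a nonzero sine as coefficient; in the shorter one
      it is the carried vector, which has no such component.\<close>
    assume "r \<noteq> r'"
    then have lt: "r < r'" using \<open>r \<le> r'\<close> by simp
    have c': "?c' r a = s * ?c r a" for a using main[of r] by auto
    have "z' r * ?c' r a + (- sn (z' r)) * F' (q (Suc r)) a = t (q r) * ?c r a" for a
      using t(2)[of "q r" a] chain_column[OF q(1) lt, of z' F'] by simp
    then have e: "ip N (\<lambda>a. z' r * ?c' r a + (- sn (z' r)) * F' (q (Suc r)) a) (F' (q (Suc r)))
       = t (q r) * ip N (?c r) (F' (q (Suc r)))" by (simp add: ip_scale1)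
    have p: "ip N (?c' r) (F' (q (Suc r))) = 0"
      using carry_ip_ahead[OF o(2) q z1(2), of r "Suc r"] lt by simp
    moreover have "?c' r = (\<lambda>a. s * ?c r a)" using c' by auto
    ultimately have "ip N (?c r) (F' (q (Suc r))) = 0" using s(1) by (auto simp: ip_scale1)
    then have "sn (z' r) = 0" using e p o1(2)[OF qS[of "Suc r"]] lt unfolding ip_lin1 by simp
    then show False using z(2) lt sn_nonzero by blast
  qed
  have tr: "t (q r) = s"
  proof -
    have c': "?c' r a = s * ?c r a" for a using main[of r] by auto
    then have "s * ?c r a = t (q r) * ?c r a" for a using t(2)[of "q r" a] rr by simp
    then have "s * ip N (?c r) (?c r) = t (q r) * ip N (?c r) (?c r)"
      unfolding ip_scale1[symmetric] by presburger
    then show ?thesis using carry_ip_self[OF o(1) qr z1(1), of r] by simp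
  qed
  have 2: "phase_eq F F'"
    unfolding phase_eq_def
  proof
    fix l
    consider "l = q 0" | i where "i < r" "l = q (Suc i)" | "l \<notin> q ` {..r}"
      by (metis atMost_iff image_iff not0_implies_Suc Suc_le_lessD)
    then show "\<exists>t. cmod t = 1 \<and> (\<forall>a. F' l a = t * F l a)"
    proof cases
      case 1 then show ?thesis using s by blast
    next
      case 2 then show ?thesis using main[of r] t(1) by blast
    next
      case 3
      then have "F' l a = t l * F l a" for a
        using t(2)[of l a] chain_outside[of l q r z F] chain_outside[of l q r' z' F'] rr by simp
      then show ?thesis using t(1) by blast
    qed
  qed
  have 3: "\<forall>i<r. z i = z' i" if "F = F'"
  proof (intro allI impI)
    fix i assume i: "i < r"
    have "s * ip N (F (q 0)) (F (q 0)) = ip N (F (q 0)) (F (q 0))"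
      unfolding ip_scale1[symmetric] using s(2) that by (simp only: s(2)[rule_format, symmetric])
    then have "s = 1" using o1(1)[OF qS[of 0]] by simp
    have "t (q i) * ip N (F (q (Suc i))) (F (q (Suc i))) = ip N (F (q (Suc i))) (F (q (Suc i)))"
      using main[of r] that i unfolding ip_scale1[symmetric]
      by (metis (no_types, lifting) order_refl)
    then have "t (q i) = 1" using o1(1)[OF qS[of "Suc i"]] i rr by simp
    then show "z i = z' i" using main[of r] i \<open>s = 1\<close> by simp
  qed
  show ?thesis using rr 2 3 by blast
qed

lemma chain_injective:
  assumes o: "ortho N S F" "ortho N S F'" and q: "inj_on q {..r}" "q ` {..r} \<subseteq> S"
    and z: "\<forall>i<r. cmod (z i) < 1" "\<forall>i<r. cmod (z' i) < 1"
    and s: "cmod s = 1" "\<forall>a. F' (q 0) a = s * F (q 0) a"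
    and fe: "phase_eq (chain q r z F) (chain q r z' F')"
  shows "phase_eq F F'" "F = F' \<Longrightarrow> i < r \<Longrightarrow> z i = z' i"
  using chain_injective_aux[OF o q z order_refl s fe] by auto

section \<open>Elimination by rotations\<close>

definition lin_closed :: "(cvec \<Rightarrow> bool) \<Rightarrow> bool" where
  "lin_closed P \<longleftrightarrow> (\<forall>u v x y. P u \<longrightarrow> P v \<longrightarrow> P (\<lambda>a. x * u a + y * v a))"

text \<open>Givens elimination: a rotation in the plane of two columns moves the whole component
  along \<open>e\<close> into column \<open>q\<close>. The quantifier over \<open>P\<close> sits
  inside the existential so that one choice of \<open>w\<close> and \<open>H\<close> inherits every
  linear condition.\<close>

lemma rot_cover:
  assumes o: "ortho N S G" and q: "q \<in> S" "q' \<in> S" "q \<noteq> q'"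
  shows "\<exists>w H. cmod w \<le> 1 \<and> phase_eq (rot q q' w H) G \<and> ortho N S H \<and> ip N (H q') e = 0 \<and>
     (\<forall>l. l \<noteq> q \<longrightarrow> l \<noteq> q' \<longrightarrow> H l = G l) \<and> (\<forall>P. lin_closed P \<longrightarrow>
        P (G q) \<longrightarrow> P (G q') \<longrightarrow> P (H q) \<and> P (H q'))"
proof -
  define x where "x = ip N (G q) e"
  define y where "y = ip N (G q') e"
  define m where "m = sqrt ((cmod x)\<^sup>2 + (cmod y)\<^sup>2)"
  show ?thesis
  proof (cases "m = 0")
    case True
    then have "y = 0" unfolding m_def by (metis norm_eq_zero power2_eq_square real_sqrt_eq_zero_cancel_iff
        sum_squares_eq_zero_iff)
    then show ?thesis using o y_def by (intro exI[of _ 1] exI[of _ G]) simp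
  next
    case False
    then have m: "m > 0" unfolding m_def by (metis less_eq_real_def real_sqrt_ge_zero sum_power2_ge_zero)
    \<comment> \<open>On the closed disc \<open>sn\<close> is real and nonnegative, so column
      \<open>q'\<close> is first turned until its component along \<open>e\<close> is nonnegative
      too.\<close>
    obtain u where u: "cmod u = 1" "u * y = of_real (cmod y)"
    proof (cases "y = 0")
      case True then show ?thesis using that[of 1] by simp
    next
      case False
      then show ?thesis using that[of "cnj y / of_real (cmod y)"] complex_norm_square[of y]
        by (simp add: norm_divide power2_eq_square mult.commute nonzero_divide_eq_eq)
    qed
    define G1 where "G1 = G(q' := (\<lambda>a. u * G q' a))"
    have G1: "phase_eq G G1" unfolding phase_eq_def G1_def
    proof
      fix l show "\<exists>t. cmod t = 1 \<and> (\<forall>a. (G(q' := \<lambda>a. u * G q' a)) l a = t * G l a)"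
        using u by (cases "l = q'") (auto intro: exI[of _ 1])
    qed
    \<comment> \<open>The first entry of (x, y) scaled to length 1; then \<open>sn w\<close> is the
      modulus of y divided by m.\<close>
    define w where "w = x / of_real m"
    have m2: "m\<^sup>2 = (cmod x)\<^sup>2 + (cmod y)\<^sup>2" unfolding m_def by simp
    have w2: "(cmod w)\<^sup>2 = (cmod x)\<^sup>2 / m\<^sup>2" using m by (simp add: w_def norm_divide power_divide)
    have "1 - (cmod w)\<^sup>2 = (cmod y / m)\<^sup>2" 
    proof -
      have "m\<^sup>2 \<noteq> 0" using m by simp
      then have "1 - (cmod x)\<^sup>2 / m\<^sup>2 = (m\<^sup>2 - (cmod x)\<^sup>2) / m\<^sup>2" by (simp add: diff_divide_distrib)
      then show ?thesis unfolding w2 by (simp add: m2 power_divide)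
    qed
    then have sw: "sn w = of_real (cmod y / m)" unfolding sn_def using m by (simp add: real_sqrt_unique)
    have w1: "cmod w \<le> 1" using \<open>1 - (cmod w)\<^sup>2 = (cmod y / m)\<^sup>2\<close>
      by (metis abs_norm_cancel abs_square_le_1 diff_ge_0_iff_ge zero_le_power2)
    define H where "H = rot q' q w G1"
    have "ortho N S H" unfolding H_def using phase_eq_ortho[OF G1 o] q w1 by (intro rot_ortho) auto
    moreover have "rot q q' w H = G1" unfolding H_def using rot_inverse[OF w1 q(3)] .
    then have "phase_eq (rot q q' w H) G" using phase_eq_sym[OF G1] by simp
    moreover have "ip N (H q') e = 0"
    proof -
      have "H q' = (\<lambda>a. (w * u) * G q' a + (- sn w) * G q a)"
        unfolding H_def rot_def G1_def using q(3) by (auto simp: mult.assoc)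
      then have "ip N (H q') e = w * (u * y) - sn w * x" by (simp add: ip_diff1 x_def y_def)
      then have "ip N (H q') e = w * of_real (cmod y) - of_real (cmod y / m) * x" unfolding u(2) sw .
      then show ?thesis unfolding w_def by simp
    qed
    moreover have "\<forall>l. l \<noteq> q \<longrightarrow> l \<noteq> q' \<longrightarrow> H l = G l" by (simp add: H_def rot_def G1_def)
    moreover have PP: "P (H q) \<and> P (H q')" if P: "lin_closed P"
        "P (G q)" "P (G q')" for P
    proof
      have "H q = (\<lambda>a. (sn w * u) * G q' a + cnj w * G q a)" "H q' = (\<lambda>a. (w * u) * G q' a + (- sn w) * G q a)"
        unfolding H_def rot_def G1_def using q(3) by (auto simp: mult.assoc)
      then show "P (H q)" "P (H q')" using P unfolding lin_closed_def by presburger+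
    qed
    ultimately show ?thesis using w1
      by (intro exI[of _ w] exI[of _ H] conjI) (simp_all only:, intro allI impI PP)
  qed
qed

text \<open>Elimination runs backwards: the last rotation clears the last column, the one before it
  the preceding column, and so on, until among the columns of the chain only \<open>q 0\<close> can
  see \<open>e\<close>.\<close>

lemma chain_cover:
  assumes o: "ortho N S G" and q: "inj_on q {..r}" "q ` {..r} \<subseteq> S"
  shows "\<exists>z\<in>pdisc r. \<exists>F. phase_eq (chain q r z F) G \<and> ortho N S F \<and>
     (\<forall>j. 0 < j \<and> j \<le> r \<longrightarrow> ip N (F (q j)) e = 0) \<and> (\<forall>l. l \<notin> q ` {..r} \<longrightarrow> F l = G l) \<and>
     (\<forall>P. lin_closed P \<longrightarrow>
        (\<forall>i\<le>r. P (G (q i))) \<longrightarrow> (\<forall>i\<le>r. P (F (q i))))"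
  using assms
proof (induction r arbitrary: G)
  case 0
  then show ?case by (intro bexI[of _ "\<lambda>_. 0"] exI[of _ G]) auto
next
  case (Suc r)
  have ne: "q r \<noteq> q (Suc r)" "q (Suc r) \<notin> q ` {..r}"
    using inj_on_Suc_neq[OF Suc.prems(2), of r] inj_on_notin[OF Suc.prems(2), of r "Suc r"] by auto
  have qS: "q r \<in> S" "q (Suc r) \<in> S" using Suc.prems(3) by auto
  obtain w H where H0: "cmod w \<le> 1 \<and> phase_eq (rot (q r) (q (Suc r)) w H) G \<and> ortho N S H \<and> ip N (H (q (Suc r))) e = 0 \<and>
     (\<forall>l. l \<noteq> q r \<longrightarrow> l \<noteq> q (Suc r) \<longrightarrow> H l = G l) \<and> (\<forall>P. lin_closed P \<longrightarrow>
        P (G (q r)) \<longrightarrow> P (G (q (Suc r))) \<longrightarrow> P (H (q r)) \<and> P (H (q (Suc r))))"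
    using rot_cover[OF Suc.prems(1) qS ne(1), of e] by (elim exE)
  note H0' = H0[THEN conjunct2, THEN conjunct2, THEN conjunct2, THEN conjunct2]
  have H: "cmod w \<le> 1" "phase_eq (rot (q r) (q (Suc r)) w H) G" "ortho N S H" "ip N (H (q (Suc r))) e = 0"
    using H0 by blast+
  note H5 = H0'[THEN conjunct1, rule_format] and HP = H0'[THEN conjunct2, rule_format]
  have "inj_on q {..r}" "q ` {..r} \<subseteq> S" using Suc.prems by (auto intro: inj_on_subset)
  note IH = Suc.IH[OF H(3) this]
  obtain z F where z: "z \<in> pdisc r" and F0: "phase_eq (chain q r z F) H \<and> ortho N S F \<and>
     (\<forall>j. 0 < j \<and> j \<le> r \<longrightarrow> ip N (F (q j)) e = 0) \<and> (\<forall>l. l \<notin> q ` {..r} \<longrightarrow> F l = H l) \<and>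
     (\<forall>P. lin_closed P \<longrightarrow> (\<forall>i\<le>r. P (H (q i))) \<longrightarrow> (\<forall>i\<le>r. P (F (q i))))"
    using IH by (elim bexE exE)
  note F0' = F0[THEN conjunct2, THEN conjunct2]
  have F: "phase_eq (chain q r z F) H" "ortho N S F" using F0 by blast+
  have F3: "ip N (F (q j)) e = 0" if "0 < j" "j \<le> r" for j using F0' that by (elim conjE) simp
  note F4 = F0'[THEN conjunct2, THEN conjunct1, rule_format]
    and FP = F0'[THEN conjunct2, THEN conjunct2, rule_format]
  \<comment> \<open>The induction hypothesis returns \<open>H\<close> only up to phases; pushing
    them through the last rotation costs a unit factor in its parameter.\<close>
  obtain w' where w': "cmod w' = cmod w" "phase_eq (rot (q r) (q (Suc r)) w' (chain q r z F)) (rot (q r) (q (Suc r)) w H)"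
    using rot_phase[OF F(1) ne(1)] by blast
  let ?z = "z(r := w')"
  have "chain q r ?z F = chain q r z F" by (rule chain_cong) auto
  then have 1: "phase_eq (chain q (Suc r) ?z F) G" using phase_eq_trans[OF w'(2) H(2)] by simp
  have 2: "?z \<in> pdisc (Suc r)" 
    unfolding pdisc_def
  proof (rule CollectI, rule allI)
    fix i
    have "cmod (z i) \<le> (if i < r then 1 else 0)" using z unfolding pdisc_def by blast
    then show "cmod (?z i) \<le> (if i < Suc r then 1 else 0)"
      using w'(1) H(1) by (cases "i < r"; cases "i = r") auto
  qed
  have FS: "F (q (Suc r)) = H (q (Suc r))" using F4 ne by blast
  have 3: "\<forall>j. 0 < j \<and> j \<le> Suc r \<longrightarrow> ip N (F (q j)) e = 0"
    using F3 H(4) FS by (auto simp: le_Suc_eq)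
  have 4: "F l = G l" if "l \<notin> q ` {..Suc r}" for l
    using that F4[of l] H5[of l] by (auto simp: atMost_Suc)
  have 5: "\<forall>i\<le>Suc r. P (F (q i))" if P: "lin_closed P" "\<forall>i\<le>Suc r. P (G (q i))" for P
  proof -
    have h: "P (H (q r)) \<and> P (H (q (Suc r)))" using HP[of P] P by auto
    have "P (H (q i))" if "i \<le> r" for i
      using that h H5[of "q i"] P(2) by (cases "q i = q r \<or> q i = q (Suc r)") auto
    then have "\<forall>i\<le>r. P (F (q i))" using FP[of P] P(1) by simp
    then show ?thesis using h FS by (auto simp: le_Suc_eq)
  qed
  show ?case
  proof (intro bexI[OF _ 2] exI[of _ F] conjI)
    show "\<forall>P. lin_closed P \<longrightarrow> (\<forall>i\<le>Suc r. P (G (q i))) \<longrightarrow> (\<forall>i\<le>Suc r. P (F (q i)))"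
    proof (intro allI impI)
      fix P i assume "lin_closed P" "\<forall>i\<le>Suc r. P (G (q i))" "i \<le> Suc r"
      then show "P (F (q i))" using 5[of P] by blast
    qed
  qed (use 1 3 4 F(2) in blast)+
qed

text \<open>Applying the common rank one matrix to v gives v on one side and a multiple of u on the
  other; comparing lengths makes the factor a unit.\<close>

lemma rank_one_eq:
  assumes "ip N u u = 1" "ip N v v = 1" "\<And>a b. a \<in> {1..N} \<Longrightarrow> b \<in> {1..N} \<Longrightarrow> u a * cnj (u b) = v a * cnj (v b)"
    "\<And>a. a \<notin> {1..N} \<Longrightarrow> u a = 0" "\<And>a. a \<notin> {1..N} \<Longrightarrow> v a = 0"
  shows "\<exists>s. cmod s = 1 \<and> (\<forall>a. v a = s * u a)"
proof -
  have e: "v a = ip N v u * u a" for a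
  proof (cases "a \<in> {1..N}")
    case True
    have "v a = v a * ip N v v" using assms(2) by simp
    also have "\<dots> = (\<Sum>b\<in>{1..N}. (v a * cnj (v b)) * v b)"
      by (simp add: ip_def sum_distrib_left mult_ac)
    also have "\<dots> = (\<Sum>b\<in>{1..N}. (u a * cnj (u b)) * v b)"
      using assms(3) True by (intro sum.cong) auto
    also have "\<dots> = ip N v u * u a" by (simp add: ip_def sum_distrib_left sum_distrib_right mult_ac)
    finally show ?thesis .
  qed (use assms(4,5) in auto)
  let ?s = "ip N v u"
  have "v = (\<lambda>a. ?s * u a)" using e by blast
  then have "ip N v v = ?s * cnj ?s * ip N u u" by (metis ip_scale1 ip_scale2 mult.assoc)
  then have "?s * cnj ?s = 1" using assms by simp
  then have "cmod ?s = 1" unfolding mult_cnj_norm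
    by (metis norm_ge_zero of_real_eq_1_iff power2_eq_1_iff abs_norm_cancel abs_minus_cancel abs_one)
  then show ?thesis using e by blast
qed

text \<open>Expanding \<open>v\<close> in the frame leaves a single term. After elimination this is
  how a column is recognised as a prescribed vector up to phase.\<close>

lemma reproduce_unit:
  assumes "finite S" "ip N v v = 1" "\<And>a. v a = (\<Sum>l\<in>S. cnj (ip N (G l) v) * G l a)" "q \<in> S"
    "\<And>l. l \<in> S \<Longrightarrow> l \<noteq> q \<Longrightarrow> ip N (G l) v = 0" "ip N (G q) (G q) = 1"
  shows "\<exists>s. cmod s = 1 \<and> (\<forall>a. G q a = s * v a)"
proof -
  let ?s = "ip N (G q) v"
  have v: "v a = cnj ?s * G q a" for a
    using assms(1,4,5) assms(3)[of a] by (simp add: sum.remove[of S q])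
  then have "v = (\<lambda>a. cnj ?s * G q a)" by blast
  then have "ip N v v = cnj ?s * ?s * ip N (G q) (G q)" by (metis ip_scale1 ip_scale2 mult.assoc complex_cnj_cnj)
  then have s1: "?s * cnj ?s = 1" using assms by (simp add: mult.commute)
  then have "cmod ?s = 1" unfolding mult_cnj_norm
    by (metis norm_ge_zero of_real_eq_1_iff power2_eq_1_iff abs_norm_cancel abs_minus_cancel abs_one)
  moreover have "G q a = ?s * v a" for a using v[of a] s1 by (simp add: mult.assoc[symmetric])
  ultimately show ?thesis by blast
qed

section \<open>Cellular sets of frames\<close>

text \<open>A set of frames, saturated under phases, whose quotient by phases is built by attaching cells; the list records their complex dimensions. Characteristic maps are lifted to frames.\<close>
inductive cellular :: "frame set \<Rightarrow> nat list \<Rightarrow> bool" where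
  empty: "cellular {} []"
| attach: "\<lbrakk>cellular A ds; continuous_on (pdisc d) \<Phi>; \<And>t. t \<in> pdisc d - odisc d \<Longrightarrow> \<Phi> t \<in> A;
     \<And>t. t \<in> odisc d \<Longrightarrow> \<Phi> t \<notin> A;
     \<And>t t'. \<lbrakk>t \<in> odisc d; t' \<in> odisc d; phase_eq (\<Phi> t) (\<Phi> t')\<rbrakk> \<Longrightarrow> t = t'\<rbrakk>
   \<Longrightarrow> cellular (A \<union> {G. \<exists>t\<in>pdisc d. phase_eq (\<Phi> t) G}) (d # ds)"

lemma cellular_saturated: "cellular A ds \<Longrightarrow> G \<in> A \<Longrightarrow> phase_eq G H \<Longrightarrow> H \<in> A"
proof (induction arbitrary: G H rule: cellular.induct)
  case (attach A ds d \<Phi>)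
  then show ?case by (auto intro: phase_eq_trans)
qed simp

text \<open>The cells are attached in the Hausdorff target by the maps
  \<open>\<pi> (\<Phi> t)\<close>. Since the fibres of \<open>\<pi>\<close> are phase classes and
  cellular sets are saturated under phases, disjointness and injectivity for frames become
  disjointness and injectivity for points.\<close>

lemma cellular_homology:
  fixes \<pi> :: "frame \<Rightarrow> 'a::t2_space"
  assumes "cellular A ds" "continuous_on UNIV \<pi>"
    and "\<And>F G. F \<in> A \<Longrightarrow> G \<in> A \<Longrightarrow> \<pi> F = \<pi> G \<longleftrightarrow> phase_eq F G"
  shows "compact (\<pi> ` A) \<and> even_free_homology (top_of_set (\<pi> ` A)) (count_list ds)"
  using assms(1,3)
proof (induction rule: cellular.induct)
  case empty
  then show ?case using even_free_homology_empty by (simp add: fun_eq_iff[symmetric])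
next
  case (attach A ds d \<Phi>)
  let ?A' = "A \<union> {G. \<exists>t\<in>pdisc d. phase_eq (\<Phi> t) G}"
  have IH: "compact (\<pi> ` A)" "even_free_homology (top_of_set (\<pi> ` A)) (count_list ds)"
    using attach.IH attach.prems by auto
  let ?\<phi> = "\<lambda>t. \<pi> (\<Phi> t)"
  have inA: "\<Phi> t \<in> ?A'" if "t \<in> pdisc d" for t using that phase_eq_refl by blast
  have "continuous_on (pdisc d) ?\<phi>"
    by (rule continuous_on_compose2[OF assms(2) attach.hyps(2)]) simp
  then have cell: "cell_attach d (\<pi> ` A) ?\<phi>"
    unfolding cell_attach_def
  proof (intro conjI)
    show "?\<phi> ` (pdisc d - odisc d) \<subseteq> \<pi> ` A" using attach.hyps(3) by blast
    have "\<pi> (\<Phi> t) \<noteq> \<pi> F" if "t \<in> odisc d" "F \<in> A" for t F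
    proof
      assume "\<pi> (\<Phi> t) = \<pi> F"
      then have "phase_eq F (\<Phi> t)" using attach.prems[of F "\<Phi> t"] inA[of t] that odisc_subset by auto
      then have "\<Phi> t \<in> A" using cellular_saturated[OF attach.hyps(1)] that by blast
      then show False using attach.hyps(4) that by blast
    qed
    then show "?\<phi> ` odisc d \<inter> \<pi> ` A = {}" by blast
    show "inj_on ?\<phi> (odisc d)"
    proof (rule inj_onI)
      fix t t' assume t: "t \<in> odisc d" "t' \<in> odisc d" "\<pi> (\<Phi> t) = \<pi> (\<Phi> t')"
      then have "phase_eq (\<Phi> t) (\<Phi> t')" using attach.prems[of "\<Phi> t" "\<Phi> t'"] inA odisc_subset by blast
      then show "t = t'" using attach.hyps(5) t by blast
    qed
  qed
  have im: "\<pi> ` ?A' = \<pi> ` A \<union> ?\<phi> ` pdisc d"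
  proof
    show "\<pi> ` ?A' \<subseteq> \<pi> ` A \<union> ?\<phi> ` pdisc d"
    proof
      fix x assume "x \<in> \<pi> ` ?A'"
      then obtain G where G: "G \<in> ?A'" "x = \<pi> G" by blast
      show "x \<in> \<pi> ` A \<union> ?\<phi> ` pdisc d"
      proof (cases "G \<in> A")
        case False
        then obtain t where t: "t \<in> pdisc d" "phase_eq (\<Phi> t) G" using G by blast
        then have "\<pi> (\<Phi> t) = \<pi> G" using attach.prems[of "\<Phi> t" G] inA G by blast
        then show ?thesis using t G by force
      qed (use G in blast)
    qed
    show "\<pi> ` A \<union> ?\<phi> ` pdisc d \<subseteq> \<pi> ` ?A'" using inA by blast
  qed
  have "even_free_homology (top_of_set (\<pi> ` ?A')) ((count_list ds)(d := Suc (count_list ds d)))"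
    by (rule even_free_homology_cell_attach[OF IH(2) cell _ im]) (use IH compact_imp_closed in blast)
  moreover have "(count_list ds)(d := Suc (count_list ds d)) = count_list (d # ds)" by auto
  moreover have "compact (\<pi> ` ?A')" unfolding im
    by (intro compact_Un IH compact_continuous_image compact_pdisc) fact
  ultimately show ?case by (simp only: simp_thms)
qed

section \<open>Cells multiplied by a polydisc of rotations\<close>

definition opset :: "((nat \<Rightarrow> complex) \<Rightarrow> frame \<Rightarrow> frame) \<Rightarrow> nat \<Rightarrow> frame set \<Rightarrow> frame set" where
  "opset Op r A = {G. \<exists>F\<in>A. \<exists>z\<in>pdisc r. phase_eq (Op z F) G}"

definition trunc :: "nat \<Rightarrow> (nat \<Rightarrow> complex) \<Rightarrow> nat \<Rightarrow> complex" where
  "trunc d t = (\<lambda>i. if i < d then t i else 0)"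

definition shift :: "nat \<Rightarrow> (nat \<Rightarrow> complex) \<Rightarrow> nat \<Rightarrow> complex" where
  "shift d t = (\<lambda>i. t (i + d))"

definition merge :: "nat \<Rightarrow> (nat \<Rightarrow> complex) \<Rightarrow> (nat \<Rightarrow> complex) \<Rightarrow> nat \<Rightarrow> complex" where
  "merge d x y = (\<lambda>i. if i < d then x i else y (i - d))"

lemma trunc_merge: "x \<in> pdisc d \<Longrightarrow> trunc d (merge d x y) = x"
  by (auto simp: trunc_def merge_def pdisc_alt fun_eq_iff)

lemma shift_merge [simp]: "shift d (merge d x y) = y"
  by (auto simp: shift_def merge_def fun_eq_iff)

lemma pdiscD: "z \<in> pdisc d \<Longrightarrow> cmod (z i) \<le> (if i < d then 1 else 0)"
  unfolding pdisc_def by blast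

lemma merge_pdisc: "x \<in> pdisc d \<Longrightarrow> y \<in> pdisc r \<Longrightarrow> merge d x y \<in> pdisc (d + r)"
  unfolding pdisc_def
proof (rule CollectI, rule allI)
  fix i assume "x \<in> {z. \<forall>i. cmod (z i) \<le> (if i < d then 1 else 0)}" "y \<in> {z. \<forall>i. cmod (z i) \<le> (if i < r then 1 else 0)}"
  then have "cmod (x i) \<le> (if i < d then 1 else 0)" "cmod (y (i - d)) \<le> (if i - d < r then 1 else 0)" by blast+
  then show "cmod (merge d x y i) \<le> (if i < d + r then 1 else 0)"
    by (auto simp: merge_def split: if_splits)
qed

lemma trunc_pdisc: "t \<in> pdisc (d + r) \<Longrightarrow> trunc d t \<in> pdisc d"
  unfolding pdisc_def trunc_def
proof (rule CollectI, rule allI)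
  fix i assume "t \<in> {z. \<forall>i. cmod (z i) \<le> (if i < d + r then 1 else 0)}"
  then have "cmod (t i) \<le> (if i < d + r then 1 else 0)" by blast
  then show "cmod (if i < d then t i else 0) \<le> (if i < d then 1 else 0)" by auto
qed

lemma shift_pdisc: "t \<in> pdisc (d + r) \<Longrightarrow> shift d t \<in> pdisc r"
  unfolding pdisc_def shift_def
proof (rule CollectI, rule allI)
  fix i assume "t \<in> {z. \<forall>i. cmod (z i) \<le> (if i < d + r then 1 else 0)}"
  then have "cmod (t (i + d)) \<le> (if i + d < d + r then 1 else 0)" by blast
  then show "cmod (t (i + d)) \<le> (if i < r then 1 else 0)" by (auto split: if_splits)
qed

lemma odisc_split: "t \<in> odisc (d + r) \<longleftrightarrow> t \<in> pdisc (d + r) \<and> trunc d t \<in> odisc d \<and> shift d t \<in> odisc r"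
proof -
  have "(\<forall>i<d+r. cmod (t i) < 1) \<longleftrightarrow> (\<forall>i<d. cmod (trunc d t i) < 1) \<and> (\<forall>i<r. cmod (shift d t i) < 1)"
  proof safe
    fix i assume a: "\<forall>i<d. cmod (trunc d t i) < 1" "\<forall>i<r. cmod (shift d t i) < 1" "i < d + r"
    show "cmod (t i) < 1"
    proof (cases "i < d")
      case True then show ?thesis using a(1) by (auto simp: trunc_def)
    next
      case False
      then have "cmod (shift d t (i - d)) < 1" using a by auto
      then show ?thesis using False by (simp add: shift_def)
    qed
  qed (auto simp: trunc_def shift_def)
  then show ?thesis unfolding odisc_def using trunc_pdisc[of t d r] shift_pdisc[of t d r] by blast
qed

lemma trunc_shift_eq: "trunc d t = trunc d t' \<Longrightarrow> shift d t = shift d t' \<Longrightarrow> t = t'"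
proof
  fix i assume a: "trunc d t = trunc d t'" "shift d t = shift d t'"
  show "t i = t' i"
    using fun_cong[OF a(1), of i] fun_cong[OF a(2), of "i - d"] by (cases "i < d") (auto simp: trunc_def shift_def)
qed

lemma continuous_on_trunc: "continuous_on S f \<Longrightarrow> continuous_on S (\<lambda>x. trunc d (f x))"
  unfolding trunc_def
proof (rule continuous_on_coordinatewise_then_product)
  fix i assume "continuous_on S f"
  then show "continuous_on S (\<lambda>x. if i < d then f x i else 0)"
    by (cases "i < d") (auto intro: continuous_on_component)
qed

lemma continuous_on_shift: "continuous_on S f \<Longrightarrow> continuous_on S (\<lambda>x. shift d (f x))"
  unfolding shift_def by (rule continuous_on_coordinatewise_then_product) (rule continuous_on_component)

text \<open>The product cells \<open>Op z (\<Phi> t)\<close> are attached to \<open>B\<close>, which must absorb the boundary in \<open>z\<close>; the boundary in \<open>t\<close> lies over earlier cells.\<close>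
lemma cellular_stage:
  assumes "cellular A ds" "A \<subseteq> FF" and B: "cellular B ds0"
    and cont: "\<And>f w (S :: (nat \<Rightarrow> complex) set). continuous_on S f \<Longrightarrow> continuous_on S w \<Longrightarrow> continuous_on S (\<lambda>x. Op (w x) (f x))"
    and phase: "\<And>F G z. F \<in> FF \<Longrightarrow> G \<in> FF \<Longrightarrow> phase_eq F G \<Longrightarrow> z \<in> pdisc r \<Longrightarrow> \<exists>w\<in>pdisc r. phase_eq (Op w F) (Op z G)"
    and bd: "\<And>F z. F \<in> FF \<Longrightarrow> z \<in> pdisc r - odisc r \<Longrightarrow> Op z F \<in> B"
    and int: "\<And>F z. F \<in> FF \<Longrightarrow> z \<in> odisc r \<Longrightarrow> Op z F \<notin> B"
    and inj: "\<And>F G z w. F \<in> FF \<Longrightarrow> G \<in> FF \<Longrightarrow> z \<in> odisc r \<Longrightarrow> w \<in> odisc r \<Longrightarrow> phase_eq (Op z F) (Op w G) \<Longrightarrow>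
       phase_eq F G \<and> (F = G \<longrightarrow> z = w)"
  shows "cellular (opset Op r A \<union> B) (map (\<lambda>d. d + r) ds @ ds0)"
  using assms(1,2)
proof (induction rule: cellular.induct)
  case empty
  then show ?case using B by (simp add: opset_def)
next
  case (attach A ds d \<Phi>)
  let ?A' = "A \<union> {G. \<exists>t\<in>pdisc d. phase_eq (\<Phi> t) G}"
  \<comment> \<open>The first \<open>d\<close> coordinates run through the old cell, the remaining
    \<open>r\<close> are parameters of \<open>Op\<close>.\<close>
  let ?\<Phi> = "\<lambda>t. Op (shift d t) (\<Phi> (trunc d t))"
  have A: "A \<subseteq> FF" and \<Phi>F: "\<And>t. t \<in> pdisc d \<Longrightarrow> \<Phi> t \<in> FF" using attach.prems phase_eq_refl by blast+
  have IH: "cellular (opset Op r A \<union> B) (map (\<lambda>d. d + r) ds @ ds0)" using attach.IH A by blast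
  have "cellular ((opset Op r A \<union> B) \<union> {G. \<exists>t\<in>pdisc (d + r). phase_eq (?\<Phi> t) G}) ((d + r) # (map (\<lambda>d. d + r) ds @ ds0))"
  proof (rule cellular.attach[OF IH])
    have "continuous_on (pdisc (d + r)) (\<lambda>t. \<Phi> (trunc d t))"
      by (rule continuous_on_compose2[OF attach.hyps(2) continuous_on_trunc[OF continuous_on_id]])
         (use trunc_pdisc in auto)
    then show "continuous_on (pdisc (d + r)) ?\<Phi>"
      by (rule cont[OF _ continuous_on_shift[OF continuous_on_id]])
    fix t
    show "?\<Phi> t \<in> opset Op r A \<union> B" if t: "t \<in> pdisc (d + r) - odisc (d + r)"
    proof (cases "shift d t \<in> odisc r")
      case True
      then have "trunc d t \<in> pdisc d - odisc d" using t odisc_split[of t d r] trunc_pdisc by blast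
      then have "\<Phi> (trunc d t) \<in> A" using attach.hyps(3) by blast
      moreover have "shift d t \<in> pdisc r" using t shift_pdisc by blast
      ultimately show ?thesis using phase_eq_refl unfolding opset_def by blast
    next
      case False
      then show ?thesis using bd[OF \<Phi>F, of "trunc d t" "shift d t"] t trunc_pdisc shift_pdisc by blast
    qed
    show "?\<Phi> t \<notin> opset Op r A \<union> B" if t: "t \<in> odisc (d + r)"
    proof
      have t': "trunc d t \<in> odisc d" "shift d t \<in> odisc r" using t odisc_split by blast+
      have tF: "\<Phi> (trunc d t) \<in> FF" using \<Phi>F t'(1) odisc_subset by blast
      have nB: "?\<Phi> t \<notin> B" using int[OF tF t'(2)] .
      assume "?\<Phi> t \<in> opset Op r A \<union> B"
      then obtain F z where F: "F \<in> A" "z \<in> pdisc r" "phase_eq (Op z F) (?\<Phi> t)" using nB unfolding opset_def by blast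
      have FF: "F \<in> FF" using F A by blast
      \<comment> \<open>A boundary parameter would place the frame in \<open>B\<close>, which is
        saturated under phases, against \<open>nB\<close>.\<close>
      have "z \<in> odisc r"
      proof (rule ccontr)
        assume "z \<notin> odisc r"
        then have "Op z F \<in> B" using bd[OF FF] F by blast
        then show False using cellular_saturated[OF B _ F(3)] nB by blast
      qed
      then have "phase_eq F (\<Phi> (trunc d t))" using inj[OF FF tF _ t'(2) F(3)] by blast
      then have "\<Phi> (trunc d t) \<in> A" using cellular_saturated[OF attach.hyps(1) F(1)] by blast
      then show False using attach.hyps(4) t'(1) by blast
    qed
    show "t = t'" if t: "t \<in> odisc (d + r)" "t' \<in> odisc (d + r)" "phase_eq (?\<Phi> t) (?\<Phi> t')" for t'
    proof -
      have s: "trunc d t \<in> odisc d" "shift d t \<in> odisc r" "trunc d t' \<in> odisc d" "shift d t' \<in> odisc r"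
        using t odisc_split by blast+
      have "\<Phi> (trunc d t) \<in> FF" "\<Phi> (trunc d t') \<in> FF" using \<Phi>F s odisc_subset by blast+
      note i = inj[OF this s(2,4) t(3)]
      then have "trunc d t = trunc d t'" using attach.hyps(5)[OF s(1,3)] by blast
      then show ?thesis using i trunc_shift_eq by metis
    qed
  qed
  moreover have "(opset Op r A \<union> B) \<union> {G. \<exists>t\<in>pdisc (d + r). phase_eq (?\<Phi> t) G} = opset Op r ?A' \<union> B"
  proof
    show "(opset Op r A \<union> B) \<union> {G. \<exists>t\<in>pdisc (d + r). phase_eq (?\<Phi> t) G} \<subseteq> opset Op r ?A' \<union> B"
    proof
      fix G assume "G \<in> (opset Op r A \<union> B) \<union> {G. \<exists>t\<in>pdisc (d + r). phase_eq (?\<Phi> t) G}"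
      then consider "G \<in> opset Op r A" | "G \<in> B" | t where "t \<in> pdisc (d + r)" "phase_eq (?\<Phi> t) G" by blast
      then show "G \<in> opset Op r ?A' \<union> B"
      proof cases
        case 1 then show ?thesis unfolding opset_def by blast
      next
        case 3
        have "\<Phi> (trunc d t) \<in> ?A'" using trunc_pdisc[OF 3(1)] phase_eq_refl by blast
        moreover have "shift d t \<in> pdisc r" using shift_pdisc[OF 3(1)] .
        ultimately have "G \<in> opset Op r ?A'" using 3(2) unfolding opset_def by (intro CollectI bexI)
        then show ?thesis by (rule UnI1)
      qed simp
    qed
    show "opset Op r ?A' \<union> B \<subseteq> (opset Op r A \<union> B) \<union> {G. \<exists>t\<in>pdisc (d + r). phase_eq (?\<Phi> t) G}"
    proof
      fix G assume G: "G \<in> opset Op r ?A' \<union> B"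
      show "G \<in> (opset Op r A \<union> B) \<union> {G. \<exists>t\<in>pdisc (d + r). phase_eq (?\<Phi> t) G}"
      proof (cases "G \<in> opset Op r A \<union> B")
        case False
        then obtain F z where F: "F \<in> ?A'" "z \<in> pdisc r" "phase_eq (Op z F) G" "F \<notin> A" using G unfolding opset_def by blast
        then obtain u where u: "u \<in> pdisc d" "phase_eq (\<Phi> u) F" by blast
        have "F \<in> FF" using attach.prems F(1) by blast
        \<comment> \<open>\<open>F\<close> is only a phase multiple of \<open>\<Phi> u\<close>; the
          phases are moved through \<open>Op\<close> at the price of another parameter.\<close>
        then obtain w where w: "w \<in> pdisc r" "phase_eq (Op w (\<Phi> u)) (Op z F)"
          using phase[OF \<Phi>F[OF u(1)] _ u(2) F(2)] by blast
        let ?t = "merge d u w"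
        have "?\<Phi> ?t = Op w (\<Phi> u)" using u(1) by (simp add: trunc_merge)
        moreover have "?t \<in> pdisc (d + r)" using merge_pdisc u(1) w(1) by blast
        ultimately have "\<exists>t\<in>pdisc (d + r). phase_eq (?\<Phi> t) G" using phase_eq_trans[OF w(2) F(3)]
          by (intro bexI[of _ ?t]) simp_all
        then show ?thesis by simp
      qed simp
    qed
  qed
  ultimately show ?case by simp
qed

section \<open>Flags in the kernel\<close>

text \<open>Orthonormal bases of \<open>E\<close> whose first \<open>k - 1\<close> vectors are \<open>e\<^sub>1, \<dots>, e\<^bsub>k-1\<^esub>\<close> up to phase.\<close>
definition unitary :: "nat \<Rightarrow> nat \<Rightarrow> frame set" where
  "unitary n k = {F. ortho (Ndim n) {1..n-1} F \<and> (\<forall>l a. a \<notin> {1..n-1} \<longrightarrow> F l a = 0) \<and>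
     (\<forall>a\<in>{1..n-1}. \<forall>b\<in>{1..n-1}. frame_sum {1..n-1} F a b = (if a = b then 1 else 0)) \<and>
     (\<forall>l\<in>{1..<k}. \<forall>a. a \<noteq> l \<longrightarrow> F l a = 0)}"

text \<open>\<open>F l k\<close> is the inner product of column l with e_k, so the condition puts
  e_k into the span of the first k + r - 1 columns. The successive differences in \<open>r\<close>
  sort flags by the step at which this line enters.\<close>

definition unitary_row :: "nat \<Rightarrow> nat \<Rightarrow> nat \<Rightarrow> frame set" where
  "unitary_row n k r = {F \<in> unitary n k. \<forall>l\<ge>k+r. F l k = 0}"

lemma unitary_phase_eq: "F \<in> unitary n k \<Longrightarrow> phase_eq F G \<Longrightarrow> G \<in> unitary n k"
  unfolding unitary_def using phase_eq_ortho[of F G] phase_eq_component_0[of F G] phase_eq_frame_sum[of F G] by auto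

lemma unitary_row_phase_eq: "F \<in> unitary_row n k r \<Longrightarrow> phase_eq F G \<Longrightarrow> G \<in> unitary_row n k r"
  unfolding unitary_row_def using unitary_phase_eq phase_eq_component_0[of F G] by blast

lemma ip_basis: "k \<in> {1..N} \<Longrightarrow> ip N u (basis_vec k) = u k"
proof -
  assume k: "k \<in> {1..N}"
  have "ip N u (basis_vec k) = (\<Sum>a\<in>{1..N}. if a = k then u a else 0)"
    unfolding ip_def basis_vec_def by (intro sum.cong) auto
  then show ?thesis using k by simp
qed

lemma Ndim_ge: "n \<ge> 2 \<Longrightarrow> n - 1 \<le> Ndim n" "n \<ge> 2 \<Longrightarrow> n \<le> Ndim n"
  by (auto simp: Ndim_def)

lemma unitary_ip_single:
  assumes "F \<in> unitary n k" "l \<in> {1..<k}" "l \<le> n - 1"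
  shows "ip (Ndim n) u (F l) = u l * cnj (F l l)"
proof -
  have l: "l \<in> {1..Ndim n}" using assms by (auto simp: Ndim_def)
  have "ip (Ndim n) u (F l) = (\<Sum>a\<in>{1..Ndim n}. if a = l then u a * cnj (F l l) else 0)"
    unfolding ip_def using assms by (intro sum.cong) (auto simp: unitary_def)
  then show ?thesis using l by simp
qed

lemma unitary_diag:
  assumes "F \<in> unitary n k" "l \<in> {1..<k}" "l \<le> n - 1"
  shows "cmod (F l l) = 1"
proof -
  have "ip (Ndim n) (F l) (F l) = 1" using assms by (auto simp: unitary_def ortho_def)
  then have "F l l * cnj (F l l) = 1" using unitary_ip_single[OF assms] by simp
  then show ?thesis unfolding mult_cnj_norm
    by (metis norm_ge_zero of_real_eq_1_iff power2_eq_1_iff abs_norm_cancel abs_minus_cancel abs_one)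
qed

lemma unitary_row:
  assumes "F \<in> unitary n k" "l \<in> {1..<k}" "l \<le> n - 1" "l' \<noteq> l"
  shows "F l' l = 0"
proof (cases "l' \<in> {1..n-1}")
  case True
  then have "ip (Ndim n) (F l') (F l) = 0" using assms by (auto simp: unitary_def ortho_def)
  then have "F l' l * cnj (F l l) = 0" using unitary_ip_single[OF assms(1-3)] by simp
  then show ?thesis using unitary_diag[OF assms(1-3)] by auto
next
  case False
  then show ?thesis using assms by (auto simp: unitary_def ortho_def)
qed

lemma unitary_column:
  assumes "F \<in> unitary n (Suc k)" "1 \<le> k" "k \<le> n - 1"
  shows "F k = (\<lambda>a. F k k * basis_vec k a)"
proof
  fix a
  show "F k a = F k k * basis_vec k a"
  proof (cases "a = k")
    case False
    then have "F k a = 0" using assms by (auto simp: unitary_def)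
    then show ?thesis using False by (simp add: basis_vec_def)
  qed (simp add: basis_vec_def)
qed

lemma chain_support: "(\<And>l. F l a = 0) \<Longrightarrow> chain q r z F l a = 0"
  by (induction r arbitrary: l) (auto simp: rot_def)

text \<open>Before the chain e_k is column \<open>k\<close> up to phase, so \<open>carry_row\<close>
  applies to it. Column k + r then misses e_k exactly when some parameter lies on the unit circle,
  and in that case the frame drops into the previous row.\<close>

lemma unitary_chain:
  assumes F: "F \<in> unitary n (Suc k)" and k: "1 \<le> k" "k + r \<le> n - 1" and z: "z \<in> pdisc r"
  shows "chain (\<lambda>m. k + m) r z F \<in> unitary_row n k (Suc r)"
    "chain (\<lambda>m. k + m) r z F (k + r) k = (\<Prod>i<r. sn (z i)) * F k k"
proof -
  let ?q = "\<lambda>m. k + m"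
  have q: "inj_on ?q {..r}" "?q ` {..r} \<subseteq> {1..n-1}" using k by (auto simp: inj_on_def)
  have o: "ortho (Ndim n) {1..n-1} F" using F by (simp add: unitary_def)
  have out: "chain ?q r z F l = F l" if "l < k \<or> l > k + r" for l
    using that by (intro chain_outside) auto
  have "chain ?q r z F \<in> unitary n k"
    unfolding unitary_def
  proof (intro CollectI conjI allI ballI impI)
    show "ortho (Ndim n) {1..n-1} (chain ?q r z F)" using chain_ortho[OF o q pdisc_le[OF z]] by simp
    show "chain ?q r z F l a = 0" if "a \<notin> {1..n-1}" for l a
      using that F by (intro chain_support) (auto simp: unitary_def)
    show "frame_sum {1..n-1} (chain ?q r z F) a b = (if a = b then 1 else 0)" if "a \<in> {1..n-1}" "b \<in> {1..n-1}" for a b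
      using chain_frame_sum[OF _ q pdisc_le[OF z]] F that by (simp add: unitary_def)
    show "chain ?q r z F l a = 0" if "l \<in> {1..<k}" "a \<noteq> l" for l a
      using out[of l] that F by (auto simp: unitary_def)
  qed
  moreover have "chain ?q r z F l k = 0" if "l \<ge> k + Suc r" for l
    using out[of l] unitary_row[OF F, of k l] that k by simp
  ultimately show "chain ?q r z F \<in> unitary_row n k (Suc r)" by (auto simp: unitary_row_def)
  have kN: "k \<in> {1..Ndim n}" using k by (auto simp: Ndim_def)
  have "ip (Ndim n) (F (?q j)) (basis_vec k) = 0" if "0 < j" "j \<le> r" for j
    unfolding ip_basis[OF kN] using unitary_row[OF F, of k "k + j"] that k by simp
  then show "chain ?q r z F (k + r) k = (\<Prod>i<r. sn (z i)) * F k k"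
    using carry_row[OF q(1), of "Ndim n" F "basis_vec k" r z] by (simp add: ip_basis[OF kN])
qed

text \<open>Elimination against e_k gathers all of it in column \<open>k\<close>. The columns form a
  basis of E, so that column is e_k up to phase and the frame fixes one more vector.\<close>

lemma unitary_row_cover:
  assumes G: "G \<in> unitary_row n k (Suc r)" and k: "1 \<le> k" "k + r \<le> n - 1"
  shows "\<exists>F\<in>unitary n (Suc k). \<exists>z\<in>pdisc r. phase_eq (chain (\<lambda>m. k + m) r z F) G"
proof -
  let ?q = "\<lambda>m. k + m"
  have q: "inj_on ?q {..r}" "?q ` {..r} \<subseteq> {1..n-1}" using k by (auto simp: inj_on_def)
  have GF: "G \<in> unitary n k" and Gr: "\<And>l. l \<ge> k + Suc r \<Longrightarrow> G l k = 0" using G by (auto simp: unitary_row_def)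
  have o: "ortho (Ndim n) {1..n-1} G" using GF by (simp add: unitary_def)
  have kN: "k \<in> {1..Ndim n}" using k by (auto simp: Ndim_def)
  obtain z F where z: "z \<in> pdisc r" and F0: "phase_eq (chain ?q r z F) G \<and> ortho (Ndim n) {1..n-1} F \<and>
     (\<forall>j. 0 < j \<and> j \<le> r \<longrightarrow> ip (Ndim n) (F (?q j)) (basis_vec k) = 0) \<and> (\<forall>l. l \<notin> ?q ` {..r} \<longrightarrow> F l = G l) \<and>
     (\<forall>P. lin_closed P \<longrightarrow> (\<forall>i\<le>r. P (G (?q i))) \<longrightarrow> (\<forall>i\<le>r. P (F (?q i))))"
    using chain_cover[OF o q, of "basis_vec k"] by (elim bexE exE)
  have fe: "phase_eq (chain ?q r z F) G" and oF: "ortho (Ndim n) {1..n-1} F" using F0 by blast+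
  note F0' = F0[THEN conjunct2, THEN conjunct2]
  have Fj: "F (k + j) k = 0" if "0 < j" "j \<le> r" for j using F0' that ip_basis[OF kN] by (elim conjE) simp
  have Fout: "F l = G l" if "l < k \<or> l > k + r" for l
  proof -
    have "l \<notin> ?q ` {..r}" using that by auto
    then show ?thesis using F0'[THEN conjunct2, THEN conjunct1] by blast
  qed
  have supp: "F l a = 0" if a: "a \<notin> {1..n-1}" for l a
  proof (cases "l < k \<or> l > k + r")
    case True
    then show ?thesis using Fout GF a by (simp add: unitary_def)
  next
    case False
    let ?P = "\<lambda>u::cvec. u a = 0"
    have "lin_closed ?P" by (simp add: lin_closed_def)
    moreover have "\<forall>i\<le>r. ?P (G (?q i))" using GF a by (simp add: unitary_def)
    ultimately have "\<forall>i\<le>r. ?P (F (?q i))" using F0'[THEN conjunct2, THEN conjunct2, rule_format, of ?P] by blast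
    moreover have "l - k \<le> r" using False by linarith
    ultimately have "?P (F (?q (l - k)))" by blast
    then show ?thesis using False by simp
  qed
  have fs: "frame_sum {1..n-1} F a b = (if a = b then 1 else 0)" if "a \<in> {1..n-1}" "b \<in> {1..n-1}" for a b
  proof -
    have "frame_sum {1..n-1} F a b = frame_sum {1..n-1} (chain ?q r z F) a b"
      using chain_frame_sum[OF _ q pdisc_le[OF z]] by simp
    also have "\<dots> = frame_sum {1..n-1} G a b" using phase_eq_frame_sum[OF fe] by simp
    finally show ?thesis using GF that by (simp add: unitary_def)
  qed
  \<comment> \<open>Columns below \<open>k\<close> are other basis vectors up to phase, those up to
    k + r were cleared by elimination, and those beyond are covered by the row condition.\<close>
  have Fl: "F l k = 0" if "l \<noteq> k" for l
  proof -
    have "l < k \<or> (l = k + (l - k) \<and> 0 < l - k \<and> l - k \<le> r) \<or> l > k + r" using that by auto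
    then consider "l < k" | j where "l = k + j" "0 < j" "j \<le> r" | "l > k + r" by blast
    then show ?thesis
    proof cases
      case 1
      show ?thesis
      proof (cases "l = 0")
        case True
        then show ?thesis using oF by (simp add: ortho_def)
      next
        case False
        then show ?thesis using 1 Fout[of l] GF by (auto simp: unitary_def)
      qed
    next
      case 2
      then show ?thesis using Fj by simp
    next
      case 3
      then show ?thesis using Fout[of l] Gr[of l] by simp
    qed
  qed
  have kS: "k \<in> {1..n-1}" using k by auto
  obtain s where s: "\<forall>a. F k a = s * basis_vec k a"
  proof -
    have "\<exists>s. cmod s = 1 \<and> (\<forall>a. F k a = s * basis_vec k a)"
    proof (rule reproduce_unit[where S = "{1..n-1}" and N = "Ndim n"])
      show "ip (Ndim n) (basis_vec k) (basis_vec k) = 1" unfolding ip_basis[OF kN] by (simp add: basis_vec_def)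
      show "basis_vec k a = (\<Sum>l\<in>{1..n-1}. cnj (ip (Ndim n) (F l) (basis_vec k)) * F l a)" for a
      proof (cases "a \<in> {1..n-1}")
        case True
        have "basis_vec k a = frame_sum {1..n-1} F a k" using fs[OF True kS] by (simp add: basis_vec_def)
        then show ?thesis unfolding ip_basis[OF kN] frame_sum_def by (simp add: mult.commute)
      next
        case False
        then show ?thesis using supp kS by (auto simp: basis_vec_def)
      qed
      show "ip (Ndim n) (F k) (F k) = 1" using oF kS by (simp add: ortho_def)
      show "ip (Ndim n) (F l) (basis_vec k) = 0" if "l \<noteq> k" for l unfolding ip_basis[OF kN] using Fl that by simp
    qed (use kS in auto)
    then show ?thesis using that by blast
  qed
  have "F \<in> unitary n (Suc k)"
    unfolding unitary_def
  proof (intro CollectI conjI allI ballI impI)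
    show "F l a = 0" if "l \<in> {1..<Suc k}" "a \<noteq> l" for l a
    proof (cases "l = k")
      case True
      then show ?thesis using s that by (simp add: basis_vec_def)
    next
      case False
      then show ?thesis using that Fout[of l] GF by (auto simp: unitary_def)
    qed
  qed (use oF supp fs in auto)
  then show ?thesis using z fe by blast
qed

lemma odisc_eqI: "z \<in> odisc r \<Longrightarrow> w \<in> odisc r \<Longrightarrow> (\<And>i. i < r \<Longrightarrow> z i = w i) \<Longrightarrow> z = w"
proof
  fix i assume a: "z \<in> odisc r" "w \<in> odisc r" "\<And>i. i < r \<Longrightarrow> z i = w i"
  show "z i = w i" using a(3)[of i] a(1,2) by (cases "i < r") (auto simp: odisc_alt)
qed

lemma odiscD: "z \<in> odisc r \<Longrightarrow> \<forall>i<r. cmod (z i) < 1"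
  by (simp add: odisc_def)

text \<open>One parameter of modulus 1 makes its own sine, and with it the whole product,
  vanish.\<close>

lemma boundary_sn_prod:
  assumes "z \<in> pdisc r - odisc r" shows "(\<Prod>i<r. sn (z i)) = 0"
proof -
  obtain i where "i < r" "\<not> cmod (z i) < 1" using assms by (auto simp: odisc_def)
  moreover have "cmod (z i) \<le> 1" using pdisc_le[of z r] assms \<open>i < r\<close> by blast
  ultimately have "i < r" "cmod (z i) = 1" by auto
  then show ?thesis by (intro prod_zero bexI[of _ i]) auto
qed

lemma interior_sn_prod: "z \<in> odisc r \<Longrightarrow> (\<Prod>i<r. sn (z i)) \<noteq> 0"
  using odiscD[of z r] sn_nonzero by auto

text \<open>Some column of a basis of E must see e_k, and the first k - 1 columns are multiples of
  other basis vectors.\<close>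

lemma unitary_row_0: 
  assumes "1 \<le> k" "k \<le> n - 1" shows "unitary_row n k 0 = {}"
proof -
  have False if F: "F \<in> unitary n k" "\<And>l. l \<ge> k \<Longrightarrow> F l k = 0" for F
  proof -
    have "F l k = 0" if "l \<in> {1..n-1}" for l
      using F that by (cases "l < k") (auto simp: unitary_def)
    then have "frame_sum {1..n-1} F k k = 0" by (simp add: frame_sum_def)
    moreover have "k \<in> {1..n-1}" using assms by simp
    ultimately show False using F(1) unfolding unitary_def by fastforce
  qed
  then show ?thesis by (auto simp: unitary_row_def)
qed

text \<open>Shifts by 0, ..., r - 1, which multiply the generating polynomial by [r]_q.\<close>

primrec stagelist :: "nat \<Rightarrow> nat list \<Rightarrow> nat list" where
  "stagelist 0 ds = []"
| "stagelist (Suc r) ds = map (\<lambda>d. d + r) ds @ stagelist r ds"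

primrec flagdims :: "nat \<Rightarrow> nat list" where
  "flagdims 0 = [0]"
| "flagdims (Suc m) = stagelist (Suc m) (flagdims m)"

text \<open>Passing from row r to row r + 1 attaches, for every cell of the frames fixing one more
  vector, its product with r discs. The previous row absorbs the boundary in these discs.\<close>

lemma cellular_unitary_row:
  assumes cellular: "cellular (unitary n (Suc k)) ds" and k: "1 \<le> k"
  shows "k + r \<le> n \<Longrightarrow> k \<le> n - 1 \<Longrightarrow> cellular (unitary_row n k r) (stagelist r ds)"
proof (induction r)
  case 0
  then show ?case using unitary_row_0[OF k] cellular.empty by simp
next
  case (Suc r)
  let ?q = "\<lambda>m. k + m"
  have kr: "k + r \<le> n - 1" using Suc.prems by simp
  have q: "inj_on ?q {..r}" "?q ` {..r} \<subseteq> {1..n-1}" using k kr by (auto simp: inj_on_def)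
  have B: "cellular (unitary_row n k r) (stagelist r ds)" using Suc by simp
  have kk: "k \<in> {1..<Suc k}" "k \<le> n - 1" using k Suc.prems by auto
  have "cellular (opset (chain ?q r) r (unitary n (Suc k)) \<union> unitary_row n k r) (map (\<lambda>d. d + r) ds @ stagelist r ds)"
  proof (rule cellular_stage[OF cellular order_refl B])
    show "continuous_on S (\<lambda>x. chain ?q r (w x) (f x))" if "continuous_on S f" "continuous_on S w"
      for f w and S :: "(nat \<Rightarrow> complex) set"
      using that by (intro continuous_on_chain)
    show "\<exists>w\<in>pdisc r. phase_eq (chain ?q r w F) (chain ?q r z G)" if "phase_eq F G" "z \<in> pdisc r" for F G z
      using chain_phase[OF that(1) q(1) that(2)] by blast
    show "chain ?q r z F \<in> unitary_row n k r" if "F \<in> unitary n (Suc k)" "z \<in> pdisc r - odisc r" for F z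
    proof -
      have c: "chain ?q r z F \<in> unitary_row n k (Suc r)" "chain ?q r z F (k + r) k = 0"
        using unitary_chain[OF that(1) k kr, of z] boundary_sn_prod[of z r] that(2) by auto
      show ?thesis unfolding unitary_row_def
      proof (intro CollectI conjI allI impI)
        show "chain ?q r z F \<in> unitary n k" using c by (simp add: unitary_row_def)
        show "chain ?q r z F l k = 0" if "l \<ge> k + r" for l
          using c that by (cases "l = k + r") (auto simp: unitary_row_def)
      qed
    qed
    show "chain ?q r z F \<notin> unitary_row n k r" if "F \<in> unitary n (Suc k)" "z \<in> odisc r" for F z
    proof -
      have "F k k \<noteq> 0" using unitary_diag[OF that(1) kk] by auto
      then have "chain ?q r z F (k + r) k \<noteq> 0"
        using unitary_chain(2)[OF that(1) k kr subsetD[OF odisc_subset that(2)]] interior_sn_prod[OF that(2)] by simp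
      then show ?thesis by (auto simp: unitary_row_def)
    qed
    show "phase_eq F G \<and> (F = G \<longrightarrow> z = w)"
      if F: "F \<in> unitary n (Suc k)" "G \<in> unitary n (Suc k)" "z \<in> odisc r" "w \<in> odisc r" "phase_eq (chain ?q r z F) (chain ?q r w G)"
      for F G z w
    proof -
      \<comment> \<open>Both first columns are unit multiples of e_k; this is the phase between
        them, from which the recovery of parameters starts.\<close>
      let ?s = "G k k * cnj (F k k)"
      have d: "cmod (F k k) = 1" "cmod (G k k) = 1" using unitary_diag[OF F(1) kk] unitary_diag[OF F(2) kk] by auto
      have s: "cmod ?s = 1" using d by (simp add: norm_mult)
      have e: "\<forall>a. G (?q 0) a = ?s * F (?q 0) a"
      proof
        fix a
        have "?s * F k a = G k k * (F k k * cnj (F k k)) * basis_vec k a"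
          using fun_cong[OF unitary_column[OF F(1) k kk(2)], of a] by (metis mult.assoc mult.commute)
        also have "\<dots> = G k a" using unit_cnj[OF d(1)] fun_cong[OF unitary_column[OF F(2) k kk(2)], of a] by simp
        finally show "G (?q 0) a = ?s * F (?q 0) a" by simp
      qed
      have o: "ortho (Ndim n) {1..n-1} F" "ortho (Ndim n) {1..n-1} G" using F by (auto simp: unitary_def)
      note c = chain_injective[OF o q odiscD[OF F(3)] odiscD[OF F(4)] s e F(5)]
      show ?thesis using c(1) c(2) odisc_eqI[OF F(3,4)] by blast
    qed
  qed
  moreover have "opset (chain ?q r) r (unitary n (Suc k)) \<union> unitary_row n k r = unitary_row n k (Suc r)"
  proof
    show "opset (chain ?q r) r (unitary n (Suc k)) \<union> unitary_row n k r \<subseteq> unitary_row n k (Suc r)"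
    proof
      fix G assume "G \<in> opset (chain ?q r) r (unitary n (Suc k)) \<union> unitary_row n k r"
      then consider F z where "F \<in> unitary n (Suc k)" "z \<in> pdisc r" "phase_eq (chain ?q r z F) G" | "G \<in> unitary_row n k r"
        unfolding opset_def by blast
      then show "G \<in> unitary_row n k (Suc r)"
      proof cases
        case 1
        then show ?thesis using unitary_row_phase_eq[OF unitary_chain(1)[OF _ k kr]] by blast
      next
        case 2
        then show ?thesis by (simp add: unitary_row_def)
      qed
    qed
    show "unitary_row n k (Suc r) \<subseteq> opset (chain ?q r) r (unitary n (Suc k)) \<union> unitary_row n k r"
      using unitary_row_cover[OF _ k kr] unfolding opset_def by blast
  qed
  ultimately show ?case by simp
qed

lemma cellular_unitary_base: "n \<ge> 2 \<Longrightarrow> cellular (unitary n n) [0]"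
proof -
  assume n: "n \<ge> 2"
  define I :: frame where "I = (\<lambda>l a. if l = a \<and> l \<in> {1..n-1} then 1 else 0)"
  have ip: "ip (Ndim n) u (I l) = (if l \<in> {1..n-1} then u l else 0)" for u l
  proof -
    have "ip (Ndim n) u (I l) = (\<Sum>a\<in>{1..Ndim n}. if a = l then (if l \<in> {1..n-1} then u l else 0) else 0)"
      unfolding ip_def I_def by (intro sum.cong) auto
    then show ?thesis using Ndim_ge(1)[OF n] by auto
  qed
  have I: "I \<in> unitary n n" unfolding unitary_def
  proof (intro CollectI conjI ballI allI impI)
    show "ortho (Ndim n) {1..n-1} I" unfolding ortho_def using Ndim_ge(1)[OF n]
      by (auto simp: ip) (auto simp: I_def)
    show "frame_sum {1..n-1} I a b = (if a = b then 1 else 0)" if "a \<in> {1..n-1}" "b \<in> {1..n-1}" for a b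
    proof -
      have "frame_sum {1..n-1} I a b = (\<Sum>l\<in>{1..n-1}. if l = a then (if a = b then 1 else 0) else 0)"
        unfolding frame_sum_def I_def by (intro sum.cong) auto
      then show ?thesis using that by simp
    qed
  qed (auto simp: I_def)
  have "cellular ({} \<union> {G. \<exists>t\<in>pdisc 0. phase_eq I G}) (0 # [])"
  proof (rule cellular.attach[OF cellular.empty])
    fix t t' :: "nat \<Rightarrow> complex" assume "t \<in> odisc 0" "t' \<in> odisc 0"
    then show "t = t'" by (intro odisc_eqI[of _ 0]) auto
  qed (auto simp: odisc_def)
  moreover have "{G. \<exists>t\<in>pdisc 0. phase_eq I G} = unitary n n"
  proof
    show "{G. \<exists>t\<in>pdisc 0. phase_eq I G} \<subseteq> unitary n n" using unitary_phase_eq[OF I] by blast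
    show "unitary n n \<subseteq> {G. \<exists>t\<in>pdisc 0. phase_eq I G}"
    proof
      fix G assume G: "G \<in> unitary n n"
      have "phase_eq I G" unfolding phase_eq_def
      proof
        fix l
        show "\<exists>t. cmod t = 1 \<and> (\<forall>a. G l a = t * I l a)"
        proof (cases "l \<in> {1..n-1}")
          case True
          then have l: "l \<in> {1..<n}" "l \<le> n - 1" using n by auto
          have "G l a = G l l * I l a" for a using True G l by (cases "a = l") (auto simp: I_def unitary_def)
          then show ?thesis using unitary_diag[OF G l] by blast
        next
          case False
          then have "G l a = 1 * I l a" for a using G by (auto simp: I_def unitary_def ortho_def)
          then show ?thesis by (intro exI[of _ 1]) auto
        qed
      qed
      then show "G \<in> {G. \<exists>t\<in>pdisc 0. phase_eq I G}" using zero_pdisc by blast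
    qed
  qed
  ultimately show ?thesis by simp
qed

text \<open>Backwards induction from the single flag with all vectors fixed. With j columns left
  free the line e_{n-j} can enter at j places, and this produces the factor [j]_q of the
  q-factorial.\<close>

lemma cellular_unitary:
  assumes "n \<ge> 2" shows "cellular (unitary n 1) (flagdims (n - 1))"
proof -
  have "cellular (unitary n (n - j)) (flagdims j)" if "j \<le> n - 1" for j
    using that
  proof (induction j)
    case 0
    then show ?case using cellular_unitary_base[OF assms] by simp
  next
    case (Suc j)
    have S: "Suc (n - Suc j) = n - j" using Suc.prems by simp
    have "cellular (unitary_row n (n - Suc j) (Suc j)) (stagelist (Suc j) (flagdims j))"
      by (rule cellular_unitary_row) (use Suc S in auto)
    \<comment> \<open>The row condition concerns only columns beyond n - 1, which vanish.\<close>
    moreover have "unitary_row n (n - Suc j) (Suc j) = unitary n (n - Suc j)"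
    proof -
      have "F l a = 0" if "F \<in> unitary n (n - Suc j)" "l \<ge> n - Suc j + Suc j" for F l a
      proof -
        have "l \<notin> {1..n-1}" using that(2) Suc.prems by auto
        then show ?thesis using that(1) unfolding unitary_def ortho_def by blast
      qed
      then show ?thesis unfolding unitary_row_def by blast
    qed
    ultimately show ?case by simp
  qed
  from this[of "n - 1"] show ?thesis using assms by simp
qed

section \<open>Generating polynomials of cell dimensions\<close>

definition dim_poly :: "nat list \<Rightarrow> int poly" where
  "dim_poly ds = sum_list (map (monom 1) ds)"

lemma dim_poly_append [simp]: "dim_poly (xs @ ys) = dim_poly xs + dim_poly ys"
  by (simp add: dim_poly_def)

lemma dim_poly_shift: "dim_poly (map (\<lambda>d. d + r) ds) = monom 1 r * dim_poly ds"
  by (induction ds) (auto simp: dim_poly_def mult_monom algebra_simps)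

lemma dim_poly_stagelist: "dim_poly (stagelist r ds) = qint r * dim_poly ds"
proof (induction r)
  case 0
  show ?case by (simp add: dim_poly_def qint_def)
next
  case (Suc r)
  then show ?case by (simp only: stagelist.simps dim_poly_append dim_poly_shift) (simp add: qint_def algebra_simps)
qed

lemma dim_poly_flagdims: "dim_poly (flagdims m) = qfact m"
proof (induction m)
  case 0
  show ?case by (simp add: dim_poly_def qfact_def)
next
  case (Suc m)
  have "qfact (Suc m) = qint (Suc m) * qfact m" by (simp add: qfact_def mult.commute)
  then show ?case using Suc by (simp only: flagdims.simps dim_poly_stagelist)
qed

lemma coeff_dim_poly: "coeff (dim_poly ds) k = int (count_list ds k)"
  by (induction ds) (auto simp: dim_poly_def)

section \<open>Frames adapted to a line\<close>

text \<open>The isometric section of \<open>x\<close> with image in the orthogonal complement of \<open>E\<close>.\<close>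
definition ymap :: "nat \<Rightarrow> cvec \<Rightarrow> cvec" where
  "ymap n v = (\<lambda>a. if n \<le> a \<and> a \<le> Ndim n then v (a - (n - 1)) else 0)"

text \<open>Orthonormal bases of \<open>E + \<complex> y v\<close>, where \<open>v\<close> spans \<open>L\<close>, such that \<open>L \<subseteq> V\<^bsub>1+r1\<^esub>\<close> and \<open>V\<^bsub>n-r2-1\<^esub> \<subseteq> E\<close>; thus \<open>K\<^bsup>i,j\<^esup>\<close> belongs to \<open>r1 = i - 2\<close>, \<open>r2 = n - j\<close>.\<close>
definition adapted_to :: "nat \<Rightarrow> cvec \<Rightarrow> nat \<Rightarrow> nat \<Rightarrow> frame \<Rightarrow> bool" where
  "adapted_to n v r1 r2 G \<longleftrightarrow> v \<in> Espan (n - 1) \<and> ip (Ndim n) v v = 1 \<and> ortho (Ndim n) {1..n} G \<and>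
     (\<forall>a\<in>{1..Ndim n}. \<forall>b\<in>{1..Ndim n}. frame_sum {1..n} G a b =
        (if a = b \<and> a \<le> n - 1 then 1 else 0) + ymap n v a * cnj (ymap n v b)) \<and>
     (\<forall>l>1+r1. ip (Ndim n) (G l) v = 0) \<and> (\<forall>l. l + r2 < n \<longrightarrow> ip (Ndim n) (G l) (ymap n v) = 0)"

definition adapted :: "nat \<Rightarrow> nat \<Rightarrow> nat \<Rightarrow> frame set" where
  "adapted n r1 r2 = {G. \<exists>v. adapted_to n v r1 r2 G}"

lemma Espan_D: "v \<in> Espan m \<Longrightarrow> a \<notin> {1..m} \<Longrightarrow> v a = 0"
  by (cases "a = 0") (auto simp: Espan_def)

lemma ymap_out: "a \<notin> {n..Ndim n} \<Longrightarrow> ymap n v a = 0"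
  by (auto simp: ymap_def)

lemma ymap_at: "n \<ge> 2 \<Longrightarrow> a \<in> {1..n-1} \<Longrightarrow> ymap n v (a + (n - 1)) = v a"
proof -
  assume "n \<ge> 2" "a \<in> {1..n-1}"
  then have "n \<le> a + (n - 1)" "a + (n - 1) \<le> Ndim n" "a + (n - 1) - (n - 1) = a" by (auto simp: Ndim_def)
  then show ?thesis unfolding ymap_def by simp
qed

lemma ip_ymap:
  assumes n: "n \<ge> 2" and "v \<in> Espan (n - 1)"
  shows "ip (Ndim n) (ymap n v) (ymap n w) = ip (Ndim n) v w"
proof -
  have "ip (Ndim n) v w = (\<Sum>a\<in>{1..n-1}. v a * cnj (w a))"
    unfolding ip_def using Ndim_ge[OF n] Espan_D[OF assms(2)] by (intro sum.mono_neutral_right) auto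
  also have "\<dots> = (\<Sum>a\<in>{n..Ndim n}. v (a - (n - 1)) * cnj (w (a - (n - 1))))"
    by (rule sum.reindex_bij_witness[of _ "\<lambda>a. a - (n - 1)" "\<lambda>a. a + (n - 1)"])
       (use n in \<open>auto simp: Ndim_def\<close>)
  also have "\<dots> = (\<Sum>a\<in>{n..Ndim n}. ymap n v a * cnj (ymap n w a))"
    by (intro sum.cong) (auto simp: ymap_def)
  also have "\<dots> = ip (Ndim n) (ymap n v) (ymap n w)"
    unfolding ip_def using n by (intro sum.mono_neutral_left) (auto simp: ymap_def)
  finally show ?thesis ..
qed

lemma ip_E_ymap: "(\<And>a. a \<ge> n \<Longrightarrow> u a = 0) \<Longrightarrow> ip N u (ymap n w) = 0"
  unfolding ip_def by (intro sum.neutral) (auto simp: ymap_def)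

lemma ip_ymap_E: "(\<And>a. a \<ge> n \<Longrightarrow> u a = 0) \<Longrightarrow> ip N (ymap n w) u = 0"
  unfolding ip_def by (intro sum.neutral) (auto simp: ymap_def)

text \<open>Both sides apply the projection matrix to \<open>u\<close>, once through the columns and
  once through the entries.\<close>

lemma reproduce_frame_sum: "(\<Sum>l\<in>S. cnj (ip N (G l) u) * G l a) = (\<Sum>b\<in>{1..N}. frame_sum S G a b * u b)"
proof -
  have "(\<Sum>l\<in>S. cnj (ip N (G l) u) * G l a) = (\<Sum>l\<in>S. \<Sum>b\<in>{1..N}. G l a * cnj (G l b) * u b)"
    unfolding ip_def by (intro sum.cong refl) (simp add: sum_distrib_right sum_distrib_left mult_ac)
  also have "\<dots> = (\<Sum>b\<in>{1..N}. \<Sum>l\<in>S. G l a * cnj (G l b) * u b)" by (rule sum.swap)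
  finally show ?thesis by (simp add: frame_sum_def sum_distrib_right)
qed

lemma adapted_to_reproduce:
  assumes n: "n \<ge> 2" and G: "ortho (Ndim n) {1..n} G" "\<And>a b. a\<in>{1..Ndim n} \<Longrightarrow> b\<in>{1..Ndim n} \<Longrightarrow> frame_sum {1..n} G a b =
        (if a = b \<and> a \<le> n - 1 then 1 else 0) + ymap n v a * cnj (ymap n v b)"
  shows "(\<Sum>l\<in>{1..n}. cnj (ip (Ndim n) (G l) u) * G l a) =
     (if a \<in> {1..Ndim n} \<and> a \<le> n - 1 then u a else 0) + ymap n v a * ip (Ndim n) u (ymap n v)"
proof (cases "a \<in> {1..Ndim n}")
  case True
  have "(\<Sum>b\<in>{1..Ndim n}. frame_sum {1..n} G a b * u b) =
     (\<Sum>b\<in>{1..Ndim n}. (if b = a then (if a \<le> n - 1 then u a else 0) else 0) + ymap n v a * (u b * cnj (ymap n v b)))"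
    using True G(2) by (intro sum.cong refl) (auto simp: algebra_simps)
  also have "\<dots> = (if a \<le> n - 1 then u a else 0) + ymap n v a * ip (Ndim n) u (ymap n v)"
    using True by (simp add: sum.distrib sum_distrib_left ip_def)
  finally show ?thesis unfolding reproduce_frame_sum using True by simp
next
  case False
  then have "G l a = 0" for l using G(1) by (simp add: ortho_def)
  then show ?thesis using False ymap_out[of a n v] n by auto
qed

lemma adapted_phase_eq: "G \<in> adapted n r1 r2 \<Longrightarrow> phase_eq G H \<Longrightarrow> H \<in> adapted n r1 r2"
  unfolding adapted_def adapted_to_def using phase_eq_ortho[of G H] phase_eq_frame_sum[of G H] phase_eq_ip_0[of G H] by auto

text \<open>The full frame sum is invariant under phases. Subtracting the projection onto E leaves
  the rank one projection onto y v, which determines y v, and with it v, up to one common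
  phase.\<close>

lemma adapted_to_unique:
  assumes n: "n \<ge> 2" and G: "adapted_to n v r1 r2 G" "adapted_to n v' r1' r2' G'" "phase_eq G G'"
  shows "\<exists>s. cmod s = 1 \<and> (\<forall>a. v' a = s * v a) \<and> (\<forall>a. ymap n v' a = s * ymap n v a)"
proof -
  let ?N = "Ndim n"
  have v: "v \<in> Espan (n - 1)" "ip ?N v v = 1" "v' \<in> Espan (n - 1)" "ip ?N v' v' = 1"
    using G by (auto simp: adapted_to_def)
  have "ymap n v a * cnj (ymap n v b) = ymap n v' a * cnj (ymap n v' b)" if "a \<in> {1..?N}" "b \<in> {1..?N}" for a b
    using phase_eq_frame_sum[OF G(3), of "{1..n}" a b] G(1,2) that unfolding adapted_to_def by simp
  then have "\<exists>s. cmod s = 1 \<and> (\<forall>a. ymap n v' a = s * ymap n v a)"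
    using v ip_ymap[OF n] n by (intro rank_one_eq[of ?N]) (auto simp: ymap_def)
  then obtain s where s: "cmod s = 1" "\<And>a. ymap n v' a = s * ymap n v a" by blast
  have "v' a = s * v a" for a
  proof (cases "a \<in> {1..n-1}")
    case True
    then show ?thesis using s(2)[of "a + (n - 1)"] ymap_at[OF n True] by simp
  next
    case False
    then show ?thesis using Espan_D[OF v(1) False] Espan_D[OF v(3) False] by simp
  qed
  then show ?thesis using s by blast
qed

text \<open>For a basis \<open>W\<close> of E this is a point of the smallest stratum r1 = r2 = 0: L
  is spanned by the first column, and the last column is orthogonal to E, so V_{n-1} = E.\<close>

definition lift :: "nat \<Rightarrow> frame \<Rightarrow> frame" where
  "lift n W = W(n := ymap n (W 1))"

lemma lift_phase_eq: "phase_eq W W' \<Longrightarrow> phase_eq (lift n W) (lift n W')"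
proof -
  assume f: "phase_eq W W'"
  obtain t where t: "cmod t = 1" "\<And>a. W' 1 a = t * W 1 a" using f unfolding phase_eq_def by blast
  show ?thesis unfolding phase_eq_def
  proof
    fix l
    show "\<exists>t. cmod t = 1 \<and> (\<forall>a. lift n W' l a = t * lift n W l a)"
    proof (cases "l = n")
      case True
      then show ?thesis using t by (intro exI[of _ t]) (auto simp: lift_def ymap_def)
    next
      case False
      then show ?thesis using f by (simp add: lift_def phase_eq_def)
    qed
  qed
qed

lemma continuous_on_lift: "continuous_on S f \<Longrightarrow> continuous_on S (\<lambda>x. lift n (f x))"
proof -
  assume c: "continuous_on S f"
  have c2: "continuous_on S (\<lambda>x. f x l a)" for l a by (rule continuous_on_component[OF continuous_on_component[OF c]])
  have "continuous_on S (\<lambda>x. lift n (f x) l a)" for l a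
  proof (cases "l = n")
    case True
    then show ?thesis using c2[of 1 "a - (n - 1)"] by (cases "n \<le> a \<and> a \<le> Ndim n") (auto simp: lift_def ymap_def)
  next
    case False
    then show ?thesis using c2[of l a] by (simp add: lift_def)
  qed
  then show ?thesis
    by (rule continuous_on_coordinatewise_then_product[OF continuous_on_coordinatewise_then_product])
qed

lemma unitaryD:
  assumes "W \<in> unitary n k"
  shows "ortho (Ndim n) {1..n-1} W" "a \<notin> {1..n-1} \<Longrightarrow> W l a = 0"
    "a \<in> {1..n-1} \<Longrightarrow> b \<in> {1..n-1} \<Longrightarrow> frame_sum {1..n-1} W a b = (if a = b then 1 else 0)"
  using assms by (auto simp: unitary_def)

lemma lift_adapted_to:
  assumes n: "n \<ge> 2" and W: "W \<in> unitary n 1"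
  shows "adapted_to n (W 1) 0 0 (lift n W)"
proof -
  let ?N = "Ndim n" and ?v = "W 1"
  note W1 = unitaryD[OF W]
  have sup: "W l a = 0" if "a \<ge> n" for l a using W1(2)[of a l] that n by auto
  have io: "ip ?N (W l) (W l') = (if l = l' then 1 else 0)" if "l \<in> {1..n-1}" "l' \<in> {1..n-1}" for l l'
    using W1(1) that unfolding ortho_def by blast
  have v: "?v \<in> Espan (n - 1)" using W1(2) by (auto simp: Espan_def)
  have v1: "ip ?N ?v ?v = 1" using io[of 1 1] n by simp
  have ll: "lift n W l = W l" if "l \<noteq> n" for l using that by (simp add: lift_def)
  have ln: "lift n W n = ymap n ?v" by (simp add: lift_def)
  have W0: "W l = (\<lambda>_. 0)" if "l \<notin> {1..n-1}" for l using W1(1) that by (auto simp: ortho_def)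
  show ?thesis unfolding adapted_to_def
  proof (intro conjI ballI allI impI)
    show "ortho ?N {1..n} (lift n W)" unfolding ortho_def
    proof (intro conjI ballI allI impI)
      fix l l' assume l: "l \<in> {1..n}" "l' \<in> {1..n}"
      show "ip ?N (lift n W l) (lift n W l') = (if l = l' then 1 else 0)"
      proof (cases "l = n"; cases "l' = n")
        assume "l = n" "l' = n"
        then show ?thesis using ip_ymap[OF n v, of ?v] v1 by (simp add: ln)
      next
        assume "l = n" "l' \<noteq> n"
        then show ?thesis using ip_ymap_E[OF sup] by (simp add: ln ll)
      next
        assume "l \<noteq> n" "l' = n"
        then show ?thesis using ip_E_ymap[OF sup] by (simp add: ln ll)
      next
        assume "l \<noteq> n" "l' \<noteq> n"
        then show ?thesis using io[of l l'] l by (auto simp: ll)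
      qed
    next
      fix l a assume "l \<notin> {1..n} \<or> a \<notin> {1..?N}"
      then show "lift n W l a = 0" using W1(1) n by (cases "l = n") (auto simp: ln ll ortho_def ymap_def)
    qed
    fix a b assume ab: "a \<in> {1..?N}" "b \<in> {1..?N}"
    have "{1..n} = insert n {1..n-1}" using n by auto
    then have "frame_sum {1..n} (lift n W) a b = frame_sum {1..n-1} (lift n W) a b + ymap n ?v a * cnj (ymap n ?v b)"
      using n by (simp add: frame_sum_def ln add.commute)
    also have "frame_sum {1..n-1} (lift n W) a b = frame_sum {1..n-1} W a b"
      unfolding frame_sum_def using n by (intro sum.cong) (auto simp: ll)
    also have "\<dots> = (if a = b \<and> a \<le> n - 1 then 1 else 0)"
    proof (cases "a \<le> n - 1 \<and> b \<le> n - 1")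
      case True
      then show ?thesis using W1(3)[of a b] ab by auto
    next
      case False
      then have "a \<notin> {1..n-1} \<or> b \<notin> {1..n-1}" by auto
      then have "W l a * cnj (W l b) = 0" for l using W1(2)[of a l] W1(2)[of b l] by auto
      then have "frame_sum {1..n-1} W a b = 0" unfolding frame_sum_def by (intro sum.neutral) blast
      then show ?thesis using False by auto
    qed
    finally show "frame_sum {1..n} (lift n W) a b = (if a = b \<and> a \<le> n - 1 then 1 else 0) + ymap n ?v a * cnj (ymap n ?v b)" .
  next
    fix l :: nat assume l: "1 + 0 < l"
    show "ip ?N (lift n W l) ?v = 0"
    proof (cases "l = n")
      case True
      then show ?thesis using ip_ymap_E[OF sup] by (simp add: ln)
    next
      case False
      then show ?thesis using io[of l 1] l n W0[of l] by (cases "l \<in> {1..n-1}") (auto simp: ll ip_def)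
    qed
  next
    fix l assume "l + 0 < n"
    then show "ip ?N (lift n W l) (ymap n ?v) = 0" using ip_E_ymap[OF sup] by (simp add: ll)
  qed (use v v1 in auto)
qed

lemma chain_lin:
  assumes "lin_closed P" "\<And>j. j \<le> r \<Longrightarrow> P (F (q j))" "j \<le> r"
  shows "P (chain q r z F (q j))"
proof -
  have "\<forall>l. l \<in> q ` {..r} \<longrightarrow> P (chain q m z F l)" if "m \<le> r" for m
    using that
  proof (induction m)
    case 0
    then show ?case using assms(2) by auto
  next
    case (Suc m)
    have m: "q m \<in> q ` {..r}" "q (Suc m) \<in> q ` {..r}" using Suc.prems by auto
    have "P (chain q m z F (q m))" "P (chain q m z F (q (Suc m)))" using Suc m by auto
    then have 1: "P (\<lambda>a. x * chain q m z F (q m) a + y * chain q m z F (q (Suc m)) a)" for x y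
      using assms(1) unfolding lin_closed_def by blast
    show ?case
    proof (intro allI impI)
      fix l assume "l \<in> q ` {..r}"
      then have "P (chain q m z F l)" using Suc by auto
      then show "P (chain q (Suc m) z F l)"
        using 1[of "z m" "- sn (z m)"] 1[of "sn (z m)" "cnj (z m)"] by (simp add: rot_def)
    qed
  qed
  then show ?thesis using assms(3) by blast
qed

lemma lin_closed_ip: "lin_closed (\<lambda>u. ip N u e = 0)"
  by (simp add: lin_closed_def ip_lin1)

text \<open>The first r1 coordinates turn L away from column 1 upwards, the other r2 turn y v away
  from column n downwards.\<close>

definition adapted_op :: "nat \<Rightarrow> nat \<Rightarrow> nat \<Rightarrow> (nat \<Rightarrow> complex) \<Rightarrow> frame \<Rightarrow> frame" where
  "adapted_op n r1 r2 z W = chain (\<lambda>m. n - m) r2 (shift r1 z) (chain Suc r1 (trunc r1 z) (lift n W))"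

lemma chains_index:
  assumes "n \<ge> 2" "r1 + r2 \<le> n - 2"
  shows "inj_on Suc {..r1}" "Suc ` {..r1} \<subseteq> {1..n}"
    "inj_on (\<lambda>m. n - m) {..r2}" "(\<lambda>m. n - m) ` {..r2} \<subseteq> {1..n}"
  using assms by (auto simp: inj_on_def)

text \<open>These rotations stay below column n, where all columns are orthogonal to y v, so the
  conditions on y v survive while those on v are relaxed by r1 columns.\<close>

lemma adapted_to_up:
  assumes n: "n \<ge> 2" "r1 + r2 \<le> n - 2" and F: "adapted_to n v 0 0 F" and z: "z \<in> pdisc r1"
  shows "adapted_to n v r1 0 (chain Suc r1 z F)"
   "ip (Ndim n) (chain Suc r1 z F (1 + r1)) v = (\<Prod>i<r1. sn (z i)) * ip (Ndim n) (F 1) v"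
   "l > 1 + r1 \<Longrightarrow> chain Suc r1 z F l = F l"
proof -
  let ?N = "Ndim n" and ?q = "Suc"
  let ?H = "chain ?q r1 z F"
  note q = chains_index(1,2)[OF n]
  have F': "v \<in> Espan (n - 1)" "ip ?N v v = 1" "ortho ?N {1..n} F"
    "\<And>a b. a \<in> {1..?N} \<Longrightarrow> b \<in> {1..?N} \<Longrightarrow> frame_sum {1..n} F a b = (if a = b \<and> a \<le> n - 1 then 1 else 0) + ymap n v a * cnj (ymap n v b)"
    "\<And>l. l > 1 \<Longrightarrow> ip ?N (F l) v = 0" "\<And>l. l < n \<Longrightarrow> ip ?N (F l) (ymap n v) = 0"
    using F by (auto simp: adapted_to_def)
  have out: "?H l = F l" if "l \<notin> ?q ` {..r1}" for l using that by (rule chain_outside)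
  show o: "l > 1 + r1 \<Longrightarrow> ?H l = F l" for l by (rule out) auto
  show "ip ?N (?H (1 + r1)) v = (\<Prod>i<r1. sn (z i)) * ip ?N (F 1) v"
    using carry_row[OF q(1), of ?N F v r1 z] F'(5) by simp
  show "adapted_to n v r1 0 ?H" unfolding adapted_to_def
  proof (intro conjI ballI allI impI)
    show "ortho ?N {1..n} ?H" using chain_ortho[OF F'(3) q pdisc_le[OF z]] by simp
    show "frame_sum {1..n} ?H a b = (if a = b \<and> a \<le> n - 1 then 1 else 0) + ymap n v a * cnj (ymap n v b)"
      if "a \<in> {1..?N}" "b \<in> {1..?N}" for a b
      using chain_frame_sum[OF _ q pdisc_le[OF z], of r1 F a b] F'(4)[OF that] by simp
    show "ip ?N (?H l) v = 0" if "1 + r1 < l" for l using o[OF that] F'(5)[of l] that by simp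
    show "ip ?N (?H l) (ymap n v) = 0" if "l + 0 < n" for l
    proof (cases "l \<in> ?q ` {..r1}")
      case True
      then obtain j where j: "l = ?q j" "j \<le> r1" by auto
      show ?thesis unfolding j(1)
        by (rule chain_lin[OF lin_closed_ip _ j(2)]) (use F'(6) n in auto)
    next
      case False
      then show ?thesis using out[OF False] F'(6) that by simp
    qed
  qed (use F' in auto)
qed

text \<open>By r1 + r2 \<le> n - 2 these rotations touch only columns beyond 1 + r1. All of these
  are orthogonal to v, so L stays where the upward chain has put it.\<close>

lemma adapted_to_down:
  assumes n: "n \<ge> 2" "r1 + r2 \<le> n - 2" and H: "adapted_to n v r1 0 H" and z: "z \<in> pdisc r2"
  shows "adapted_to n v r1 r2 (chain (\<lambda>m. n - m) r2 z H)"
   "ip (Ndim n) (chain (\<lambda>m. n - m) r2 z H (n - r2)) (ymap n v) = (\<Prod>i<r2. sn (z i)) * ip (Ndim n) (H n) (ymap n v)"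
   "l + r2 < n \<Longrightarrow> chain (\<lambda>m. n - m) r2 z H l = H l"
proof -
  let ?N = "Ndim n" and ?q = "\<lambda>m::nat. n - m"
  let ?G = "chain ?q r2 z H"
  note q = chains_index(3,4)[OF n]
  have H': "v \<in> Espan (n - 1)" "ip ?N v v = 1" "ortho ?N {1..n} H"
    "\<And>a b. a \<in> {1..?N} \<Longrightarrow> b \<in> {1..?N} \<Longrightarrow> frame_sum {1..n} H a b = (if a = b \<and> a \<le> n - 1 then 1 else 0) + ymap n v a * cnj (ymap n v b)"
    "\<And>l. l > 1 + r1 \<Longrightarrow> ip ?N (H l) v = 0" "\<And>l. l < n \<Longrightarrow> ip ?N (H l) (ymap n v) = 0"
    using H by (auto simp: adapted_to_def)
  have out: "?G l = H l" if "l \<notin> ?q ` {..r2}" for l using that by (rule chain_outside)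
  show o: "l + r2 < n \<Longrightarrow> ?G l = H l" for l by (rule out) auto
  show "ip ?N (?G (n - r2)) (ymap n v) = (\<Prod>i<r2. sn (z i)) * ip ?N (H n) (ymap n v)"
    using carry_row[OF q(1), of ?N H "ymap n v" r2 z] H'(6) n by simp
  show "adapted_to n v r1 r2 ?G" unfolding adapted_to_def
  proof (intro conjI ballI allI impI)
    show "ortho ?N {1..n} ?G" using chain_ortho[OF H'(3) q pdisc_le[OF z]] by simp
    show "frame_sum {1..n} ?G a b = (if a = b \<and> a \<le> n - 1 then 1 else 0) + ymap n v a * cnj (ymap n v b)"
      if "a \<in> {1..?N}" "b \<in> {1..?N}" for a b
      using chain_frame_sum[OF _ q pdisc_le[OF z], of r2 H a b] H'(4)[OF that] by simp
    show "ip ?N (?G l) v = 0" if "1 + r1 < l" for l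
    proof (cases "l \<in> ?q ` {..r2}")
      case True
      then obtain j where j: "l = ?q j" "j \<le> r2" by auto
      show ?thesis unfolding j(1)
        by (rule chain_lin[OF lin_closed_ip _ j(2)]) (use H'(5) n in auto)
    next
      case False
      then show ?thesis using out[OF False] H'(5) that by simp
    qed
    show "ip ?N (?G l) (ymap n v) = 0" if "l + r2 < n" for l using o[OF that] H'(6)[of l] that by simp
  qed (use H' in auto)
qed

text \<open>Two independent tests: the first product vanishes when L already lies one step lower in
  the flag, the second when one more space of the flag lies in E. They decide which smaller stratum
  receives a boundary point.\<close>

lemma adapted_op_adapted_to:
  assumes n: "n \<ge> 2" "r1 + r2 \<le> n - 2" and W: "W \<in> unitary n 1" and z: "z \<in> pdisc (r1 + r2)"
  shows "adapted_to n (W 1) r1 r2 (adapted_op n r1 r2 z W)"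
   "ip (Ndim n) (adapted_op n r1 r2 z W (1 + r1)) (W 1) = (\<Prod>i<r1. sn (trunc r1 z i))"
   "ip (Ndim n) (adapted_op n r1 r2 z W (n - r2)) (ymap n (W 1)) = (\<Prod>i<r2. sn (shift r1 z i))"
proof -
  let ?v = "W 1" and ?H = "chain Suc r1 (trunc r1 z) (lift n W)"
  have L: "adapted_to n ?v 0 0 (lift n W)" by (rule lift_adapted_to[OF n(1) W])
  have v: "?v \<in> Espan (n - 1)" "ip (Ndim n) ?v ?v = 1" using L by (auto simp: adapted_to_def)
  note u = adapted_to_up[OF n L trunc_pdisc[OF z]]
  note d = adapted_to_down[OF n u(1) shift_pdisc[OF z]]
  show "adapted_to n ?v r1 r2 (adapted_op n r1 r2 z W)" using d(1) by (simp add: adapted_op_def)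
  have "adapted_op n r1 r2 z W (1 + r1) = ?H (1 + r1)" unfolding adapted_op_def using n by (intro d(3)) auto
  then show "ip (Ndim n) (adapted_op n r1 r2 z W (1 + r1)) ?v = (\<Prod>i<r1. sn (trunc r1 z i))"
    using u(2) v n by (simp add: lift_def)
  have "?H n = lift n W n" using n by (intro u(3)) auto
  then show "ip (Ndim n) (adapted_op n r1 r2 z W (n - r2)) (ymap n ?v) = (\<Prod>i<r2. sn (shift r1 z i))"
    using d(2) ip_ymap[OF n(1) v(1), of ?v] v unfolding adapted_op_def by (simp add: lift_def)
qed

text \<open>The two chains are undone in reverse order by elimination, against y v in the columns n
  - r2 to n, then against v in the columns 1 to 1 + r1. Afterwards y v sits in column n and v in
  column 1 up to phase, and the remaining columns are orthogonal to y v and so lie in E.\<close>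

lemma adapted_cover:
  assumes n: "n \<ge> 2" "r1 + r2 \<le> n - 2" and G: "G \<in> adapted n r1 r2"
  shows "\<exists>W\<in>unitary n 1. \<exists>z\<in>pdisc (r1 + r2). phase_eq (adapted_op n r1 r2 z W) G"
proof -
  let ?N = "Ndim n"
  obtain v where Gv: "adapted_to n v r1 r2 G" using G by (auto simp: adapted_def)
  let ?y = "ymap n v"
  let ?fs = "\<lambda>a b. (if a = b \<and> a \<le> n - 1 then 1 else 0) + ?y a * cnj (?y b)"
  have G': "v \<in> Espan (n - 1)" "ip ?N v v = 1" "ortho ?N {1..n} G"
    "\<And>a b. a \<in> {1..?N} \<Longrightarrow> b \<in> {1..?N} \<Longrightarrow> frame_sum {1..n} G a b = ?fs a b"
    "\<And>l. l > 1 + r1 \<Longrightarrow> ip ?N (G l) v = 0" "\<And>l. l + r2 < n \<Longrightarrow> ip ?N (G l) ?y = 0"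
    using Gv by (auto simp: adapted_to_def)
  have vn: "v a = 0" if "a \<ge> n" for a using Espan_D[OF G'(1), of a] that n by auto
  have yy: "ip ?N ?y ?y = 1" using ip_ymap[OF n(1) G'(1)] G'(2) by simp
  note qd = chains_index(3,4)[OF n] and qu = chains_index(1,2)[OF n]
  let ?d = "\<lambda>m::nat. n - m"
  obtain z2 H where z2: "z2 \<in> pdisc r2" and H0: "phase_eq (chain ?d r2 z2 H) G \<and> ortho ?N {1..n} H \<and>
     (\<forall>j. 0 < j \<and> j \<le> r2 \<longrightarrow> ip ?N (H (?d j)) ?y = 0) \<and> (\<forall>l. l \<notin> ?d ` {..r2} \<longrightarrow> H l = G l) \<and>
     (\<forall>P. lin_closed P \<longrightarrow> (\<forall>i\<le>r2. P (G (?d i))) \<longrightarrow> (\<forall>i\<le>r2. P (H (?d i))))"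
    using chain_cover[OF G'(3) qd, of ?y] by (elim bexE exE)
  have H1: "phase_eq (chain ?d r2 z2 H) G" "ortho ?N {1..n} H" using H0 by blast+
  note H0' = H0[THEN conjunct2, THEN conjunct2]
  have Hj: "ip ?N (H (?d j)) ?y = 0" if "0 < j" "j \<le> r2" for j using H0' that by (elim conjE) simp
  have Hout: "H l = G l" if "l \<notin> ?d ` {..r2}" for l using H0'[THEN conjunct2, THEN conjunct1] that by blast
  have Hfs: "frame_sum {1..n} H a b = ?fs a b" if "a \<in> {1..?N}" "b \<in> {1..?N}" for a b
    using chain_frame_sum[OF _ qd pdisc_le[OF z2], of r2 H a b] phase_eq_frame_sum[OF H1(1), of "{1..n}" a b] G'(4)[OF that] by simp
  have Hy: "ip ?N (H l) ?y = 0" if "l \<noteq> n" for l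
  proof (cases "l \<in> ?d ` {..r2}")
    case True
    then obtain j where "l = ?d j" "j \<le> r2" by auto
    then show ?thesis using Hj[of j] that by (cases "j = 0") auto
  next
    case False
    have "l + r2 < n \<or> l > n"
    proof (rule ccontr)
      assume "\<not> (l + r2 < n \<or> l > n)"
      then have "l = ?d (n - l)" "n - l \<le> r2" by auto
      then show False using False by blast
    qed
    then show ?thesis using Hout[OF False] G'(6)[of l] G'(3) by (auto simp: ortho_def ip_def)
  qed
  have Hv: "ip ?N (H l) v = 0" if "l > 1 + r1" for l
  proof (cases "l \<in> ?d ` {..r2}")
    case True
    then obtain j where j: "l = ?d j" "j \<le> r2" by auto
    have "\<forall>i\<le>r2. ip ?N (G (?d i)) v = 0" using G'(5) n by auto
    then have "\<forall>i\<le>r2. ip ?N (H (?d i)) v = 0"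
      using H0'[THEN conjunct2, THEN conjunct2, rule_format, of "\<lambda>u. ip ?N u v = 0"] lin_closed_ip by blast
    then show ?thesis using j by blast
  next
    case False
    then show ?thesis using Hout[OF False] G'(5)[OF that] by simp
  qed
  have Hrep: "(\<Sum>l\<in>{1..n}. cnj (ip ?N (K l) u) * K l a) = (if a \<in> {1..?N} \<and> a \<le> n - 1 then u a else 0) + ?y a * ip ?N u ?y"
    if "ortho ?N {1..n} K" "\<And>a b. a \<in> {1..?N} \<Longrightarrow> b \<in> {1..?N} \<Longrightarrow> frame_sum {1..n} K a b = ?fs a b" for K u a
    by (rule adapted_to_reproduce[OF n(1) that])
  \<comment> \<open>The vector y v lies in V_n, and only column n still sees it.\<close>
  have "\<exists>s. cmod s = 1 \<and> (\<forall>a. H n a = s * ?y a)"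
  proof (rule reproduce_unit[where S = "{1..n}" and N = ?N])
    show "?y a = (\<Sum>l\<in>{1..n}. cnj (ip ?N (H l) ?y) * H l a)" for a
    proof -
      have "(if a \<in> {1..?N} \<and> a \<le> n - 1 then ?y a else 0) = 0" using n by (auto simp: ymap_def)
      then show ?thesis using Hrep[OF H1(2) Hfs, of ?y a] yy by simp
    qed
    show "ip ?N (H n) (H n) = 1" using H1(2) n by (simp add: ortho_def)
  qed (use yy n Hy in auto)
  then obtain s where s: "cmod s = 1" "\<And>a. H n a = s * ?y a" by blast
  obtain z1 F where z1: "z1 \<in> pdisc r1" and F0: "phase_eq (chain Suc r1 z1 F) H \<and> ortho ?N {1..n} F \<and>
     (\<forall>j. 0 < j \<and> j \<le> r1 \<longrightarrow> ip ?N (F (Suc j)) v = 0) \<and> (\<forall>l. l \<notin> Suc ` {..r1} \<longrightarrow> F l = H l) \<and>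
     (\<forall>P. lin_closed P \<longrightarrow> (\<forall>i\<le>r1. P (H (Suc i))) \<longrightarrow> (\<forall>i\<le>r1. P (F (Suc i))))"
    using chain_cover[OF H1(2) qu, of v] by (elim bexE exE)
  have F1: "phase_eq (chain Suc r1 z1 F) H" "ortho ?N {1..n} F" using F0 by blast+
  note F0' = F0[THEN conjunct2, THEN conjunct2]
  have Fj: "ip ?N (F (Suc j)) v = 0" if "0 < j" "j \<le> r1" for j using F0' that by (elim conjE) simp
  have Fout: "F l = H l" if "l \<notin> Suc ` {..r1}" for l using F0'[THEN conjunct2, THEN conjunct1] that by blast
  have Ffs: "frame_sum {1..n} F a b = ?fs a b" if "a \<in> {1..?N}" "b \<in> {1..?N}" for a b
    using chain_frame_sum[OF _ qu pdisc_le[OF z1], of r1 F a b] phase_eq_frame_sum[OF F1(1), of "{1..n}" a b] Hfs[OF that] by simp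
  have Fn: "F n a = s * ?y a" for a
  proof -
    have "n \<notin> Suc ` {..r1}" using n by auto
    then show ?thesis using Fout[of n] s(2) by simp
  qed
  have Fy: "ip ?N (F l) ?y = 0" if "l \<noteq> n" for l
  proof (cases "l \<in> Suc ` {..r1}")
    case True
    then obtain j where j: "l = Suc j" "j \<le> r1" by auto
    have "\<forall>i\<le>r1. ip ?N (H (Suc i)) ?y = 0" using Hy n by auto
    then have "\<forall>i\<le>r1. ip ?N (F (Suc i)) ?y = 0"
      using F0'[THEN conjunct2, THEN conjunct2, rule_format, of "\<lambda>u. ip ?N u ?y = 0"] lin_closed_ip by blast
    then show ?thesis using j by blast
  next
    case False
    then show ?thesis using Fout[OF False] Hy[OF that] by simp
  qed
  have Fv: "ip ?N (F l) v = 0" if "l \<in> {1..n}" "l \<noteq> 1" for l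
  proof (cases "l \<in> Suc ` {..r1}")
    case True
    then obtain j where "l = Suc j" "j \<le> r1" by auto
    then show ?thesis using Fj[of j] that by auto
  next
    case False
    have "l > 1 + r1"
    proof (rule ccontr)
      assume "\<not> l > 1 + r1"
      then have "l = Suc (l - 1)" "l - 1 \<le> r1" using that by auto
      then show False using False by blast
    qed
    then show ?thesis using Fout[OF False] Hv by simp
  qed
  have "\<exists>s. cmod s = 1 \<and> (\<forall>a. F 1 a = s * v a)"
  proof (rule reproduce_unit[where S = "{1..n}" and N = ?N])
    show "v a = (\<Sum>l\<in>{1..n}. cnj (ip ?N (F l) v) * F l a)" for a
    proof -
      have "(if a \<in> {1..?N} \<and> a \<le> n - 1 then v a else 0) = v a"
        using Espan_D[OF G'(1), of a] Ndim_ge[OF n(1)] by auto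
      then show ?thesis using Hrep[OF F1(2) Ffs, of v a] ip_E_ymap[OF vn, where w = v and N = ?N] by simp
    qed
    show "ip ?N (F 1) (F 1) = 1" using F1(2) n by (simp add: ortho_def)
  qed (use G'(2) n Fv in auto)
  then obtain s' where s': "cmod s' = 1" "\<And>a. F 1 a = s' * v a" by blast
  \<comment> \<open>A vector of V_n orthogonal to y v equals its own projection to E.\<close>
  have FE: "F l a = 0" if "l \<noteq> n" "a \<notin> {1..n-1}" for l a
  proof (cases "l \<in> {1..n}")
    case True
    have "(\<Sum>k\<in>{1..n}. cnj (ip ?N (F k) (F l)) * F k a) = (\<Sum>k\<in>{1..n}. if k = l then F l a else 0)"
      using F1(2) True by (intro sum.cong) (auto simp: ortho_def)
    then have "F l a = (\<Sum>k\<in>{1..n}. cnj (ip ?N (F k) (F l)) * F k a)" using True by simp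
    also have "\<dots> = 0" using Hrep[OF F1(2) Ffs, of "F l" a] Fy[OF that(1)] that(2) by auto
    finally show ?thesis .
  next
    case False
    then show ?thesis using F1(2) by (simp add: ortho_def)
  qed
  define W where "W = F(n := (\<lambda>_. 0))"
  have Wl: "W l = F l" if "l \<noteq> n" for l using that by (simp add: W_def)
  have WFr: "W \<in> unitary n 1" unfolding unitary_def
  proof (intro CollectI conjI allI ballI impI)
    show "ortho ?N {1..n-1} W" unfolding ortho_def
    proof (intro conjI ballI allI impI)
      show "ip ?N (W l) (W l') = (if l = l' then 1 else 0)" if "l \<in> {1..n-1}" "l' \<in> {1..n-1}" for l l'
      proof -
        have "l \<in> {1..n}" "l' \<in> {1..n}" "l \<noteq> n" "l' \<noteq> n" using that n by auto
        then show ?thesis using F1(2) by (simp add: ortho_def Wl)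
      qed
      show "W l a = 0" if "l \<notin> {1..n-1} \<or> a \<notin> {1..?N}" for l a
      proof (cases "l = n")
        case False
        then have "l \<notin> {1..n} \<or> a \<notin> {1..?N}" using that by auto
        then show ?thesis using F1(2) False by (simp add: ortho_def Wl)
      qed (simp add: W_def)
    qed
    show "W l a = 0" if "a \<notin> {1..n-1}" for l a using FE that by (cases "l = n") (auto simp: W_def)
    fix a b assume ab: "a \<in> {1..n-1}" "b \<in> {1..n-1}"
    have "{1..n} = insert n {1..n-1}" using n by auto
    then have "frame_sum {1..n} F a b = frame_sum {1..n-1} F a b + F n a * cnj (F n b)"
      using n by (simp add: frame_sum_def add.commute)
    moreover have "F n a = 0" unfolding Fn using ab n by (auto simp: ymap_def)
    moreover have "frame_sum {1..n-1} W a b = frame_sum {1..n-1} F a b"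
      unfolding frame_sum_def using n by (intro sum.cong) (auto simp: Wl)
    ultimately have "frame_sum {1..n-1} W a b = ?fs a b" using Ffs[of a b] ab Ndim_ge[OF n(1)] by auto
    then show "frame_sum {1..n-1} W a b = (if a = b then 1 else 0)" using ab n by (auto simp: ymap_def)
  qed auto
  \<comment> \<open>The phases of columns 1 and n are unrelated in \<open>F\<close> but tied
    together in \<open>lift n W\<close>, so equality can hold only up to phases; these are then
    moved through both chains.\<close>
  have LF: "phase_eq (lift n W) F" unfolding phase_eq_def
  proof
    fix l
    show "\<exists>t. cmod t = 1 \<and> (\<forall>a. F l a = t * lift n W l a)"
    proof (cases "l = n")
      case True
      let ?t = "s * cnj s'"
      have "F n a = ?t * ymap n (W 1) a" for a
      proof -
        have "ymap n (W 1) a = s' * ?y a" using s'(2) Wl[of 1] n by (simp add: ymap_def)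
        then have "?t * ymap n (W 1) a = s * (s' * cnj s') * ?y a" by (simp add: mult_ac)
        then show ?thesis using unit_cnj[OF s'(1)] Fn[of a] by auto
      qed
      moreover have "cmod ?t = 1" using s(1) s'(1) by (simp add: norm_mult)
      ultimately show ?thesis using True by (intro exI[of _ ?t]) (simp add: lift_def)
    next
      case False
      then have "F l a = 1 * lift n W l a" for a by (simp add: lift_def Wl)
      then show ?thesis by (intro exI[of _ 1]) auto
    qed
  qed
  obtain w1 where w1: "w1 \<in> pdisc r1" "phase_eq (chain Suc r1 w1 (lift n W)) (chain Suc r1 z1 F)"
    using chain_phase[OF LF qu(1) z1] by blast
  have "phase_eq (chain Suc r1 w1 (lift n W)) H" using phase_eq_trans[OF w1(2) F1(1)] .
  then obtain w2 where w2: "w2 \<in> pdisc r2" "phase_eq (chain ?d r2 w2 (chain Suc r1 w1 (lift n W))) (chain ?d r2 z2 H)"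
    using chain_phase[OF _ qd(1) z2] by blast
  let ?z = "merge r1 w1 w2"
  have "adapted_op n r1 r2 ?z W = chain ?d r2 w2 (chain Suc r1 w1 (lift n W))"
    unfolding adapted_op_def using trunc_merge[OF w1(1)] by simp
  then have "phase_eq (adapted_op n r1 r2 ?z W) G" using phase_eq_trans[OF w2(2) H1(1)] by simp
  then show ?thesis using WFr merge_pdisc[OF w1(1) w2(1)] by blast
qed

definition adapted_union :: "nat \<Rightarrow> (nat \<times> nat) set \<Rightarrow> frame set" where
  "adapted_union n \<Delta> = (\<Union>(r1, r2)\<in>\<Delta>. adapted n r1 r2)"

lemma lift_inj: "n \<ge> 2 \<Longrightarrow> W \<in> unitary n 1 \<Longrightarrow> W' \<in> unitary n 1 \<Longrightarrow> phase_eq (lift n W) (lift n W') \<Longrightarrow> phase_eq W W'"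
  unfolding phase_eq_def
proof (intro allI)
  fix l assume n: "n \<ge> 2" and W: "W \<in> unitary n 1" "W' \<in> unitary n 1" and f: "\<forall>l. \<exists>t. cmod t = 1 \<and> (\<forall>a. lift n W' l a = t * lift n W l a)"
  show "\<exists>t. cmod t = 1 \<and> (\<forall>a. W' l a = t * W l a)"
  proof (cases "l = n")
    case True
    then have "l \<notin> {1..n-1}" using n by auto
    then have "W' l a = 1 * W l a" for a using unitaryD(1)[OF W(1)] unitaryD(1)[OF W(2)] unfolding ortho_def by simp
    then show ?thesis by (intro exI[of _ 1]) auto
  next
    case False
    then show ?thesis using f[rule_format, of l] by (simp add: lift_def)
  qed
qed

text \<open>\<open>down\<close> provides the smaller strata that absorb the boundary,
  \<open>max\<close> keeps interior points out of the strata already present. Every cell of the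
  flags of E contributes one cell with r1 + r2 further discs.\<close>

lemma cellular_adapted_union_step:
  assumes n: "n \<ge> 2" "r1 + r2 \<le> n - 2" and B: "cellular (adapted_union n \<Delta>) ds0"
    and down: "\<And>s1 s2. s1 \<le> r1 \<Longrightarrow> s2 \<le> r2 \<Longrightarrow> (s1, s2) \<noteq> (r1, r2) \<Longrightarrow> (s1, s2) \<in> \<Delta>"
    and max: "\<And>s1 s2. (s1, s2) \<in> \<Delta> \<Longrightarrow> \<not> (r1 \<le> s1 \<and> r2 \<le> s2)"
  shows "cellular (adapted_union n (insert (r1, r2) \<Delta>)) (map (\<lambda>d. d + (r1 + r2)) (flagdims (n - 1)) @ ds0)"
proof -
  let ?N = "Ndim n" and ?Op = "adapted_op n r1 r2" and ?d = "\<lambda>m::nat. n - m"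
  note qd = chains_index(3,4)[OF n] and qu = chains_index(1,2)[OF n]
  have "cellular (opset ?Op (r1 + r2) (unitary n 1) \<union> adapted_union n \<Delta>) (map (\<lambda>d. d + (r1 + r2)) (flagdims (n - 1)) @ ds0)"
  proof (rule cellular_stage[OF cellular_unitary[OF n(1)] order_refl B])
    show "continuous_on S (\<lambda>x. ?Op (w x) (f x))" if "continuous_on S f" "continuous_on S w"
      for f w and S :: "(nat \<Rightarrow> complex) set"
      unfolding adapted_op_def
      by (intro continuous_on_chain continuous_on_shift continuous_on_trunc continuous_on_lift that)
    show "\<exists>w\<in>pdisc (r1 + r2). phase_eq (?Op w F) (?Op z G)" if fg: "phase_eq F G" and zz: "z \<in> pdisc (r1 + r2)" for F G z
    proof -
      obtain w1 where w1: "w1 \<in> pdisc r1" "phase_eq (chain Suc r1 w1 (lift n F)) (chain Suc r1 (trunc r1 z) (lift n G))"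
        using chain_phase[OF lift_phase_eq[OF fg] qu(1) trunc_pdisc[OF zz]] by blast
      obtain w2 where w2: "w2 \<in> pdisc r2" "phase_eq (chain ?d r2 w2 (chain Suc r1 w1 (lift n F))) (?Op z G)"
        using chain_phase[OF w1(2) qd(1) shift_pdisc[OF zz]] unfolding adapted_op_def by blast
      let ?z = "merge r1 w1 w2"
      have "?Op ?z F = chain ?d r2 w2 (chain Suc r1 w1 (lift n F))"
        unfolding adapted_op_def using trunc_merge[OF w1(1)] by simp
      then show ?thesis using w2(2) merge_pdisc[OF w1(1) w2(1)] by (intro bexI[of _ ?z]) simp_all
    qed
    show "?Op z F \<in> adapted_union n \<Delta>" if F: "F \<in> unitary n 1" and z: "z \<in> pdisc (r1 + r2) - odisc (r1 + r2)" for F z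
    proof -
      have zp: "z \<in> pdisc (r1 + r2)" using z by blast
      note c = adapted_op_adapted_to[OF n F zp]
      consider "trunc r1 z \<notin> odisc r1" | "shift r1 z \<notin> odisc r2" using z odisc_split[of z r1 r2] by blast
      then show ?thesis
      proof cases
        case 1
        then have 0: "ip ?N (?Op z F (1 + r1)) (F 1) = 0"
          using c(2) boundary_sn_prod[of "trunc r1 z" r1] trunc_pdisc[OF zp] by simp
        \<comment> \<open>A polydisc of dimension 0 has no boundary, so the index r1 - 1 below is a
          genuine decrease.\<close>
        have "r1 \<noteq> 0" using 1 trunc_pdisc[OF zp] by (cases "r1 = 0") (auto simp: odisc_def)
        have "ip ?N (?Op z F l) (F 1) = 0" if "l > 1 + (r1 - 1)" for l
        proof (cases "l = 1 + r1")
          case False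
          then have "l > 1 + r1" using that by simp
          then show ?thesis using c(1) unfolding adapted_to_def by blast
        qed (use 0 in simp)
        then have "adapted_to n (F 1) (r1 - 1) r2 (?Op z F)" using c(1) unfolding adapted_to_def by blast
        moreover have "(r1 - 1, r2) \<in> \<Delta>" using down[of "r1 - 1" r2] \<open>r1 \<noteq> 0\<close> by auto
        ultimately show ?thesis unfolding adapted_union_def adapted_def by blast
      next
        case 2
        then have 0: "ip ?N (?Op z F (n - r2)) (ymap n (F 1)) = 0"
          using c(3) boundary_sn_prod[of "shift r1 z" r2] shift_pdisc[OF zp] by simp
        have "r2 \<noteq> 0" using 2 shift_pdisc[OF zp] by (cases "r2 = 0") (auto simp: odisc_def)
        have "ip ?N (?Op z F l) (ymap n (F 1)) = 0" if "l + (r2 - 1) < n" for l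
        proof (cases "l = n - r2")
          case False
          then have "l + r2 < n" using that by linarith
          then show ?thesis using c(1) unfolding adapted_to_def by blast
        qed (use 0 in simp)
        then have "adapted_to n (F 1) r1 (r2 - 1) (?Op z F)" using c(1) unfolding adapted_to_def by blast
        moreover have "(r1, r2 - 1) \<in> \<Delta>" using down[of r1 "r2 - 1"] \<open>r2 \<noteq> 0\<close> by auto
        ultimately show ?thesis unfolding adapted_union_def adapted_def by blast
      qed
    qed
    show "?Op z F \<notin> adapted_union n \<Delta>" if F: "F \<in> unitary n 1" and z: "z \<in> odisc (r1 + r2)" for F z
    proof
      assume "?Op z F \<in> adapted_union n \<Delta>"
      then obtain s1 s2 v where s: "(s1, s2) \<in> \<Delta>" "adapted_to n v s1 s2 (?Op z F)" unfolding adapted_union_def adapted_def by blast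
      have zp: "z \<in> pdisc (r1 + r2)" and zo: "trunc r1 z \<in> odisc r1" "shift r1 z \<in> odisc r2"
        using z odisc_split[of z r1 r2] by blast+
      note c = adapted_op_adapted_to[OF n F zp]
      \<comment> \<open>An older stratum might use another vector \<open>v\<close>, but V_n fixes it
        up to phase, so the two sine products also test membership there.\<close>
      obtain t where t: "cmod t = 1" "\<forall>a. v a = t * F 1 a" "\<forall>a. ymap n v a = t * ymap n (F 1) a"
        using adapted_to_unique[OF n(1) c(1) s(2) phase_eq_refl] by blast
      have v: "v = (\<lambda>a. t * F 1 a)" "ymap n v = (\<lambda>a. t * ymap n (F 1) a)" using t by auto
      have "ip ?N (?Op z F (1 + r1)) v \<noteq> 0"
        unfolding v(1) ip_scale2 c(2) using interior_sn_prod[OF zo(1)] t(1) by auto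
      moreover have "ip ?N (?Op z F (n - r2)) (ymap n v) \<noteq> 0"
        unfolding v(2) ip_scale2 c(3) using interior_sn_prod[OF zo(2)] t(1) by auto
      ultimately have "\<not> 1 + r1 > 1 + s1" "\<not> n - r2 + s2 < n" using s(2) unfolding adapted_to_def by blast+
      then have "r1 \<le> s1" "r2 \<le> s2" using n by auto
      then show False using max s(1) by blast
    qed
    show "phase_eq F G \<and> (F = G \<longrightarrow> z = w)"
      if F: "F \<in> unitary n 1" "G \<in> unitary n 1" and z: "z \<in> odisc (r1 + r2)" "w \<in> odisc (r1 + r2)" and f: "phase_eq (?Op z F) (?Op w G)"
      for F G z w
    proof -
      have zp: "z \<in> pdisc (r1 + r2)" and zo: "trunc r1 z \<in> odisc r1" "shift r1 z \<in> odisc r2"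
        using z odisc_split[of z r1 r2] by blast+
      have wp: "w \<in> pdisc (r1 + r2)" and wo: "trunc r1 w \<in> odisc r1" "shift r1 w \<in> odisc r2"
        using z odisc_split[of w r1 r2] by blast+
      \<comment> \<open>V_n is common to both frames, so their first columns before rotation differ
        by this phase, and so do the images of these under y. Both injectivity arguments start from
        it.\<close>
      obtain t where t: "cmod t = 1" "\<forall>a. G 1 a = t * F 1 a" "\<forall>a. ymap n (G 1) a = t * ymap n (F 1) a"
        using adapted_to_unique[OF n(1) adapted_op_adapted_to(1)[OF n F(1) zp] adapted_op_adapted_to(1)[OF n F(2) wp] f] by blast
      let ?F = "chain Suc r1 (trunc r1 z) (lift n F)" and ?G = "chain Suc r1 (trunc r1 w) (lift n G)"
      note LF = lift_adapted_to[OF n(1) F(1)] and LG = lift_adapted_to[OF n(1) F(2)]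
      note uF = adapted_to_up[OF n LF trunc_pdisc[OF zp]] and uG = adapted_to_up[OF n LG trunc_pdisc[OF wp]]
      have o: "ortho ?N {1..n} ?F" "ortho ?N {1..n} ?G" "ortho ?N {1..n} (lift n F)" "ortho ?N {1..n} (lift n G)"
        using uF(1) uG(1) LF LG unfolding adapted_to_def by blast+
      have "?F n = ymap n (F 1)" "?G n = ymap n (G 1)" using uF(3)[of n] uG(3)[of n] n by (auto simp: lift_def)
      then have e: "\<forall>a. ?G (n - 0) a = t * ?F (n - 0) a" using t(3) by simp
      have f': "phase_eq (chain ?d r2 (shift r1 z) ?F) (chain ?d r2 (shift r1 w) ?G)" using f unfolding adapted_op_def .
      \<comment> \<open>The downward chain was applied last and is therefore removed first.\<close>
      note c2 = chain_injective[OF o(1,2) qd odiscD[OF zo(2)] odiscD[OF wo(2)] t(1) e f']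
      have e': "\<forall>a. lift n G (Suc 0) a = t * lift n F (Suc 0) a" using t(2) n by (simp add: lift_def)
      note c1 = chain_injective[OF o(3,4) qu odiscD[OF zo(1)] odiscD[OF wo(1)] t(1) e' c2(1)]
      have 1: "phase_eq F G" using lift_inj[OF n(1) F c1(1)] .
      have 2: "z = w" if "F = G"
      proof -
        have tr: "trunc r1 z = trunc r1 w" using c1(2) that odisc_eqI[OF zo(1) wo(1)] by blast
        then have "?F = ?G" using that by simp
        then have "shift r1 z = shift r1 w" using c2(2) odisc_eqI[OF zo(2) wo(2)] by blast
        then show ?thesis using tr trunc_shift_eq by blast
      qed
      show ?thesis using 1 2 by blast
    qed
  qed
  moreover have "opset ?Op (r1 + r2) (unitary n 1) \<union> adapted_union n \<Delta> = adapted_union n (insert (r1, r2) \<Delta>)"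
  proof -
    have "opset ?Op (r1 + r2) (unitary n 1) = adapted n r1 r2"
    proof
      show "opset ?Op (r1 + r2) (unitary n 1) \<subseteq> adapted n r1 r2"
      proof
        fix G assume "G \<in> opset ?Op (r1 + r2) (unitary n 1)"
        then obtain F z where "F \<in> unitary n 1" "z \<in> pdisc (r1 + r2)" "phase_eq (?Op z F) G" unfolding opset_def by blast
        moreover have "?Op z F \<in> adapted n r1 r2" using adapted_op_adapted_to(1)[OF n] calculation unfolding adapted_def by blast
        ultimately show "G \<in> adapted n r1 r2" using adapted_phase_eq by blast
      qed
      show "adapted n r1 r2 \<subseteq> opset ?Op (r1 + r2) (unitary n 1)" using adapted_cover[OF n] unfolding opset_def by blast
    qed
    then show ?thesis unfolding adapted_union_def by auto
  qed
  ultimately show ?thesis by simp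
qed

lemma cellular_adapted_union:
  assumes n: "n \<ge> 2" and "finite \<Delta>" and "\<And>r1 r2. (r1, r2) \<in> \<Delta> \<Longrightarrow> r1 + r2 \<le> n - 2"
    and "\<And>r1 r2 s1 s2. (r1, r2) \<in> \<Delta> \<Longrightarrow> s1 \<le> r1 \<Longrightarrow> s2 \<le> r2 \<Longrightarrow> (s1, s2) \<in> \<Delta>"
  shows "\<exists>ds. cellular (adapted_union n \<Delta>) ds \<and> dim_poly ds = qfact (n - 1) * (\<Sum>(r1, r2)\<in>\<Delta>. monom 1 (r1 + r2))"
  using assms(2,3,4)
proof (induction "card \<Delta>" arbitrary: \<Delta>)
  case 0
  then have "\<Delta> = {}" by simp
  then show ?case using cellular.empty by (intro exI[of _ "[]"]) (auto simp: adapted_union_def dim_poly_def)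
next
  case (Suc m)
  then have "\<Delta> \<noteq> {}" by auto
  \<comment> \<open>A cell with maximal r1 + r2 is maximal in the componentwise order, so without it
    the set is still closed downwards.\<close>
  define M where "M = Max ((\<lambda>(r1, r2). r1 + r2) ` \<Delta>)"
  have "M \<in> (\<lambda>(r1, r2). r1 + r2) ` \<Delta>" unfolding M_def using Suc.prems \<open>\<Delta> \<noteq> {}\<close> by (intro Max_in) auto
  then obtain r1 r2 where r: "(r1, r2) \<in> \<Delta>" "M = r1 + r2" by auto
  have M: "s1 + s2 \<le> r1 + r2" if "(s1, s2) \<in> \<Delta>" for s1 s2
    unfolding r(2)[symmetric] M_def using that Suc.prems(1) by (intro Max_ge) force+
  let ?D = "\<Delta> - {(r1, r2)}"
  have "\<exists>ds. cellular (adapted_union n ?D) ds \<and> dim_poly ds = qfact (n - 1) * (\<Sum>(r1, r2)\<in>?D. monom 1 (r1 + r2))"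
  proof (rule Suc.hyps(1))
    show "m = card ?D" using Suc.hyps(2) Suc.prems(1) r(1) by simp
    show "(s1, s2) \<in> ?D" if "(t1, t2) \<in> ?D" "s1 \<le> t1" "s2 \<le> t2" for s1 s2 t1 t2
    proof -
      have "(s1, s2) \<noteq> (r1, r2)"
      proof
        assume "(s1, s2) = (r1, r2)"
        then have "r1 \<le> t1" "r2 \<le> t2" using that by auto
        moreover have "t1 + t2 \<le> r1 + r2" using M that(1) by blast
        ultimately have "(t1, t2) = (r1, r2)" by auto
        then show False using that(1) by blast
      qed
      then show ?thesis using Suc.prems(3) that by blast
    qed
  qed (use Suc.prems in auto)
  then obtain ds where ds: "cellular (adapted_union n ?D) ds" "dim_poly ds = qfact (n - 1) * (\<Sum>(r1, r2)\<in>?D. monom 1 (r1 + r2))" by blast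
  have "cellular (adapted_union n (insert (r1, r2) ?D)) (map (\<lambda>d. d + (r1 + r2)) (flagdims (n - 1)) @ ds)"
  proof (rule cellular_adapted_union_step[OF n _ ds(1)])
    show "r1 + r2 \<le> n - 2" using Suc.prems(2) r(1) .
    show "(s1, s2) \<in> ?D" if "s1 \<le> r1" "s2 \<le> r2" "(s1, s2) \<noteq> (r1, r2)" for s1 s2
      using Suc.prems(3)[OF r(1) that(1,2)] that(3) by blast
    show "\<not> (r1 \<le> s1 \<and> r2 \<le> s2)" if "(s1, s2) \<in> ?D" for s1 s2
    proof
      assume "r1 \<le> s1 \<and> r2 \<le> s2"
      moreover have "s1 + s2 \<le> r1 + r2" using M that by blast
      ultimately have "(s1, s2) = (r1, r2)" by auto
      then show False using that by blast
    qed
  qed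
  moreover have "insert (r1, r2) ?D = \<Delta>" using r(1) by blast
  moreover have "dim_poly (map (\<lambda>d. d + (r1 + r2)) (flagdims (n - 1)) @ ds) =
     qfact (n - 1) * (\<Sum>(r1, r2)\<in>\<Delta>. monom 1 (r1 + r2))"
  proof -
    have "(\<Sum>(r1, r2)\<in>\<Delta>. monom 1 (r1 + r2)) = monom (1::int) (r1 + r2) + (\<Sum>(r1, r2)\<in>?D. monom 1 (r1 + r2))"
      using sum.remove[OF Suc.prems(1) r(1), of "\<lambda>(r1, r2). monom 1 (r1 + r2)"] by simp
    then show ?thesis unfolding dim_poly_append dim_poly_shift dim_poly_flagdims ds(2) by (simp add: algebra_simps)
  qed
  ultimately show ?case by auto
qed

section \<open>Flags and orthonormal frames\<close>

interpretation cv: vector_space cscale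
  by unfold_locales (auto simp: cscale_def fun_eq_iff algebra_simps)

definition csubspace :: "cvec set \<Rightarrow> bool" where
  "csubspace V \<longleftrightarrow> (\<lambda>_. 0) \<in> V \<and> (\<forall>u\<in>V. \<forall>v\<in>V. \<forall>x y. (\<lambda>a. x * u a + y * v a) \<in> V)"

definition lspan :: "nat \<Rightarrow> frame \<Rightarrow> cvec set" where
  "lspan k G = {u. \<exists>c. u = (\<lambda>a. \<Sum>l\<in>{1..k}. c l * G l a)}"

text \<open>In contrast to \<open>ortho\<close>, columns beyond \<open>k\<close> are left open, so a
  system can be extended one vector at a time.\<close>

definition onframe :: "nat \<Rightarrow> nat \<Rightarrow> frame \<Rightarrow> bool" where
  "onframe N k G \<longleftrightarrow> (\<forall>l\<in>{1..k}. G l \<in> Espan N) \<and>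
     (\<forall>l\<in>{1..k}. \<forall>l'\<in>{1..k}. ip N (G l) (G l') = (if l = l' then 1 else 0))"

lemma ortho_onframe: "ortho N {1..n} G \<Longrightarrow> k \<le> n \<Longrightarrow> onframe N k G"
  unfolding ortho_def onframe_def Espan_def by auto

lemma csubspace_zero: "csubspace V \<Longrightarrow> (\<lambda>_. 0) \<in> V"
  unfolding csubspace_def by (rule conjunct1)

lemma csubspace_lin: "csubspace V \<Longrightarrow> u \<in> V \<Longrightarrow> v \<in> V \<Longrightarrow> (\<lambda>a. x * u a + y * v a) \<in> V"
  unfolding csubspace_def by simp

lemma csubspace_scale: "csubspace V \<Longrightarrow> u \<in> V \<Longrightarrow> (\<lambda>a. x * u a) \<in> V"
  using csubspace_lin[of V u u x 0] by simp

lemma csubspace_sum: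
  assumes V: "csubspace V" and "finite S" "\<And>l. l \<in> S \<Longrightarrow> f l \<in> V"
  shows "(\<lambda>a. \<Sum>l\<in>S. c l * f l a) \<in> V"
  using assms(2,3)
proof (induction S rule: finite_induct)
  case empty
  then show ?case using csubspace_zero[OF V] by simp
next
  case (insert x S)
  have "(\<lambda>a. c x * f x a + 1 * (\<Sum>l\<in>S. c l * f l a)) \<in> V"
    by (rule csubspace_lin[OF V]) (use insert in auto)
  then show ?case using insert by simp
qed

lemma csubspace_lspan: "csubspace (lspan k G)"
  unfolding csubspace_def
proof (intro conjI ballI allI)
  show "(\<lambda>_. 0) \<in> lspan k G" unfolding lspan_def by (intro CollectI exI[of _ "\<lambda>_. 0"]) simp
  fix u v x y assume "u \<in> lspan k G" "v \<in> lspan k G"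
  then obtain c d where u: "u = (\<lambda>a. \<Sum>l\<in>{1..k}. c l * G l a)" and v: "v = (\<lambda>a. \<Sum>l\<in>{1..k}. d l * G l a)"
    unfolding lspan_def by blast
  show "(\<lambda>a. x * u a + y * v a) \<in> lspan k G" unfolding lspan_def u v
    by (intro CollectI exI[of _ "\<lambda>l. x * c l + y * d l"])
       (simp add: fun_eq_iff sum_distrib_left sum.distrib algebra_simps)
qed

lemma csubspace_Espan: "csubspace (Espan m)" by (auto simp: csubspace_def Espan_def)

lemma csubspace_Int: "csubspace V \<Longrightarrow> csubspace U \<Longrightarrow> csubspace (V \<inter> U)" by (simp add: csubspace_def)

lemma csubspace_subspace: "csubspace V \<Longrightarrow> cv.subspace V"
proof (rule cv.subspaceI)
  assume V: "csubspace V"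
  show "0 \<in> V" using csubspace_zero[OF V] by (simp add: zero_fun_def)
  show "x + y \<in> V" if "x \<in> V" "y \<in> V" for x y
    using csubspace_lin[OF V that, of 1 1] by (simp add: plus_fun_def)
  show "cscale c x \<in> V" if "x \<in> V" for c x
    using csubspace_scale[OF V that, of c] by (simp add: cscale_def)
qed

lemma lspan_base: "l \<in> {1..k} \<Longrightarrow> G l \<in> lspan k G"
  unfolding lspan_def
proof (intro CollectI exI[of _ "\<lambda>j. if j = l then 1 else 0"] ext)
  fix a assume "l \<in> {1..k}"
  have "(\<Sum>j = 1..k. (if j = l then 1 else 0) * G j a) = (\<Sum>j = 1..k. if j = l then G l a else 0)"
    by (intro sum.cong) auto
  then show "G l a = (\<Sum>j = 1..k. (if j = l then 1 else 0) * G j a)" using \<open>l \<in> {1..k}\<close> by simp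
qed

lemma lspan_minimal: "csubspace V \<Longrightarrow> (\<And>l. l \<in> {1..k} \<Longrightarrow> G l \<in> V) \<Longrightarrow> lspan k G \<subseteq> V"
  unfolding lspan_def using csubspace_sum[of V "{1..k}"] by auto

lemma lspan_cong: "(\<And>l. l \<in> {1..k} \<Longrightarrow> G l = H l) \<Longrightarrow> lspan k G = lspan k H"
  unfolding lspan_def by simp

lemma lspan_mono: "j \<le> k \<Longrightarrow> lspan j G \<subseteq> lspan k G"
  by (rule lspan_minimal[OF csubspace_lspan]) (auto intro: lspan_base)

lemma lspan_span: "lspan k G = cv.span (G ` {1..k})"
proof
  have "csubspace (cv.span (G ` {1..k}))" unfolding csubspace_def
  proof (intro conjI ballI allI)
    show "(\<lambda>_. 0) \<in> cv.span (G ` {1..k})" using cv.span_zero by (simp add: zero_fun_def)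
    fix u v x y assume "u \<in> cv.span (G ` {1..k})" "v \<in> cv.span (G ` {1..k})"
    then have "cscale x u + cscale y v \<in> cv.span (G ` {1..k})" by (intro cv.span_add cv.span_scale)
    then show "(\<lambda>a. x * u a + y * v a) \<in> cv.span (G ` {1..k})" by (simp add: plus_fun_def cscale_def)
  qed
  then show "lspan k G \<subseteq> cv.span (G ` {1..k})" by (rule lspan_minimal) (auto intro: cv.span_base)
  show "cv.span (G ` {1..k}) \<subseteq> lspan k G"
    by (rule cv.span_minimal) (auto intro: lspan_base csubspace_subspace csubspace_lspan)
qed

lemma onframe_expand:
  assumes G: "onframe N k G" and "u \<in> lspan k G"
  shows "u a = (\<Sum>l\<in>{1..k}. ip N u (G l) * G l a)"
proof -
  obtain c where u: "u = (\<lambda>a. \<Sum>l\<in>{1..k}. c l * G l a)" using assms(2) unfolding lspan_def by blast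
  have "ip N u (G l) = c l" if "l \<in> {1..k}" for l
  proof -
    have "ip N u (G l) = (\<Sum>j\<in>{1..k}. c j * ip N (G j) (G l))" unfolding u by (rule ip_sum1)
    also have "\<dots> = (\<Sum>j\<in>{1..k}. if j = l then c l else 0)" using G that by (intro sum.cong) (auto simp: onframe_def)
    finally show ?thesis using that by simp
  qed
  then show ?thesis by (subst u) (auto intro!: sum.cong)
qed

lemma onframe_independent:
  assumes G: "onframe N k G" shows "inj_on G {1..k}" "cv.independent (G ` {1..k})"
proof -
  show inj: "inj_on G {1..k}"
  proof (rule inj_onI)
    fix l l' assume l: "l \<in> {1..k}" "l' \<in> {1..k}" "G l = G l'"
    then have "ip N (G l) (G l') = 1" using G unfolding onframe_def by metis
    then show "l = l'" using G l unfolding onframe_def by (metis zero_neq_one)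
  qed
  show "cv.independent (G ` {1..k})"
    unfolding cv.dependent_def
  proof
    assume "\<exists>a\<in>G ` {1..k}. a \<in> cv.span (G ` {1..k} - {a})"
    then obtain l where l: "l \<in> {1..k}" "G l \<in> cv.span (G ` {1..k} - {G l})" by blast
    let ?U = "{u. ip N u (G l) = 0}"
    have "csubspace ?U" by (simp add: csubspace_def ip_lin1) (simp add: ip_def)
    then have "cv.span (G ` {1..k} - {G l}) \<subseteq> ?U"
      using G l(1) by (intro cv.span_minimal csubspace_subspace) (auto simp: onframe_def)
    then have "ip N (G l) (G l) = 0" using l(2) by blast
    then show False using G l(1) by (simp add: onframe_def)
  qed
qed

lemma cdim_lspan: "onframe N k G \<Longrightarrow> cdim (lspan k G) = k"
  unfolding cdim_def lspan_span
  using onframe_independent[of N k G] by (simp add: cv.dim_eq_card_independent card_image)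

lemma lspan_Espan: "onframe N k G \<Longrightarrow> lspan k G \<subseteq> Espan N"
  by (rule lspan_minimal[OF csubspace_Espan]) (auto simp: onframe_def)

lemma Espan_lspan: "Espan m = lspan m basis_vec"
proof
  show "Espan m \<subseteq> lspan m basis_vec"
  proof
    fix u assume u: "u \<in> Espan m"
    have "u a = (\<Sum>l\<in>{1..m}. u l * basis_vec l a)" for a
    proof -
      have "(\<Sum>l\<in>{1..m}. u l * basis_vec l a) = (\<Sum>l\<in>{1..m}. if l = a then u a else 0)"
        by (intro sum.cong) (auto simp: basis_vec_def)
      then show ?thesis using Espan_D[OF u, of a] by simp
    qed
    then show "u \<in> lspan m basis_vec" unfolding lspan_def by blast
  qed
  show "lspan m basis_vec \<subseteq> Espan m"
    by (rule lspan_minimal[OF csubspace_Espan]) (auto simp: Espan_def basis_vec_def)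
qed

lemma onframe_basis: "m \<le> N \<Longrightarrow> onframe N m basis_vec"
  unfolding onframe_def using ip_basis[of _ N] by (auto simp: Espan_def basis_vec_def)

lemma onframe_le: assumes "onframe N k G" shows "k \<le> N"
proof -
  have "G ` {1..k} \<subseteq> cv.span (basis_vec ` {1..N})"
    using assms unfolding lspan_span[symmetric] Espan_lspan[symmetric] by (auto simp: onframe_def)
  then have "card (G ` {1..k}) \<le> card (basis_vec ` {1..N})"
    using cv.independent_span_bound[OF _ onframe_independent(2)[OF assms], of "basis_vec ` {1..N}"] by simp
  then show ?thesis using card_image[OF onframe_independent(1)[OF assms]] card_image_le[of "{1..N}" basis_vec] by simp
qed

section \<open>Gram-Schmidt and dimension counts\<close>

lemma onframe_extend1:
  assumes G: "onframe N k G" and V: "csubspace V" "V \<subseteq> Espan N" "lspan k G \<subseteq> V" "lspan k G \<noteq> V"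
  shows "\<exists>g\<in>V. onframe N (Suc k) (G(Suc k := g))"
proof -
  obtain u where u: "u \<in> V" "u \<notin> lspan k G" using V by blast
  define p where "p = (\<lambda>a. \<Sum>l\<in>{1..k}. ip N u (G l) * G l a)"
  have p: "p \<in> lspan k G" unfolding p_def lspan_def by (intro CollectI exI) (rule refl)
  define w where "w = (\<lambda>a. 1 * u a + (-1) * p a)"
  have wV: "w \<in> V" unfolding w_def by (rule csubspace_lin[OF V(1)]) (use u p V in auto)
  have pl: "ip N p (G l) = ip N u (G l)" if "l \<in> {1..k}" for l
  proof -
    have "ip N p (G l) = (\<Sum>j\<in>{1..k}. ip N u (G j) * ip N (G j) (G l))" unfolding p_def by (rule ip_sum1)
    also have "\<dots> = (\<Sum>j\<in>{1..k}. if j = l then ip N u (G l) else 0)" using G that by (intro sum.cong) (auto simp: onframe_def)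
    finally show ?thesis using that by simp
  qed
  have wl: "ip N w (G l) = 0" if "l \<in> {1..k}" for l
    unfolding w_def ip_lin1 using pl[OF that] by simp
  have wE: "w \<in> Espan N" using wV V by blast
  have "\<exists>a\<in>{1..N}. w a \<noteq> 0"
  proof (rule ccontr)
    assume "\<not> (\<exists>a\<in>{1..N}. w a \<noteq> 0)"
    then have "w a = 0" for a using Espan_D[OF wE, of a] by blast
    then have "u = p" unfolding w_def by auto
    then show False using u p by simp
  qed
  then have pos: "(\<Sum>a\<in>{1..N}. (cmod (w a))\<^sup>2) > 0"
    by (auto intro!: sum_pos2)
  define r where "r = sqrt (\<Sum>a\<in>{1..N}. (cmod (w a))\<^sup>2)"
  have r: "r > 0" "ip N w w = of_real (r * r)" using pos unfolding ip_self r_def by auto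
  define g where "g = (\<lambda>a. of_real (1 / r) * w a)"
  have gV: "g \<in> V" unfolding g_def by (rule csubspace_scale[OF V(1) wV])
  have gg: "ip N g g = 1" unfolding g_def ip_scale1 ip_scale2 r(2) using r(1) by simp
  have gl: "ip N g (G l) = 0" "ip N (G l) g = 0" if "l \<in> {1..k}" for l
  proof -
    show 1: "ip N g (G l) = 0" unfolding g_def ip_scale1 using wl[OF that] by simp
    show "ip N (G l) g = 0" using ip_cnj[of N g "G l"] 1 by simp
  qed
  have "onframe N (Suc k) (G(Suc k := g))" unfolding onframe_def
  proof (intro conjI ballI)
    show "(G(Suc k := g)) l \<in> Espan N" if "l \<in> {1..Suc k}" for l
      using that G gV V by (cases "l = Suc k") (auto simp: onframe_def)
    fix l l' assume l: "l \<in> {1..Suc k}" "l' \<in> {1..Suc k}"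
    have io: "ip N (G l) (G l') = (if l = l' then 1 else 0)" if "l \<noteq> Suc k" "l' \<noteq> Suc k"
      using G l that by (auto simp: onframe_def)
    have in_k: "l \<noteq> Suc k \<Longrightarrow> l \<in> {1..k}" "l' \<noteq> Suc k \<Longrightarrow> l' \<in> {1..k}" using l by auto
    show "ip N ((G(Suc k := g)) l) ((G(Suc k := g)) l') = (if l = l' then 1 else 0)"
      using gg gl[of l] gl[of l'] io in_k by (cases "l = Suc k"; cases "l' = Suc k") auto
  qed
  then show ?thesis using gV by blast
qed

text \<open>Gram-Schmidt until V is exhausted. It terminates because an orthonormal system in N
  coordinates has at most N members, and the final length is the dimension.\<close>

lemma onframe_extend:
  assumes G: "onframe N k G" and V: "csubspace V" "V \<subseteq> Espan N" "lspan k G \<subseteq> V"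
  shows "\<exists>H. onframe N (cdim V) H \<and> k \<le> cdim V \<and> (\<forall>l\<in>{1..k}. H l = G l) \<and> V = lspan (cdim V) H"
  using assms
proof (induction "N - k" arbitrary: k G rule: less_induct)
  case less
  show ?case
  proof (cases "lspan k G = V")
    case True
    then have "cdim V = k" using cdim_lspan[OF less.prems(1)] by simp
    then show ?thesis using True less.prems(1) by (intro exI[of _ G]) auto
  next
    case False
    then obtain g where g: "g \<in> V" "onframe N (Suc k) (G(Suc k := g))"
      using onframe_extend1[OF less.prems] by blast
    let ?G = "G(Suc k := g)"
    have "lspan (Suc k) ?G \<subseteq> V"
    proof (rule lspan_minimal[OF less.prems(2)])
      fix l assume "l \<in> {1..Suc k}"
      then show "?G l \<in> V" using g(1) less.prems(4) lspan_base[of l k G] by (cases "l = Suc k") auto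
    qed
    moreover have "N - Suc k < N - k" using onframe_le[OF g(2)] by simp
    ultimately obtain H where H: "onframe N (cdim V) H" "Suc k \<le> cdim V" "\<forall>l\<in>{1..Suc k}. H l = ?G l" "V = lspan (cdim V) H"
      using less.hyps[OF _ g(2) less.prems(2,3)] by blast
    have "\<forall>l\<in>{1..k}. H l = G l" using H(3) by auto
    then show ?thesis using H by (intro exI[of _ H]) auto
  qed
qed

lemma onframe_0: "onframe N 0 G" by (simp add: onframe_def)

lemma lspan_0: "lspan 0 G = {\<lambda>_. 0}" by (auto simp: lspan_def)

lemma csubspace_frame:
  assumes "csubspace V" "V \<subseteq> Espan N" shows "\<exists>H. onframe N (cdim V) H \<and> V = lspan (cdim V) H"
proof -
  have "lspan 0 (\<lambda>_ _. 0) \<subseteq> V" unfolding lspan_0 using csubspace_zero[OF assms(1)] by simp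
  note e = onframe_extend[OF onframe_0 assms this]
  show ?thesis
  proof (rule exE[OF e])
    fix H
    assume H: "onframe N (cdim V) H \<and> 0 \<le> cdim V \<and> (\<forall>l\<in>{1..0}. H l = (\<lambda>_. 0)) \<and> V = lspan (cdim V) H"
    have "onframe N (cdim V) H" using H by (rule conjunct1)
    moreover have "V = lspan (cdim V) H" using H[THEN conjunct2, THEN conjunct2] by (rule conjunct2)
    ultimately have "onframe N (cdim V) H \<and> V = lspan (cdim V) H" by (rule conjI)
    then show ?thesis by (intro exI[of _ H])
  qed
qed

lemma cdim_mono: assumes "csubspace U" "csubspace V" "U \<subseteq> V" "V \<subseteq> Espan N" shows "cdim U \<le> cdim V"
proof -
  obtain H where "onframe N (cdim U) H" "U = lspan (cdim U) H" using csubspace_frame[of U N] assms by blast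
  note H = this
  show ?thesis using onframe_extend[OF H(1) assms(2,4)] assms(3) unfolding H(2)[symmetric] by blast
qed

lemma cdim_eq: assumes "csubspace U" "csubspace V" "U \<subseteq> V" "V \<subseteq> Espan N" "cdim V \<le> cdim U" shows "U = V"
proof -
  obtain H where H: "onframe N (cdim U) H" "U = lspan (cdim U) H" using csubspace_frame[of U N] assms by blast
  obtain K where K: "onframe N (cdim V) K" "cdim U \<le> cdim V" "\<forall>l\<in>{1..cdim U}. K l = H l" "V = lspan (cdim V) K"
    using onframe_extend[OF H(1) assms(2,4)] assms(3) unfolding H(2)[symmetric] by blast
  have e: "cdim U = cdim V" using K(2) assms(5) by simp
  have "lspan (cdim V) K = lspan (cdim V) H" by (rule lspan_cong) (use K(3) e in auto)
  then have "lspan (cdim V) K = lspan (cdim U) H" unfolding e .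
  then show ?thesis using H(2)[symmetric] K(4)[symmetric] by argo
qed

text \<open>If V contained two orthonormal vectors orthogonal to its part with vanishing coordinate
  \<open>a\<close>, a nontrivial combination of them would lie in that part and hence be orthogonal
  to itself.\<close>

lemma cdim_hyperplane:
  assumes V: "csubspace V" "V \<subseteq> Espan N"
  shows "cdim V \<le> Suc (cdim (V \<inter> {u. u a = 0}))"
proof -
  let ?U = "V \<inter> {u. u a = 0}"
  have U: "csubspace ?U" by (rule csubspace_Int[OF V(1)]) (simp add: csubspace_def)
  obtain H where H: "onframe N (cdim ?U) H" "?U = lspan (cdim ?U) H" using csubspace_frame[OF U] V by blast
  obtain K where K: "onframe N (cdim V) K" "cdim ?U \<le> cdim V" "\<forall>l\<in>{1..cdim ?U}. K l = H l" "V = lspan (cdim V) K"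
    using onframe_extend[OF H(1) V] unfolding H(2)[symmetric] by blast
  let ?d = "cdim ?U"
  show ?thesis
  proof (rule ccontr)
    assume "\<not> cdim V \<le> Suc ?d"
    then have d: "Suc (Suc ?d) \<le> cdim V" by simp
    let ?p = "K (Suc ?d)" and ?r = "K (Suc (Suc ?d))"
    have pr: "?p \<in> V" "?r \<in> V" using lspan_base[of "Suc ?d" "cdim V" K] lspan_base[of "Suc (Suc ?d)" "cdim V" K] d K(4)[symmetric] by auto
    have io: "ip N (K l) (K l') = (if l = l' then 1 else 0)" if "l \<in> {1..cdim V}" "l' \<in> {1..cdim V}" for l l'
      using K(1) that by (simp add: onframe_def)
    have zero: "u = (\<lambda>_. 0)" if "u \<in> ?U" "\<And>l. l \<in> {1..?d} \<Longrightarrow> ip N u (K l) = 0" for u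
    proof
      fix b
      have "ip N u (H l) = 0" if "l \<in> {1..?d}" for l using that(1) K(3) \<open>\<And>l. l \<in> {1..?d} \<Longrightarrow> ip N u (K l) = 0\<close> by metis
      then show "u b = 0" using onframe_expand[OF H(1), of u b] that(1) H(2) by simp
    qed
    have kill: "x = 0 \<and> y = 0" if e: "x * ?p a + y * ?r a = 0" for x y
    proof -
      let ?u = "\<lambda>b. x * ?p b + y * ?r b"
      have "?u \<in> V" by (rule csubspace_lin[OF V(1) pr])
      then have "?u \<in> ?U" using e by simp
      moreover have "ip N ?u (K l) = 0" if "l \<in> {1..?d}" for l
        unfolding ip_lin1 using io[of "Suc ?d" l] io[of "Suc (Suc ?d)" l] that d by simp
      ultimately have "?u = (\<lambda>_. 0)" by (rule zero)
      then have "ip N ?u ?p = 0" "ip N ?u ?r = 0" by (simp_all add: ip_def)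
      then show ?thesis unfolding ip_lin1
        using io[of "Suc ?d" "Suc ?d"] io[of "Suc (Suc ?d)" "Suc ?d"] io[of "Suc ?d" "Suc (Suc ?d)"]
          io[of "Suc (Suc ?d)" "Suc (Suc ?d)"] d by simp
    qed
    show False
    proof (cases "?p a = 0")
      case True then show False using kill[of 1 0] by simp
    next
      case False
      \<comment> \<open>The combination in which coordinate \<open>a\<close> cancels.\<close>
      then show False using kill[of "- ?r a" "?p a"] by (simp add: mult.commute)
    qed
  qed
qed

lemma cdim_cut:
  assumes "csubspace V" "V \<subseteq> Espan N" "finite S"
  shows "cdim V \<le> card S + cdim (V \<inter> {u. \<forall>a\<in>S. u a = 0})"
  using assms(3)
proof (induction S rule: finite_induct)
  case empty
  then show ?case by simp
next
  case (insert a S)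
  let ?U = "V \<inter> {u. \<forall>a\<in>S. u a = 0}"
  have "csubspace ?U" by (rule csubspace_Int[OF assms(1)]) (simp add: csubspace_def)
  then have "cdim ?U \<le> Suc (cdim (?U \<inter> {u. u a = 0}))" using assms(2) by (intro cdim_hyperplane[of _ N]) auto
  moreover have "?U \<inter> {u. u a = 0} = V \<inter> {u. \<forall>a\<in>insert a S. u a = 0}" by auto
  ultimately show ?case using insert by simp
qed

section \<open>From orthonormal frames to flags\<close>

definition flagof :: "nat \<Rightarrow> frame \<Rightarrow> flagpt" where
  "flagof n G = (\<lambda>(j, a, b). if 1 \<le> j \<and> j \<le> n \<and> 1 \<le> a \<and> a \<le> Ndim n \<and> 1 \<le> b \<and> b \<le> Ndim n
     then frame_sum {1..j} G a b else 0)"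

lemma continuous_on_flagof: "continuous_on UNIV (flagof n)"
proof -
  have c: "continuous_on UNIV (\<lambda>G::frame. G l a)" for l a
    by (rule continuous_on_component[OF continuous_on_component[OF continuous_on_id]])
  have "continuous_on UNIV (\<lambda>G. flagof n G (j, a, b))" for j a b
    unfolding flagof_def frame_sum_def
    by (cases "1 \<le> j \<and> j \<le> n \<and> 1 \<le> a \<and> a \<le> Ndim n \<and> 1 \<le> b \<and> b \<le> Ndim n")
       (simp_all only: case_prod_conv if_True if_False,
        auto intro!: continuous_on_sum continuous_on_mult continuous_on_cnj c)
  then show ?thesis by (intro continuous_on_coordinatewise_then_product) auto
qed

text \<open>The projections onto V_l and V_{l-1} differ by the rank one projection onto column l,
  which determines that column up to phase.\<close>

lemma flagof_eq_iff:
  assumes "ortho (Ndim n) {1..n} G" "ortho (Ndim n) {1..n} H"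
  shows "flagof n G = flagof n H \<longleftrightarrow> phase_eq G H"
proof
  let ?N = "Ndim n"
  assume "phase_eq G H"
  then show "flagof n G = flagof n H" unfolding flagof_def using phase_eq_frame_sum[of G H] by (auto simp: fun_eq_iff)
next
  let ?N = "Ndim n"
  assume eq: "flagof n G = flagof n H"
  have fs: "frame_sum {1..j} G a b = frame_sum {1..j} H a b" if "j \<le> n" "a \<in> {1..?N}" "b \<in> {1..?N}" for j a b
  proof (cases "j = 0")
    case False
    then show ?thesis using fun_cong[OF eq, of "(j, a, b)"] that by (simp add: flagof_def)
  qed (simp add: frame_sum_def)
  show "phase_eq G H" unfolding phase_eq_def
  proof
    fix l
    show "\<exists>t. cmod t = 1 \<and> (\<forall>a. H l a = t * G l a)"
    proof (cases "l \<in> {1..n}")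
      case True
      then obtain j where j: "l = Suc j" by (cases l) auto
      have "G l a * cnj (G l b) = H l a * cnj (H l b)" if "a \<in> {1..?N}" "b \<in> {1..?N}" for a b
        using fs[of l a b] fs[of j a b] that True j by (simp add: frame_sum_def)
      then show ?thesis using assms True by (intro rank_one_eq[of ?N]) (auto simp: ortho_def)
    next
      case False
      then have "H l a = 1 * G l a" for a using assms by (simp add: ortho_def)
      then show ?thesis by (intro exI[of _ 1]) auto
    qed
  qed
qed

lemma Vsp_flagof:
  assumes G: "ortho (Ndim n) {1..n} G" and j: "j \<le> n"
  shows "Vsp n (flagof n G) j = lspan j G"
proof -
  let ?N = "Ndim n"
  have on: "onframe ?N j G" by (rule ortho_onframe[OF G j])
  have pa: "projapp n (flagof n G) j u a = (\<Sum>l\<in>{1..j}. ip ?N u (G l) * G l a)" for u a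
  proof (cases "j = 0")
    case True
    then show ?thesis by (simp add: projapp_def flagof_def)
  next
    case F: False
    show ?thesis
    proof (cases "a \<in> {1..?N}")
      case True
      have "projapp n (flagof n G) j u a = (\<Sum>b\<in>{1..?N}. frame_sum {1..j} G a b * u b)"
        unfolding projapp_def using True F j by (intro sum.cong) (auto simp: flagof_def)
      also have "\<dots> = (\<Sum>l\<in>{1..j}. cnj (ip ?N (G l) u) * G l a)" by (rule reproduce_frame_sum[symmetric])
      finally show ?thesis by (simp add: ip_cnj)
    next
      case False
      then have "G l a = 0" for l using G by (simp add: ortho_def)
      moreover have "projapp n (flagof n G) j u a = 0" unfolding projapp_def
        using False by (intro sum.neutral) (auto simp: flagof_def)
      ultimately show ?thesis by simp
    qed
  qed
  show ?thesis unfolding Vsp_def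
  proof
    show "projapp n (flagof n G) j ` Espan ?N \<subseteq> lspan j G"
    proof
      fix w assume "w \<in> projapp n (flagof n G) j ` Espan ?N"
      then obtain u where "w = projapp n (flagof n G) j u" by blast
      then have "w = (\<lambda>a. \<Sum>l\<in>{1..j}. ip ?N u (G l) * G l a)" using pa by blast
      then show "w \<in> lspan j G" unfolding lspan_def by (intro CollectI exI)
    qed
    show "lspan j G \<subseteq> projapp n (flagof n G) j ` Espan ?N"
    proof
      fix u assume u: "u \<in> lspan j G"
      have "projapp n (flagof n G) j u = u" using pa onframe_expand[OF on u] by auto
      then show "u \<in> projapp n (flagof n G) j ` Espan ?N" using u lspan_Espan[OF on] by force
    qed
  qed
qed

lemma flagof_FlagVar:
  assumes G: "ortho (Ndim n) {1..n} G" shows "flagof n G \<in> FlagVar n"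
  unfolding FlagVar_def
proof (intro CollectI conjI ballI allI impI)
  let ?N = "Ndim n"
  show "flagof n G (j, a, b) = 0" if "\<not> (1 \<le> j \<and> j \<le> n \<and> 1 \<le> a \<and> a \<le> ?N \<and> 1 \<le> b \<and> b \<le> ?N)" for j a b
    using that by (auto simp: flagof_def)
  fix j assume j: "j \<in> {1..n}"
  have on: "onframe ?N j G" using ortho_onframe[OF G] j by simp
  show "cdim (Vsp n (flagof n G) j) = j" using Vsp_flagof[OF G] cdim_lspan[OF on] j by simp
  fix a b assume ab: "a \<in> {1..?N}" "b \<in> {1..?N}"
  have F: "flagof n G (j, a, b) = frame_sum {1..j} G a b" if "a \<in> {1..?N}" "b \<in> {1..?N}" for a b
    using that j by (simp add: flagof_def)
  show "flagof n G (j, a, b) = cnj (flagof n G (j, b, a))"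
    using F[OF ab] F[OF ab(2,1)] by (simp add: frame_sum_def mult.commute)
  have "(\<Sum>c\<in>{1..?N}. flagof n G (j, a, c) * flagof n G (j, c, b)) = (\<Sum>c\<in>{1..?N}. frame_sum {1..j} G a c * frame_sum {1..j} G c b)"
    using F ab by (intro sum.cong) auto
  also have "\<dots> = (\<Sum>l\<in>{1..j}. cnj (ip ?N (G l) (\<lambda>c. frame_sum {1..j} G c b)) * G l a)" by (rule reproduce_frame_sum[symmetric])
  also have "\<dots> = (\<Sum>l\<in>{1..j}. ip ?N (\<lambda>c. frame_sum {1..j} G c b) (G l) * G l a)" by (simp add: ip_cnj)
  also have "\<dots> = frame_sum {1..j} G a b"
  proof -
    have "(\<lambda>c. frame_sum {1..j} G c b) \<in> lspan j G" unfolding lspan_def frame_sum_def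
      by (intro CollectI exI[of _ "\<lambda>l. cnj (G l b)"]) (simp add: mult.commute)
    from onframe_expand[OF on this, of a] show ?thesis by simp
  qed
  finally show "(\<Sum>c\<in>{1..?N}. flagof n G (j, a, c) * flagof n G (j, c, b)) = flagof n G (j, a, b)" using F ab by simp
next
  fix j assume "j \<in> {1..<n}"
  then show "Vsp n (flagof n G) j \<subseteq> Vsp n (flagof n G) (Suc j)"
    using Vsp_flagof[OF G] lspan_mono[of j "Suc j" G] by simp
qed

section \<open>Flags stable under the nilpotent map\<close>

lemma projapp_lin: "projapp n F j (\<lambda>a. x * u a + y * v a) = (\<lambda>a. x * projapp n F j u a + y * projapp n F j v a)"
  by (simp add: projapp_def fun_eq_iff sum.distrib sum_distrib_left algebra_simps)

lemma csubspace_Vsp: "csubspace (Vsp n F j)"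
  unfolding csubspace_def
proof (intro conjI ballI allI)
  have "projapp n F j (\<lambda>_. 0) = (\<lambda>_. 0)" by (simp add: projapp_def)
  then show "(\<lambda>_. 0) \<in> Vsp n F j" unfolding Vsp_def using csubspace_zero[OF csubspace_Espan, of "Ndim n"]
    by (metis image_eqI)
  fix u v x y assume "u \<in> Vsp n F j" "v \<in> Vsp n F j"
  then obtain u' v' where u: "u = projapp n F j u'" "u' \<in> Espan (Ndim n)" and v: "v = projapp n F j v'" "v' \<in> Espan (Ndim n)"
    unfolding Vsp_def by blast
  show "(\<lambda>a. x * u a + y * v a) \<in> Vsp n F j"
    unfolding u(1) v(1) projapp_lin[symmetric] Vsp_def by (rule imageI) (rule csubspace_lin[OF csubspace_Espan u(2) v(2)])
qed

lemma Vsp_Espan: "F \<in> FlagVar n \<Longrightarrow> Vsp n F j \<subseteq> Espan (Ndim n)"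
proof
  fix u assume F: "F \<in> FlagVar n" and "u \<in> Vsp n F j"
  then obtain w where u: "u = projapp n F j w" unfolding Vsp_def by blast
  have "u a = 0" if "a < 1 \<or> Ndim n < a" for a
  proof -
    have "F (j, a, b) = 0" for b using F that unfolding FlagVar_def by force
    then show ?thesis unfolding u projapp_def by simp
  qed
  then show "u \<in> Espan (Ndim n)" by (simp add: Espan_def)
qed

text \<open>Gram-Schmidt along the flag gives a frame with the right spaces. The matrices then agree
  because a hermitian idempotent is determined by its image.\<close>

lemma flag_frame:
  assumes F: "F \<in> FlagVar n"
  shows "\<exists>G. ortho (Ndim n) {1..n} G \<and> F = flagof n G"
proof -
  let ?N = "Ndim n"
  have Fd: "cdim (Vsp n F j) = j" if "j \<in> {1..n}" for j using F that unfolding FlagVar_def by blast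
  have Fm: "Vsp n F j \<subseteq> Vsp n F (Suc j)" if "j \<in> {1..<n}" for j using F that unfolding FlagVar_def by blast
  have Fh: "F (j, a, b) = cnj (F (j, b, a))" "(\<Sum>c\<in>{1..?N}. F (j, a, c) * F (j, c, b)) = F (j, a, b)"
    if "j \<in> {1..n}" "a \<in> {1..?N}" "b \<in> {1..?N}" for j a b
    using F that unfolding FlagVar_def by blast+
  have F0: "F (j, a, b) = 0" if "\<not> (1 \<le> j \<and> j \<le> n \<and> 1 \<le> a \<and> a \<le> ?N \<and> 1 \<le> b \<and> b \<le> ?N)" for j a b
    using F that unfolding FlagVar_def by blast
  have "\<exists>G. onframe ?N j G \<and> (\<forall>i\<in>{1..j}. Vsp n F i = lspan i G)" if "j \<le> n" for j
    using that
  proof (induction j)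
    case 0
    then show ?case by (simp add: onframe_def)
  next
    case (Suc j)
    then obtain G where G: "onframe ?N j G" "\<forall>i\<in>{1..j}. Vsp n F i = lspan i G" by auto
    let ?V = "Vsp n F (Suc j)"
    have sub: "lspan j G \<subseteq> ?V"
    proof (cases "j = 0")
      case True
      then show ?thesis using csubspace_zero[OF csubspace_Vsp] by (simp add: lspan_0)
    next
      case False
      then show ?thesis using G(2) Fm[of j] Suc.prems by auto
    qed
    have d: "cdim ?V = Suc j" using Fd[of "Suc j"] Suc.prems by simp
    obtain H where H: "onframe ?N (Suc j) H" "\<forall>l\<in>{1..j}. H l = G l" "?V = lspan (Suc j) H"
      using onframe_extend[OF G(1) csubspace_Vsp Vsp_Espan[OF F] sub] unfolding d by blast
    have "Vsp n F i = lspan i H" if "i \<in> {1..Suc j}" for i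
    proof (cases "i = Suc j")
      case False
      then have i: "i \<in> {1..j}" using that by simp
      have "lspan i G = lspan i H" by (rule lspan_cong) (use H(2) i in auto)
      then show ?thesis using G(2) i by simp
    qed (use H in simp)
    then show ?case using H(1) by blast
  qed
  then obtain G where G: "onframe ?N n G" "\<forall>i\<in>{1..n}. Vsp n F i = lspan i G" by blast
  define H where "H = (\<lambda>l. if l \<in> {1..n} then G l else (\<lambda>_. 0))"
  have o: "ortho ?N {1..n} H" unfolding ortho_def
  proof (intro conjI ballI allI impI)
    show "ip ?N (H l) (H l') = (if l = l' then 1 else 0)" if "l \<in> {1..n}" "l' \<in> {1..n}" for l l'
      using G(1) that by (simp add: H_def onframe_def)
    fix l a assume la: "l \<notin> {1..n} \<or> a \<notin> {1..?N}"
    show "H l a = 0"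
    proof (cases "l \<in> {1..n}")
      case True
      then have "G l \<in> Espan ?N" "a \<notin> {1..?N}" using G(1) la by (auto simp: onframe_def)
      then show ?thesis using Espan_D by (simp add: H_def)
    qed (auto simp: H_def)
  qed
  have V: "Vsp n F j = lspan j H" if "j \<in> {1..n}" for j
  proof -
    have "lspan j G = lspan j H" by (rule lspan_cong) (use that in \<open>auto simp: H_def\<close>)
    then show ?thesis using G(2) that by simp
  qed
  have "F (j, a, b) = frame_sum {1..j} H a b" if j: "j \<in> {1..n}" and a: "a \<in> {1..?N}" and b: "b \<in> {1..?N}" for j a b
  proof -
    have on: "onframe ?N j H" using ortho_onframe[OF o] j by simp
    \<comment> \<open>Idempotence: the matrix fixes its image.\<close>
    have fixV: "projapp n F j u a = u a" if u: "u \<in> Vsp n F j" and "a \<in> {1..?N}" for u a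
    proof -
      obtain w where w: "u = projapp n F j w" using u unfolding Vsp_def by blast
      have "projapp n F j u a = (\<Sum>c\<in>{1..?N}. \<Sum>b\<in>{1..?N}. F (j, a, c) * F (j, c, b) * w b)"
        unfolding w projapp_def by (simp add: sum_distrib_left mult.assoc)
      also have "\<dots> = (\<Sum>b\<in>{1..?N}. \<Sum>c\<in>{1..?N}. F (j, a, c) * F (j, c, b) * w b)" by (rule sum.swap)
      also have "\<dots> = (\<Sum>b\<in>{1..?N}. F (j, a, b) * w b)"
        using Fh(2)[OF j that(2)] by (intro sum.cong) (auto simp: sum_distrib_right[symmetric])
      finally show ?thesis unfolding w by (simp add: projapp_def)
    qed
    let ?e = "basis_vec b" and ?p = "projapp n F j (basis_vec b)"
    have pe: "?p a = F (j, a, b)" for a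
    proof -
      have "?p a = (\<Sum>c\<in>{1..?N}. if c = b then F (j, a, b) else 0)"
        unfolding projapp_def by (intro sum.cong) (auto simp: basis_vec_def)
      then show ?thesis using b by simp
    qed
    have "?e \<in> Espan ?N" using b by (auto simp: Espan_def basis_vec_def)
    then have "?p \<in> lspan j H" using V[OF j] unfolding Vsp_def by blast
    then have 1: "F (j, a, b) = (\<Sum>l\<in>{1..j}. ip ?N ?p (H l) * H l a)" using onframe_expand[OF on, of ?p a] pe by simp
    \<comment> \<open>Hermitian symmetry moves the matrix onto \<open>H l\<close>, which it
      fixes.\<close>
    have "ip ?N ?p (H l) = cnj (H l b)" if l: "l \<in> {1..j}" for l
    proof -
      have HV: "H l \<in> Vsp n F j" using lspan_base[OF l, of H] V[OF j] by simp
      have "ip ?N ?p (H l) = (\<Sum>c\<in>{1..?N}. cnj (F (j, b, c) * H l c))"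
        unfolding ip_def using pe Fh(1)[OF j _ b] by (intro sum.cong) auto
      also have "\<dots> = cnj (projapp n F j (H l) b)" by (simp add: projapp_def)
      finally show ?thesis using fixV[OF HV b] by simp
    qed
    then have "F (j, a, b) = (\<Sum>l\<in>{1..j}. cnj (H l b) * H l a)" unfolding 1 by (intro sum.cong) auto
    then show ?thesis by (simp add: frame_sum_def mult.commute)
  qed
  then have "F x = flagof n H x" for x
    using F0 by (cases x) (auto simp: flagof_def)
  then have "F = flagof n H" by (rule ext)
  then show ?thesis using o by blast
qed

lemma frame_sum_eq_of_lspan:
  assumes G: "onframe N k G" and K: "onframe N k K" and e: "lspan k G = lspan k K"
  shows "frame_sum {1..k} G a b = frame_sum {1..k} K a b"
proof -
  have Gl: "G l a = (\<Sum>j\<in>{1..k}. ip N (G l) (K j) * K j a)" if "l \<in> {1..k}" for l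
    using onframe_expand[OF K, of "G l" a] lspan_base[OF that, of G] e by simp
  have Kl: "K j b = (\<Sum>l\<in>{1..k}. ip N (K j) (G l) * G l b)" if "j \<in> {1..k}" for j
    using onframe_expand[OF G, of "K j" b] lspan_base[OF that, of K] e by simp
  have "frame_sum {1..k} G a b = (\<Sum>l\<in>{1..k}. \<Sum>j\<in>{1..k}. ip N (G l) (K j) * K j a * cnj (G l b))"
    unfolding frame_sum_def using Gl by (intro sum.cong) (auto simp: sum_distrib_right)
  also have "\<dots> = (\<Sum>j\<in>{1..k}. \<Sum>l\<in>{1..k}. ip N (G l) (K j) * K j a * cnj (G l b))" by (rule sum.swap)
  also have "\<dots> = (\<Sum>j\<in>{1..k}. K j a * cnj (K j b))"
  proof (rule sum.cong[OF refl])
    fix j assume "j \<in> {1..k}"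
    then have "cnj (K j b) = (\<Sum>l\<in>{1..k}. cnj (ip N (K j) (G l) * G l b))" using Kl by (simp only: cnj_sum)
    then show "(\<Sum>l\<in>{1..k}. ip N (G l) (K j) * K j a * cnj (G l b)) = K j a * cnj (K j b)"
      by (simp add: ip_cnj sum_distrib_left mult_ac)
  qed
  finally show ?thesis by (simp add: frame_sum_def)
qed

text \<open>Completing e_1, ..., e_{n-1} to an orthonormal basis of V_n adds a unit vector y
  orthogonal to E, and v = x y. With both bounds equal to n the position conditions hold trivially;
  later they are sharpened for the same v.\<close>

lemma adapted_to_base:
  assumes n: "n \<ge> 2" and G: "ortho (Ndim n) {1..n} G" and E: "Espan (n - 1) \<subseteq> lspan n G"
  shows "\<exists>v. adapted_to n v n n G"
proof -
  let ?N = "Ndim n"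
  have on: "onframe ?N n G" using ortho_onframe[OF G] by simp
  have onb: "onframe ?N (n - 1) basis_vec" using Ndim_ge[OF n] by (intro onframe_basis) auto
  have d: "cdim (lspan n G) = n" by (rule cdim_lspan[OF on])
  obtain K where K: "onframe ?N n K" "\<forall>l\<in>{1..n-1}. K l = basis_vec l" "lspan n G = lspan n K"
    using onframe_extend[OF onb csubspace_lspan lspan_Espan[OF on]] E unfolding d Espan_lspan by blast
  define y where "y = K n"
  have nn: "n \<in> {1..n}" using n by auto
  have yE: "y \<in> Espan ?N" and yy: "ip ?N y y = 1" using K(1) nn by (auto simp: onframe_def y_def)
  have y0: "y l = 0" if "l \<in> {1..n-1}" for l
  proof -
    have "ip ?N y (K l) = 0" using K(1) that n nn unfolding y_def onframe_def by force
    then show ?thesis using K(2) that ip_basis[of l ?N y] Ndim_ge[OF n] by auto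
  qed
  define v where "v = xmap n y"
  have vE: "v \<in> Espan (n - 1)" by (auto simp: v_def xmap_def Espan_def)
  have yv: "ymap n v = y"
  proof
    fix a
    show "ymap n v a = y a"
    proof (cases "n \<le> a \<and> a \<le> ?N")
      case True
      then have "1 \<le> a - (n - 1)" "a - (n - 1) \<le> n - 1" "a - (n - 1) + (n - 1) = a" using n by (auto simp: Ndim_def)
      then have "xmap n y (a - (n - 1)) = y a" unfolding xmap_def by presburger
      then show ?thesis using True by (simp only: ymap_def v_def) simp
    next
      case False
      then have "a \<in> {1..n-1} \<or> a \<notin> {1..?N}" by auto
      then show ?thesis using False y0 Espan_D[OF yE] by (auto simp: ymap_def)
    qed
  qed
  have vv: "ip ?N v v = 1" using ip_ymap[OF n vE, of v] yv yy by simp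
  have fs: "frame_sum {1..n} G a b = (if a = b \<and> a \<le> n - 1 then 1 else 0) + y a * cnj (y b)"
    if "a \<in> {1..?N}" "b \<in> {1..?N}" for a b
  proof -
    have "frame_sum {1..n} G a b = frame_sum {1..n} K a b" by (rule frame_sum_eq_of_lspan[OF on K(1) K(3)])
    also have "\<dots> = (\<Sum>l\<in>{1..n-1}. K l a * cnj (K l b)) + y a * cnj (y b)"
    proof -
      have ins: "{1..n} = insert n {1..n-1}" using n by auto
      show ?thesis unfolding frame_sum_def ins using n by (simp add: y_def add.commute)
    qed
    also have "(\<Sum>l\<in>{1..n-1}. K l a * cnj (K l b)) = (\<Sum>l\<in>{1..n-1}. if l = a then (if a = b then 1 else 0) else 0)"
      using K(2) by (intro sum.cong) (auto simp: basis_vec_def)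
    also have "\<dots> = (if a = b \<and> a \<le> n - 1 then 1 else 0)" using that by auto
    finally show ?thesis .
  qed
  have "ip ?N (G l) v = 0" if "1 + n < l" for l using G that by (auto simp: ortho_def ip_def)
  then have "adapted_to n v n n G" unfolding adapted_to_def yv using vE vv G fs by auto
  then show ?thesis by blast
qed

lemma adapted_to_weaken: "adapted_to n v r1 r2 G \<Longrightarrow> r1 \<le> s1 \<Longrightarrow> r2 \<le> s2 \<Longrightarrow> adapted_to n v s1 s2 G"
  unfolding adapted_to_def by auto

lemma lspan_iff:
  assumes G: "ortho N {1..n} G" and j: "j \<le> n" and u: "u \<in> lspan n G"
  shows "u \<in> lspan j G \<longleftrightarrow> (\<forall>l. j < l \<longrightarrow> ip N (G l) u = 0)"
proof
  assume uj: "u \<in> lspan j G"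
  show "\<forall>l. j < l \<longrightarrow> ip N (G l) u = 0"
  proof (intro allI impI)
    fix l assume l: "j < l"
    show "ip N (G l) u = 0"
    proof (cases "l \<le> n")
      case True
      let ?U = "{u. ip N u (G l) = 0}"
      have "csubspace ?U" by (simp add: csubspace_def ip_lin1) (simp add: ip_def)
      then have "lspan j G \<subseteq> ?U" by (rule lspan_minimal) (use G l True in \<open>auto simp: ortho_def\<close>)
      then have "ip N u (G l) = 0" using uj by blast
      then show ?thesis using ip_cnj[of N u "G l"] by simp
    next
      case False
      then show ?thesis using G by (simp add: ortho_def ip_def)
    qed
  qed
next
  assume z: "\<forall>l. j < l \<longrightarrow> ip N (G l) u = 0"
  have z': "ip N u (G l) = 0" if "j < l" for l using z that ip_cnj[of N "G l" u] by simp
  have "u a = (\<Sum>l\<in>{1..j}. ip N u (G l) * G l a)" for a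
  proof -
    have "u a = (\<Sum>l\<in>{1..n}. ip N u (G l) * G l a)" using onframe_expand[OF ortho_onframe[OF G order_refl] u] .
    also have "\<dots> = (\<Sum>l\<in>{1..j}. ip N u (G l) * G l a)"
      using j z' by (intro sum.mono_neutral_right) auto
    finally show ?thesis .
  qed
  then have "u = (\<lambda>a. \<Sum>l\<in>{1..j}. ip N u (G l) * G l a)" by (rule ext)
  then show "u \<in> lspan j G" unfolding lspan_def by (intro CollectI exI)
qed

lemma adapted_to_expand:
  assumes n: "n \<ge> 2" and G: "adapted_to n v r1 r2 G" and u: "u \<in> lspan n G"
  shows "u a = (if a \<in> {1..n-1} then u a else 0) + ymap n v a * ip (Ndim n) u (ymap n v)"
proof -
  have o: "ortho (Ndim n) {1..n} G" using G by (simp add: adapted_to_def)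
  have "u a = (\<Sum>l\<in>{1..n}. cnj (ip (Ndim n) (G l) u) * G l a)"
    using onframe_expand[OF ortho_onframe[OF o order_refl] u, of a] by (simp add: ip_cnj)
  also have "\<dots> = (if a \<in> {1..Ndim n} \<and> a \<le> n - 1 then u a else 0) + ymap n v a * ip (Ndim n) u (ymap n v)"
    by (rule adapted_to_reproduce[OF n o]) (use G in \<open>auto simp: adapted_to_def\<close>)
  finally show ?thesis using Ndim_ge[OF n] by (auto split: if_splits)
qed

text \<open>E is killed and y v goes to v, so on V_n the map x has rank one with image L. Stability
  of a flag thereby becomes a question of where L enters it and where it leaves E.\<close>

lemma adapted_to_xmap:
  assumes n: "n \<ge> 2" and G: "adapted_to n v r1 r2 G" and u: "u \<in> lspan n G"
  shows "xmap n u = (\<lambda>a. ip (Ndim n) u (ymap n v) * v a)"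
proof
  fix a
  show "xmap n u a = ip (Ndim n) u (ymap n v) * v a"
  proof (cases "a \<in> {1..n-1}")
    case True
    have "a + (n - 1) \<notin> {1..n-1}" using True by auto
    then have "u (a + (n - 1)) = v a * ip (Ndim n) u (ymap n v)"
      using adapted_to_expand[OF assms, of "a + (n - 1)"] ymap_at[OF n True, of v] by auto
    then show ?thesis using True by (simp add: xmap_def)
  next
    case False
    then have "v a = 0" using G Espan_D unfolding adapted_to_def by blast
    moreover have "xmap n u a = 0" using False by (auto simp: xmap_def)
    ultimately show ?thesis by simp
  qed
qed

lemma adapted_to_Espan:
  assumes n: "n \<ge> 2" and G: "adapted_to n v r1 r2 G" shows "Espan (n - 1) \<subseteq> lspan n G"
proof
  fix u assume u: "u \<in> Espan (n - 1)"
  have o: "ortho (Ndim n) {1..n} G" using G by (simp add: adapted_to_def)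
  have "ip (Ndim n) u (ymap n v) = 0" by (rule ip_E_ymap) (use Espan_D[OF u] n in auto)
  moreover have "(\<Sum>l\<in>{1..n}. cnj (ip (Ndim n) (G l) u) * G l a) =
     (if a \<in> {1..Ndim n} \<and> a \<le> n - 1 then u a else 0) + ymap n v a * ip (Ndim n) u (ymap n v)" for a
    by (rule adapted_to_reproduce[OF n o]) (use G in \<open>auto simp: adapted_to_def\<close>)
  moreover have "(if a \<in> {1..Ndim n} \<and> a \<le> n - 1 then u a else 0) = u a" for a
    using Espan_D[OF u, of a] Ndim_ge[OF n] by auto
  ultimately have "u = (\<lambda>a. \<Sum>l\<in>{1..n}. cnj (ip (Ndim n) (G l) u) * G l a)" by auto
  then show "u \<in> lspan n G" unfolding lspan_def by (intro CollectI exI)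
qed

lemma adapted_to_mem_E:
  assumes n: "n \<ge> 2" and G: "adapted_to n v r1 r2 G" and u: "u \<in> lspan n G"
  shows "u \<in> Espan (n - 1) \<longleftrightarrow> ip (Ndim n) u (ymap n v) = 0"
proof
  assume "u \<in> Espan (n - 1)"
  then show "ip (Ndim n) u (ymap n v) = 0" by (intro ip_E_ymap) (use Espan_D n in auto)
next
  assume z: "ip (Ndim n) u (ymap n v) = 0"
  have "u a = 0" if "a \<notin> {1..n-1}" for a using adapted_to_expand[OF assms, of a] z that by (simp only: if_False) simp
  then show "u \<in> Espan (n - 1)" by (auto simp: Espan_def)
qed

lemma adapted_to_v_mem:
  assumes n: "n \<ge> 2" and G: "adapted_to n v r1 r2 G" and j: "j \<le> n"
  shows "v \<in> lspan j G \<longleftrightarrow> (\<forall>l. j < l \<longrightarrow> ip (Ndim n) (G l) v = 0)"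
  using lspan_iff[OF _ j, of "Ndim n" G v] adapted_to_Espan[OF n G] G unfolding adapted_to_def by blast

text \<open>Up to V_{i-1} the spaces lie in E and are killed by x; from V_{i-1} on they contain L,
  which is the whole image of V_n.\<close>

lemma adapted_Y:
  assumes n: "n \<ge> 2" and i: "2 \<le> i" "i \<le> n" and G: "G \<in> adapted n (i - 2) (n - i)"
  shows "flagof n G \<in> Yvar n"
proof -
  let ?N = "Ndim n"
  obtain v where v: "adapted_to n v (i - 2) (n - i) G" using G by (auto simp: adapted_def)
  have o: "ortho ?N {1..n} G" using v by (simp add: adapted_to_def)
  show ?thesis unfolding Yvar_def
  proof (intro CollectI conjI ballI)
    show "flagof n G \<in> FlagVar n" by (rule flagof_FlagVar[OF o])
    show "Espan (n - 1) \<subseteq> Vsp n (flagof n G) n" using adapted_to_Espan[OF n v] Vsp_flagof[OF o] by simp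
    fix j assume j: "j \<in> {1..n}"
    show "xmap n ` Vsp n (flagof n G) j \<subseteq> Vsp n (flagof n G) j"
    proof
      fix w assume "w \<in> xmap n ` Vsp n (flagof n G) j"
      then obtain u where u: "u \<in> lspan j G" "w = xmap n u" using Vsp_flagof[OF o] j by auto
      have u_span: "u \<in> lspan n G" using u(1) lspan_mono[of j n G] j by auto
      have w: "w = (\<lambda>a. ip ?N u (ymap n v) * v a)" using u(2) adapted_to_xmap[OF n v u_span] by simp
      have "w \<in> lspan j G"
      proof (cases "j < i")
        case True
        let ?U = "{u. ip ?N u (ymap n v) = 0}"
        have "csubspace ?U" by (simp add: csubspace_def ip_lin1) (simp add: ip_def)
        then have "lspan j G \<subseteq> ?U" by (rule lspan_minimal) (use v True i in \<open>auto simp: adapted_to_def\<close>)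
        then have "w = (\<lambda>_. 0)" using u(1) w by auto
        then show ?thesis using csubspace_zero[OF csubspace_lspan] by simp
      next
        case False
        have "\<forall>l. j < l \<longrightarrow> ip ?N (G l) v = 0" using v False i unfolding adapted_to_def by auto
        then have "v \<in> lspan j G" using adapted_to_v_mem[OF n v] j by auto
        then show ?thesis unfolding w by (rule csubspace_scale[OF csubspace_lspan])
      qed
      then show "w \<in> Vsp n (flagof n G) j" using Vsp_flagof[OF o] j by simp
    qed
  qed
qed

text \<open>The rank conditions with m = n - 1 say that V_{i-1} lies in E while V_i does not. Then x
  V_i = L lies in V_i by stability and in E, and the intersection of these two is V_{i-1}.\<close>

lemma cell_adapted:
  assumes n: "n \<ge> 2" and i: "2 \<le> i" "i \<le> n" and F: "F \<in> SchubertCell n (wperm n i)" "F \<in> Yvar n"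
  shows "F \<in> flagof n ` adapted n (i - 2) (n - i)"
proof -
  let ?N = "Ndim n"
  have "F \<in> FlagVar n" using F by (simp add: Yvar_def)
  then obtain G where o: "ortho ?N {1..n} G" and FG: "F = flagof n G" using flag_frame by blast
  have V: "Vsp n F j = lspan j G" if "j \<le> n" for j using Vsp_flagof[OF o that] FG by simp
  have "Espan (n - 1) \<subseteq> lspan n G" using F(2) V[of n] unfolding Yvar_def by simp
  then obtain v where v: "adapted_to n v n n G" using adapted_to_base[OF n o] by blast
  have ond: "cdim (lspan j G) = j" "lspan j G \<subseteq> Espan ?N" if "j \<le> n" for j
    using cdim_lspan[OF ortho_onframe[OF o that]] lspan_Espan[OF ortho_onframe[OF o that]] by auto
  have dims: "cdim (lspan j G \<inter> Espan (n - 1)) = card {l\<in>{1..j}. wperm n i l \<le> n - 1}" if "j \<le> n" for j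
  proof -
    have "\<forall>j\<in>{0..n}. \<forall>m\<in>{0..?N}. cdim (Vsp n F j \<inter> Espan m) = card {l\<in>{1..j}. wperm n i l \<le> m}"
      using F(1) unfolding SchubertCell_def by blast
    then have "cdim (Vsp n F j \<inter> Espan (n - 1)) = card {l\<in>{1..j}. wperm n i l \<le> n - 1}"
      using that Ndim_ge(1)[OF n] by (metis atLeastAtMost_iff zero_le)
    then show ?thesis unfolding V[OF that] .
  qed
  have cs: "csubspace (lspan j G \<inter> Espan (n - 1))" for j by (rule csubspace_Int[OF csubspace_lspan csubspace_Espan])
  have "{l\<in>{1..i-1}. wperm n i l \<le> n - 1} = {1..i-1}" using i n by (auto simp: wperm_def)
  then have d1: "cdim (lspan (i - 1) G \<inter> Espan (n - 1)) = i - 1" using dims[of "i - 1"] i by simp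
  \<comment> \<open>Position i carries N, the only entry exceeding n - 1.\<close>
  have "{l\<in>{1..i}. wperm n i l \<le> n - 1} = {1..i-1}"
    using i n by (auto simp: wperm_def Ndim_def split: if_splits)
  then have d2: "cdim (lspan i G \<inter> Espan (n - 1)) = i - 1" using dims[of i] i by simp
  have e1: "lspan (i - 1) G \<inter> Espan (n - 1) = lspan (i - 1) G"
    by (rule cdim_eq[OF cs csubspace_lspan _ ond(2)]) (use d1 ond(1)[of "i - 1"] i in auto)
  have e2: "lspan (i - 1) G = lspan i G \<inter> Espan (n - 1)"
  proof (rule cdim_eq[OF csubspace_lspan cs])
    show "lspan (i - 1) G \<subseteq> lspan i G \<inter> Espan (n - 1)" using e1 lspan_mono[of "i - 1" i G] by auto
    show "lspan i G \<inter> Espan (n - 1) \<subseteq> Espan ?N" using ond(2)[of i] i by blast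
    show "cdim (lspan i G \<inter> Espan (n - 1)) \<le> cdim (lspan (i - 1) G)" using d2 ond(1)[of "i - 1"] i by simp
  qed
  have "lspan i G \<noteq> lspan (i - 1) G"
  proof
    assume "lspan i G = lspan (i - 1) G"
    then have "cdim (lspan i G) = cdim (lspan (i - 1) G)" by simp
    moreover have "i - 1 \<le> n" using i by simp
    ultimately show False using ond(1)[of i] ond(1)[of "i - 1"] i by simp
  qed
  \<comment> \<open>A vector of V_n outside E has a nonzero component along y v, so x sends it to a
    nonzero multiple of v.\<close>
  then obtain u where u: "u \<in> lspan i G" "u \<notin> Espan (n - 1)" using e2 by blast
  have u_span: "u \<in> lspan n G" using u(1) lspan_mono[OF i(2), of G] by blast
  have c: "ip ?N u (ymap n v) \<noteq> 0" using adapted_to_mem_E[OF n v u_span] u(2) by blast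
  have "i \<in> {1..n}" using i by simp
  then have "xmap n ` Vsp n F i \<subseteq> Vsp n F i" using F(2) unfolding Yvar_def by blast
  then have "xmap n u \<in> lspan i G" using u(1) unfolding V[OF i(2)] by blast
  then have "(\<lambda>a. ip ?N u (ymap n v) * v a) \<in> lspan i G" using adapted_to_xmap[OF n v u_span] by simp
  then have "(\<lambda>a. (1 / ip ?N u (ymap n v)) * (ip ?N u (ymap n v) * v a)) \<in> lspan i G" by (rule csubspace_scale[OF csubspace_lspan])
  then have "v \<in> lspan i G" using c by simp
  moreover have "v \<in> Espan (n - 1)" using v by (simp add: adapted_to_def)
  ultimately have "v \<in> lspan (i - 1) G" using e2 by blast
  then have r1: "\<forall>l. i - 1 < l \<longrightarrow> ip ?N (G l) v = 0" using adapted_to_v_mem[OF n v] i by auto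
  have r2: "ip ?N (G l) (ymap n v) = 0" if "l < i" for l
  proof (cases "l = 0")
    case True
    then show ?thesis using o by (simp add: ortho_def ip_def)
  next
    case False
    then have "G l \<in> lspan (i - 1) G" using that by (intro lspan_base) auto
    moreover have "lspan (i - 1) G \<subseteq> lspan n G" using i by (intro lspan_mono) auto
    ultimately have "G l \<in> Espan (n - 1)" "G l \<in> lspan n G" using e1 by blast+
    then show ?thesis using adapted_to_mem_E[OF n v] by blast
  qed
  have "adapted_to n v (i - 2) (n - i) G" unfolding adapted_to_def
  proof (intro conjI)
    show "\<forall>l>1 + (i - 2). ip ?N (G l) v = 0" using r1 i by auto
    show "\<forall>l. l + (n - i) < n \<longrightarrow> ip ?N (G l) (ymap n v) = 0" using r2 i by auto
  qed (use v in \<open>simp_all add: adapted_to_def\<close>)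
  then show ?thesis using FG unfolding adapted_def by blast
qed

section \<open>Density of the Schubert cells\<close>

text \<open>Transversality of the flag spanned by columns \<open>k, k + 1, \<dots>\<close> to the standard flag of \<open>\<langle>e\<^sub>k, \<dots>, e\<^bsub>n-1\<^esub>\<rangle>\<close>.\<close>
definition generic :: "nat \<Rightarrow> nat \<Rightarrow> frame set" where
  "generic n k = {F \<in> unitary n k. \<forall>j m c. k \<le> m + 1 \<longrightarrow> j + m + 2 \<le> n + k \<longrightarrow>
     (\<forall>a>m. (\<Sum>l\<in>{k..j}. c l * F l a) = 0) \<longrightarrow> (\<forall>l\<in>{k..j}. c l = 0)}"

lemma generic_phase_eq: assumes "F \<in> generic n k" "phase_eq F G" shows "G \<in> generic n k"
proof -
  obtain t where t: "\<And>l. cmod (t l) = 1" "\<And>l a. G l a = t l * F l a" using assms(2) unfolding phase_eq_def by metis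
  have "\<forall>l\<in>{k..j}. c l = 0" if a: "k \<le> m + 1" "j + m + 2 \<le> n + k" "\<forall>a>m. (\<Sum>l\<in>{k..j}. c l * G l a) = 0" for j m c
  proof -
    have "\<forall>a>m. (\<Sum>l\<in>{k..j}. (c l * t l) * F l a) = 0" using a(3) t(2) by (simp add: mult.assoc)
    moreover have "\<forall>j m c. k \<le> m + 1 \<longrightarrow> j + m + 2 \<le> n + k \<longrightarrow>
     (\<forall>a>m. (\<Sum>l\<in>{k..j}. c l * F l a) = 0) \<longrightarrow> (\<forall>l\<in>{k..j}. c l = 0)" using assms(1) unfolding generic_def by simp
    ultimately have z: "\<forall>l\<in>{k..j}. c l * t l = 0" using a(1,2) by presburger
    show ?thesis
    proof
      fix l assume "l \<in> {k..j}"
      then have "c l * t l = 0" using z by blast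
      moreover have "t l \<noteq> 0" using t(1)[of l] by auto
      ultimately show "c l = 0" by simp
    qed
  qed
  then show ?thesis using unitary_phase_eq[of F n k G] assms unfolding generic_def by blast
qed

lemma generic_D:
  assumes "F \<in> generic n k" "k \<le> m + 1" "j + m + 2 \<le> n + k" "\<And>a. a > m \<Longrightarrow> (\<Sum>l\<in>{k..j}. c l * F l a) = 0" "l \<in> {k..j}"
  shows "c l = 0"
  using assms unfolding generic_def by blast

lemma unitary_low: 
  assumes "F \<in> unitary n k" "k \<le> l" "a < k" "k \<le> n"
  shows "F l a = 0"
proof (cases "a = 0")
  case True
  then show ?thesis using unitaryD(2)[OF assms(1), of a l] by simp
next
  case False
  then show ?thesis using unitary_row[OF assms(1), of a l] assms by auto
qed

text \<open>The inequality in \<open>generic\<close> says that the dimensions j - k + 1 and m - k +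
  1 add up to at most n - k, so the two spaces should meet in 0. Take a nonzero u in the
  intersection for the new frame and let l0 be the last column it involves. In the old frame u has
  the component \<open>- sn (z (l0 - k)) * c l0\<close> along column l0 + 1 and none beyond column j
  + 1. Column k of the old frame is e_k up to phase; discarding it leaves a vector in an
  intersection that is 0 for \<open>F\<close>, against the nonzero sine.\<close>

lemma generic_chain:
  assumes F: "F \<in> generic n (Suc k)" and k: "1 \<le> k" "k \<le> n - 1" and z: "z \<in> odisc (n - 1 - k)"
  shows "chain (\<lambda>m. k + m) (n - 1 - k) z F \<in> generic n k"
proof -
  let ?r = "n - 1 - k" and ?q = "\<lambda>m. k + m" and ?N = "Ndim n"
  let ?G = "chain ?q ?r z F"
  have FF: "F \<in> unitary n (Suc k)" using F by (simp add: generic_def)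
  have zp: "z \<in> pdisc ?r" using z odisc_subset by blast
  have kr: "k + ?r \<le> n - 1" using k by simp
  have GF: "?G \<in> unitary n k" using unitary_chain(1)[OF FF k(1) kr zp] by (simp add: unitary_row_def)
  have q: "inj_on ?q {..?r}" "?q ` {..?r} \<subseteq> {1..n-1}" using k by (auto simp: inj_on_def)
  have oF: "ortho ?N {1..n-1} F" and oG: "ortho ?N {1..n-1} ?G" using FF GF by (auto simp: unitary_def)
  have ahead: "ip ?N (?G l) (F l') = (if l' = Suc l then - sn (z (l - k)) else 0)"
    if l: "k \<le> l" "l < n - 1" "l < l'" "l' \<le> n - 1" for l l'
  proof -
    let ?m = "l - k"
    have m: "?m < ?r" "?q ?m = l" "?q (l' - k) = l'" "?m < l' - k" "l' - k \<le> ?r" using l by auto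
    have "?G l = (\<lambda>a. z ?m * chain ?q ?m z F l a + (- sn (z ?m)) * F (Suc l) a)"
      using chain_column[OF q(1) m(1), of z F] m(2) l by (simp add: Suc_diff_le)
    moreover have "ip ?N (chain ?q ?m z F l) (F l') = 0"
      using carry_ip_ahead[OF oF q pdisc_le[OF zp] m(4,5)] m(2,3) by simp
    moreover have "ip ?N (F (Suc l)) (F l') = (if l' = Suc l then 1 else 0)"
      using oF l unfolding ortho_def by auto
    ultimately show ?thesis by (simp only: ip_lin1) simp
  qed
  have "\<forall>l\<in>{k..j}. c l = 0" if a: "k \<le> m + 1" "j + m + 2 \<le> n + k" "\<forall>a>m. (\<Sum>l\<in>{k..j}. c l * ?G l a) = 0" for j m c
  proof (rule ccontr)
    assume "\<not> (\<forall>l\<in>{k..j}. c l = 0)"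
    then have ne: "{l\<in>{k..j}. c l \<noteq> 0} \<noteq> {}" by blast
    define l0 where "l0 = Max {l\<in>{k..j}. c l \<noteq> 0}"
    have "l0 \<in> {l\<in>{k..j}. c l \<noteq> 0}" unfolding l0_def using ne by (intro Max_in) auto
    then have l0: "k \<le> l0" "l0 \<le> j" "c l0 \<noteq> 0" by auto
    have l0': "c l = 0" if "l \<in> {k..j}" "l > l0" for l
    proof (rule ccontr)
      assume "c l \<noteq> 0"
      then have "l \<le> l0" unfolding l0_def using that(1) by (intro Max_ge) auto
      then show False using that(2) by simp
    qed
    define u where "u = (\<lambda>a. \<Sum>l\<in>{k..j}. c l * ?G l a)"
    have uip: "ip ?N u w = (\<Sum>l\<in>{k..j}. c l * ip ?N (?G l) w)" for w unfolding u_def by (rule ip_sum1)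
    have j: "j \<le> n - 1" using a(1,2) by linarith
    show False
    \<comment> \<open>In the first case there is no column j + 1, but the inequality leaves only m =
      k - 1, and u vanishes outright.\<close>
    proof (cases "j = n - 1")
      case True
      then have "m = k - 1" using a(1,2) k by linarith
      have "u a = 0" for a
      proof (cases "a > m")
        case False
        then have "a < k" using \<open>m = k - 1\<close> k by auto
        then show ?thesis unfolding u_def using unitary_low[OF GF, of _ a] k by (intro sum.neutral) auto
      qed (use a(3) in \<open>simp add: u_def\<close>)
      then have "ip ?N u (?G l0) = 0" by (simp add: ip_def)
      moreover have "ip ?N u (?G l0) = (\<Sum>l\<in>{k..j}. if l = l0 then c l0 else 0)"
        unfolding uip using oG l0 j k by (intro sum.cong) (auto simp: ortho_def)
      ultimately show False using l0 by simp
    next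
      case False
      then have j2: "j < n - 1" using j by simp
      define d where "d = (\<lambda>l. ip ?N u (F l))"
      have usup: "u a = 0" if "a \<notin> {1..n-1}" for a
        unfolding u_def using unitaryD(2)[OF GF that] by simp
      have ulow: "u a = 0" if "a < k" for a
        unfolding u_def using unitary_low[OF GF, of _ a] that k by (intro sum.neutral) auto
      have uexp: "u a = (\<Sum>l\<in>{1..n-1}. d l * F l a)" for a
      proof (cases "a \<in> {1..n-1}")
        case True
        have "(\<Sum>l\<in>{1..n-1}. d l * F l a) = (\<Sum>b\<in>{1..?N}. frame_sum {1..n-1} F a b * u b)"
          unfolding reproduce_frame_sum[symmetric] d_def by (simp add: ip_cnj)
        also have "\<dots> = (\<Sum>b\<in>{1..n-1}. frame_sum {1..n-1} F a b * u b)"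
          using usup by (intro sum.mono_neutral_right) (auto simp: Ndim_def)
        also have "\<dots> = (\<Sum>b\<in>{1..n-1}. if b = a then u a else 0)"
          using unitaryD(3)[OF FF True] by (intro sum.cong) auto
        finally show ?thesis using True by simp
      next
        case False
        then show ?thesis using usup[OF False] unitaryD(2)[OF FF False] by simp
      qed
      have dlow: "d l = 0" if "l \<in> {1..<k}" for l
        unfolding d_def using unitary_ip_single[OF FF, of l u] that ulow[of l] k by auto
      have dhigh: "d l = 0" if "l > Suc j" "l \<le> n - 1" for l
        unfolding d_def uip using ahead[of _ l] that j2 by (intro sum.neutral) auto
      have dl0: "d (Suc l0) = - sn (z (l0 - k)) * c l0"
      proof -
        have "d (Suc l0) = (\<Sum>l\<in>{k..j}. if l = l0 then - sn (z (l0 - k)) * c l0 else 0)"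
          unfolding d_def uip
        proof (rule sum.cong[OF refl])
          fix l assume l: "l \<in> {k..j}"
          show "c l * ip ?N (?G l) (F (Suc l0)) = (if l = l0 then - sn (z (l0 - k)) * c l0 else 0)"
          proof (cases "l > l0")
            case True
            then show ?thesis using l0'[OF l] by simp
          next
            case False
            then show ?thesis using ahead[of l "Suc l0"] l l0 j2 by auto
          qed
        qed
        then show ?thesis using l0 by simp
      qed
      \<comment> \<open>Transversality of \<open>F\<close> concerns e_{k+1}, e_{k+2} and so on, so m
        = k - 1 is raised to k. Testing only coordinates beyond k also removes the multiple of e_k,
        and j < n - 1 leaves room in the inequality.\<close>
      let ?m' = "max m k"
      have "d (Suc l0) = 0"
      proof (rule generic_D[OF F, of ?m' "Suc j" d])
        show "Suc k \<le> ?m' + 1" by simp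
        show "Suc j + ?m' + 2 \<le> n + Suc k" using a(1,2) j2 by (cases "m \<ge> k") auto
        show "Suc l0 \<in> {Suc k..Suc j}" using l0 by simp
        fix b assume b: "b > ?m'"
        have "u b = (\<Sum>l\<in>{k..Suc j}. d l * F l b)" unfolding uexp[of b]
          using dlow dhigh j2 k by (intro sum.mono_neutral_right) auto
        also have "\<dots> = d k * F k b + (\<Sum>l\<in>{Suc k..Suc j}. d l * F l b)"
          using l0 by (intro sum.atLeast_Suc_atMost) simp
        also have "F k b = 0" using FF b k unfolding unitary_def by auto
        finally have "(\<Sum>l\<in>{Suc k..Suc j}. d l * F l b) = u b" by simp
        also have "\<dots> = 0" using a(3) b by (simp add: u_def)
        finally show "(\<Sum>l\<in>{Suc k..Suc j}. d l * F l b) = 0" .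
      qed
      moreover have "sn (z (l0 - k)) \<noteq> 0" using z l0 j2 by (intro sn_nonzero) (auto simp: odisc_def)
      ultimately show False using dl0 l0(3) by simp
    qed
  qed
  then show ?thesis using GF unfolding generic_def by blast
qed

lemma pdisc_closure: "pdisc r \<subseteq> closure (odisc r)"
proof
  fix z assume z: "z \<in> pdisc r"
  define f where "f = (\<lambda>c::real. \<lambda>i. of_real c * z i)"
  have c: "continuous_on UNIV f" unfolding f_def
    by (intro continuous_on_coordinatewise_then_product continuous_on_mult continuous_on_of_real continuous_on_id continuous_on_const)
  have "f ` closure {0..<1} \<subseteq> closure (odisc r)"
  proof (rule image_closure_subset)
    show "continuous_on (closure {0..<1}) f" using c continuous_on_subset by blast
    show "f ` {0..<1} \<subseteq> closure (odisc r)"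
    proof
      fix w assume "w \<in> f ` {0..<1}"
      then obtain x where x: "0 \<le> x" "x < 1" "w = f x" by auto
      have "supnorm r (f x) = x * supnorm r z" unfolding f_def using supnorm_scale[OF x(1)] by simp
      moreover have "x * supnorm r z \<le> x * 1" using x z by (intro mult_left_mono) (auto simp: pdisc_alt)
      ultimately have "f x \<in> odisc r" using x z by (auto simp: odisc_alt pdisc_alt f_def)
      then show "w \<in> closure (odisc r)" using x closure_subset by blast
    qed
  qed simp
  moreover have "(1::real) \<in> closure {0..<1}" by simp
  ultimately have "f 1 \<in> closure (odisc r)" by blast
  then show "z \<in> closure (odisc r)" by (simp add: f_def)
qed

text \<open>Every frame arises by a chain from a frame with one more fixed vector. Approximating the
  parameters by interior ones and the old frame by generic ones gives density by continuity of the
  chain.\<close>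

lemma unitary_closure:
  assumes n: "n \<ge> 2" shows "j \<le> n - 1 \<Longrightarrow> unitary n (n - j) \<subseteq> closure (generic n (n - j))"
proof (induction j)
  case 0
  have "unitary n n \<subseteq> generic n n" unfolding generic_def by auto
  then show ?case using closure_subset by auto
next
  case (Suc j)
  define k where "k = n - Suc j"
  have k: "1 \<le> k" "k \<le> n - 1" "Suc k = n - j" "k + (n - 1 - k) \<le> n - 1" using Suc.prems unfolding k_def by auto
  let ?r = "n - 1 - k" and ?q = "\<lambda>m. k + m"
  have IH: "unitary n (Suc k) \<subseteq> closure (generic n (Suc k))" using Suc k(3) by simp
  have "unitary n k \<subseteq> closure (generic n k)"
  proof
    fix W assume W: "W \<in> unitary n k"
    have "W l k = 0" if "l \<ge> k + Suc ?r" for l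
    proof -
      have "l \<notin> {1..n-1}" using that k by auto
      then show ?thesis using unitaryD(1)[OF W] unfolding ortho_def by blast
    qed
    then have "W \<in> unitary_row n k (Suc ?r)" using W unfolding unitary_row_def by blast
    then obtain F z where F: "F \<in> unitary n (Suc k)" and z: "z \<in> pdisc ?r" and fe: "phase_eq (chain ?q ?r z F) W"
      using unitary_row_cover[OF _ k(1,4)] by blast
    let ?f = "\<lambda>p. chain ?q ?r (fst p) (snd p)"
    have "?f ` closure (odisc ?r \<times> generic n (Suc k)) \<subseteq> closure (generic n k)"
    proof (rule image_closure_subset)
      show "continuous_on (closure (odisc ?r \<times> generic n (Suc k))) ?f"
        by (intro continuous_on_chain continuous_on_fst continuous_on_snd continuous_on_id)
      show "?f ` (odisc ?r \<times> generic n (Suc k)) \<subseteq> closure (generic n k)"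
        using generic_chain[OF _ k(1,2)] closure_subset[of "generic n k"] by auto
    qed simp
    moreover have "(z, F) \<in> closure (odisc ?r \<times> generic n (Suc k))"
      using z F IH pdisc_closure[of ?r] unfolding closure_Times by blast
    ultimately have "?f (z, F) \<in> closure (generic n k)" by blast
    then have cl: "chain ?q ?r z F \<in> closure (generic n k)" by simp
    obtain t where t: "\<And>l. cmod (t l) = 1" "\<And>l a. W l a = t l * chain ?q ?r z F l a"
      using fe unfolding phase_eq_def by metis
    \<comment> \<open>The chain produces \<open>W\<close> only up to phases. Multiplying the columns
      by these fixed phases is continuous and preserves genericity.\<close>
    let ?g = "\<lambda>G::frame. \<lambda>l a. t l * G l a"
    have "?g ` closure (generic n k) \<subseteq> closure (generic n k)"
    proof (rule image_closure_subset)
      show "continuous_on (closure (generic n k)) ?g"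
        by (rule continuous_on_coordinatewise_then_product[OF continuous_on_coordinatewise_then_product])
           (intro continuous_on_mult continuous_on_const continuous_on_component[OF continuous_on_component[OF continuous_on_id]])
      show "?g ` generic n k \<subseteq> closure (generic n k)"
      proof
        fix H assume "H \<in> ?g ` generic n k"
        then obtain G where G: "G \<in> generic n k" "H = ?g G" by blast
        have "phase_eq G H" unfolding phase_eq_def using t(1) G(2) by blast
        then show "H \<in> closure (generic n k)" using generic_phase_eq[OF G(1)] closure_subset by blast
      qed
    qed simp
    then have "?g (chain ?q ?r z F) \<in> closure (generic n k)" using cl by blast
    moreover have "?g (chain ?q ?r z F) = W" using t(2) by (intro ext) simp
    ultimately show "W \<in> closure (generic n k)" by simp
  qed
  then show ?case unfolding k_def .
qed

lemma unitary_closure_1: "n \<ge> 2 \<Longrightarrow> unitary n 1 \<subseteq> closure (generic n 1)"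
  using unitary_closure[of n "n - 1"] by simp

section \<open>Undoing the upward rotations\<close>

primrec unchain :: "nat \<Rightarrow> (nat \<Rightarrow> complex) \<Rightarrow> frame \<Rightarrow> frame" where
  "unchain 0 z F = F"
| "unchain (Suc r) z F = unchain r z (rot (Suc (Suc r)) (Suc r) (z r) F)"

lemma unchain_chain: "\<forall>i<r. cmod (z i) \<le> 1 \<Longrightarrow> unchain r z (chain Suc r z F) = F"
  by (induction r) (auto simp: rot_inverse)

lemma chain_unchain: "\<forall>i<r. cmod (z i) \<le> 1 \<Longrightarrow> chain Suc r z (unchain r z F) = F"
  by (induction r arbitrary: F) (auto simp: rot_inverse)

lemma rot_unitary:
  assumes W: "W \<in> unitary n 1" and q: "q \<in> {1..n-1}" "q' \<in> {1..n-1}" "q \<noteq> q'" "cmod z \<le> 1"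
  shows "rot q q' z W \<in> unitary n 1"
  unfolding unitary_def
proof (intro CollectI conjI ballI allI impI)
  show "ortho (Ndim n) {1..n-1} (rot q q' z W)" by (rule rot_ortho[OF unitaryD(1)[OF W] q])
  show "rot q q' z W l a = 0" if "a \<notin> {1..n-1}" for l a
    using unitaryD(2)[OF W that] by (simp add: rot_def)
  show "frame_sum {1..n-1} (rot q q' z W) a b = (if a = b then 1 else 0)" if "a \<in> {1..n-1}" "b \<in> {1..n-1}" for a b
    using rot_frame_sum[OF _ q, of W a b] unitaryD(3)[OF W that] by simp
qed auto

lemma unchain_unitary: "W \<in> unitary n 1 \<Longrightarrow> r + 2 \<le> n \<Longrightarrow> \<forall>i<r. cmod (z i) \<le> 1 \<Longrightarrow> unchain r z W \<in> unitary n 1"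
proof (induction r arbitrary: W)
  case (Suc r)
  have "rot (Suc (Suc r)) (Suc r) (z r) W \<in> unitary n 1" by (rule rot_unitary) (use Suc.prems in auto)
  then show ?case using Suc by simp
qed simp

lemma chain_unitary: "W \<in> unitary n 1 \<Longrightarrow> r + 2 \<le> n \<Longrightarrow> \<forall>i<r. cmod (z i) \<le> 1 \<Longrightarrow> chain Suc r z W \<in> unitary n 1"
proof (induction r)
  case (Suc r)
  then have "chain Suc r z W \<in> unitary n 1" by simp
  then show ?case unfolding chain.simps by (rule rot_unitary) (use Suc.prems in auto)
qed simp

text \<open>Parameter 0 is undone last and is the only one to touch column 1, so its influence there
  is explicit and \<open>\<beta>\<close> does not depend on it. This permits a perturbation of v by
  a single parameter.\<close>

lemma unchain_first: "\<exists>\<beta>. \<forall>w. unchain (Suc r) (z(0 := w)) W 1 = (\<lambda>a. sn w * \<beta> a + cnj w * W 1 a)"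
proof (induction r arbitrary: W)
  case 0
  show ?case by (intro exI[of _ "W 2"]) (simp add: rot_def numeral_2_eq_2)
next
  case (Suc r)
  let ?W = "rot (Suc (Suc (Suc r))) (Suc (Suc r)) (z (Suc r)) W"
  obtain \<beta> where b: "\<forall>w. unchain (Suc r) (z(0 := w)) ?W 1 = (\<lambda>a. sn w * \<beta> a + cnj w * ?W 1 a)" using Suc by blast
  have "?W 1 = W 1" by (simp add: rot_def)
  moreover have "unchain (Suc (Suc r)) (z(0 := w)) W = unchain (Suc r) (z(0 := w)) ?W" for w
    by (subst unchain.simps(2)) simp
  ultimately show ?case using b by (intro exI[of _ \<beta>]) (simp only: simp_thms)
qed

lemma continuous_on_unchain:
  fixes f :: "'a::topological_space \<Rightarrow> frame"
  shows "continuous_on S w \<Longrightarrow> continuous_on S f \<Longrightarrow> continuous_on S (\<lambda>x. unchain r (w x) (f x))"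
proof (induction r arbitrary: f)
  case (Suc r)
  show ?case unfolding unchain.simps
    by (rule Suc.IH[OF Suc.prems(1) continuous_on_rot[OF continuous_on_component[OF Suc.prems(1)] Suc.prems(2)]])
qed simp

lemma rot_upd: "l \<noteq> q \<Longrightarrow> l \<noteq> q' \<Longrightarrow> rot q q' z (F(l := y)) = (rot q q' z F)(l := y)"
  by (auto simp: rot_def fun_eq_iff)

lemma chain_upd: "l \<notin> q ` {..r} \<Longrightarrow> chain q r z (F(l := y)) = (chain q r z F)(l := y)"
proof (induction r)
  case (Suc r)
  then have "l \<noteq> q r" "l \<noteq> q (Suc r)" "l \<notin> q ` {..r}" by auto
  then have "chain q r z (F(l := y)) = (chain q r z F)(l := y)" using Suc.IH by blast
  then show ?case unfolding chain.simps using rot_upd[OF \<open>l \<noteq> q r\<close> \<open>l \<noteq> q (Suc r)\<close>] by metis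
qed simp

text \<open>The same points as \<open>adapted_op\<close>, but parametrised by the basis of \<open>E\<close> after the upward rotations: genericity of the flag in \<open>E\<close> is a condition on that basis.\<close>
definition adapted_par :: "nat \<Rightarrow> nat \<Rightarrow> nat \<Rightarrow> frame \<Rightarrow> (nat \<Rightarrow> complex) \<Rightarrow> (nat \<Rightarrow> complex) \<Rightarrow> frame" where
  "adapted_par n r1 r2 W z1 z2 = chain (\<lambda>m. n - m) r2 z2 (W(n := ymap n (unchain r1 z1 W 1)))"

lemma continuous_on_adapted_par:
  fixes f :: "'a::topological_space \<Rightarrow> frame"
  assumes "continuous_on S f" "continuous_on S w1" "continuous_on S w2"
  shows "continuous_on S (\<lambda>x. adapted_par n r1 r2 (f x) (w1 x) (w2 x))"
  unfolding adapted_par_def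
proof (intro continuous_on_chain assms)
  have u: "continuous_on S (\<lambda>x. unchain r1 (w1 x) (f x) 1 a)" for a
    by (rule continuous_on_component[OF continuous_on_component[OF continuous_on_unchain[OF assms(2,1)]]])
  have c: "continuous_on S (\<lambda>x. f x l a)" for l a
    by (rule continuous_on_component[OF continuous_on_component[OF assms(1)]])
  have "continuous_on S (\<lambda>x. ((f x)(n := ymap n (unchain r1 (w1 x) (f x) 1))) l a)" for l a
  proof (cases "l = n")
    case True
    then show ?thesis using u[of "a - (n - 1)"] by (cases "n \<le> a \<and> a \<le> Ndim n") (auto simp: ymap_def)
  next
    case False
    then show ?thesis using c[of l a] by simp
  qed
  then show "continuous_on S (\<lambda>x. (f x)(n := ymap n (unchain r1 (w1 x) (f x) 1)))"
    by (rule continuous_on_coordinatewise_then_product[OF continuous_on_coordinatewise_then_product])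
qed

lemma up_lift:
  assumes "r1 + 2 \<le> n" "\<forall>i<r1. cmod (z i) \<le> 1"
  shows "chain Suc r1 z (lift n (unchain r1 z W)) = W(n := ymap n (unchain r1 z W 1))"
proof -
  have "n \<notin> Suc ` {..r1}" using assms by auto
  then show ?thesis unfolding lift_def using chain_upd[of n Suc r1 z "unchain r1 z W"] chain_unchain[OF assms(2)] by simp
qed

section \<open>The components and their intersections\<close>

lemma cdim_zero: "cdim {\<lambda>_. 0} = 0"
  using cdim_lspan[OF onframe_0] unfolding lspan_0 .

text \<open>Genericity settles the case of expected dimension 0. Otherwise two coordinate counts
  meet: setting the n - 1 - m coordinates above m to zero bounds the dimension from below, and
  setting the coordinates n - p, ..., m to zero leads to an intersection that is 0, which bounds it
  from above.\<close>

lemma generic_dim: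
  assumes n: "n \<ge> 2" and W: "W \<in> generic n 1" and p: "p \<le> n - 1" and m: "m \<le> n - 1"
  shows "cdim (lspan p W \<inter> Espan m) = p + m - (n - 1)"
proof -
  let ?N = "Ndim n"
  have WF: "W \<in> unitary n 1" using W by (simp add: generic_def)
  have on: "onframe ?N p W" using ortho_onframe[OF unitaryD(1)[OF WF] p] .
  let ?A = "lspan p W"
  have AE: "?A \<subseteq> Espan (n - 1)"
    by (rule lspan_minimal[OF csubspace_Espan]) (use unitaryD(2)[OF WF] in \<open>auto simp: Espan_def\<close>)
  have AN: "?A \<subseteq> Espan ?N" by (rule lspan_Espan[OF on])
  have dA: "cdim ?A = p" by (rule cdim_lspan[OF on])
  have small: "?A \<inter> Espan m = {\<lambda>_. 0}" if "p + m \<le> n - 1" for m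
  proof
    show "?A \<inter> Espan m \<subseteq> {\<lambda>_. 0}"
    proof
      fix u assume u: "u \<in> ?A \<inter> Espan m"
      then obtain c where c: "u = (\<lambda>a. \<Sum>l\<in>{1..p}. c l * W l a)" unfolding lspan_def by blast
      have "c l = 0" if l: "l \<in> {1..p}" for l
      proof (rule generic_D[OF W, of m p c l])
        show "p + m + 2 \<le> n + 1" using \<open>p + m \<le> n - 1\<close> n by simp
        show "(\<Sum>l\<in>{1..p}. c l * W l a) = 0" if "a > m" for a
        proof -
          have "u a = 0" using u that by (auto simp: Espan_def)
          then show ?thesis using c by simp
        qed
      qed (use l in auto)
      then have "u = (\<lambda>_. 0)" unfolding c by (intro ext sum.neutral) auto
      then show "u \<in> {\<lambda>_. 0}" by simp
    qed
    show "{\<lambda>_. 0} \<subseteq> ?A \<inter> Espan m" using csubspace_zero[OF csubspace_lspan] csubspace_zero[OF csubspace_Espan] by simp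
  qed
  let ?U = "?A \<inter> Espan m"
  have U: "csubspace ?U" "?U \<subseteq> Espan ?N" using csubspace_Int[OF csubspace_lspan csubspace_Espan] AN by auto
  have "?A \<inter> {u. \<forall>a\<in>{m+1..n-1}. u a = 0} = ?U"
  proof
    show "?A \<inter> {u. \<forall>a\<in>{m+1..n-1}. u a = 0} \<subseteq> ?U"
    proof
      fix u assume u: "u \<in> ?A \<inter> {u. \<forall>a\<in>{m+1..n-1}. u a = 0}"
      have uE: "u \<in> Espan (n - 1)" using u AE by blast
      have "u a = 0" if "a < 1 \<or> m < a" for a
      proof (cases "a \<in> {m+1..n-1}")
        case False
        then have "a \<notin> {1..n-1}" using that by auto
        then show ?thesis using Espan_D[OF uE] by blast
      qed (use u in blast)
      then show "u \<in> ?U" using u by (simp add: Espan_def)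
    qed
    show "?U \<subseteq> ?A \<inter> {u. \<forall>a\<in>{m+1..n-1}. u a = 0}" by (auto simp: Espan_def)
  qed
  then have lower: "p \<le> (n - 1 - m) + cdim ?U"
    using cdim_cut[OF csubspace_lspan AN, of "{m+1..n-1}"] dA by simp
  show ?thesis
  proof (cases "p + m \<le> n - 1")
    case True
    then show ?thesis using small[OF True] cdim_zero by simp
  next
    case False
    let ?m0 = "n - 1 - p"
    have z: "?A \<inter> Espan ?m0 = {\<lambda>_. 0}" by (rule small) (use p in simp)
    have "?U \<inter> {u. \<forall>a\<in>{?m0+1..m}. u a = 0} \<subseteq> ?A \<inter> Espan ?m0"
    proof
      fix u assume u: "u \<in> ?U \<inter> {u. \<forall>a\<in>{?m0+1..m}. u a = 0}"
      have "u a = 0" if "a < 1 \<or> ?m0 < a" for a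
      proof (cases "a \<in> {?m0+1..m}")
        case False
        then have "a < 1 \<or> m < a" using that by auto
        then show ?thesis using u by (auto simp: Espan_def)
      qed (use u in blast)
      then show "u \<in> ?A \<inter> Espan ?m0" using u by (simp add: Espan_def)
    qed
    moreover have "csubspace (?U \<inter> {u. \<forall>a\<in>{?m0+1..m}. u a = 0})" by (rule csubspace_Int[OF U(1)]) (simp add: csubspace_def)
    ultimately have "cdim (?U \<inter> {u. \<forall>a\<in>{?m0+1..m}. u a = 0}) \<le> cdim (?A \<inter> Espan ?m0)"
      using cdim_mono[OF _ csubspace_Int[OF csubspace_lspan csubspace_Espan], of _ p W ?m0 ?N] AN by blast
    then have "cdim (?U \<inter> {u. \<forall>a\<in>{?m0+1..m}. u a = 0}) = 0" unfolding z cdim_zero by simp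
    then have "cdim ?U \<le> m - ?m0" using cdim_cut[OF U, of "{?m0+1..m}"] by simp
    then show ?thesis using lower False p m by linarith
  qed
qed

text \<open>Without the entry N the word is n - 1, ..., 1, and for m up to n - 1 its first p letters
  contain p + m - (n - 1) that are at most m; truncated subtraction supplies the 0 for short
  prefixes. Prefixes of length at least i contain N as one of their letters.\<close>

lemma wperm_count:
  assumes n: "n \<ge> 2" and i: "2 \<le> i" "i \<le> n" and j: "j \<le> n" and m: "m \<le> Ndim n"
  shows "card {l\<in>{1..j}. wperm n i l \<le> m} =
    (if m \<le> n - 1 then (if j < i then j else j - 1) + m - (n - 1)
     else if m < Ndim n then (if j < i then j else j - 1) else j)"
proof -
  let ?C = "{l\<in>{1..j}. wperm n i l \<le> m}"
  have N: "n - 1 < Ndim n" using n by (auto simp: Ndim_def)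
  consider "m \<le> n - 1" "j < i" | "m \<le> n - 1" "i \<le> j" | "n - 1 < m" "m < Ndim n" "j < i" |
    "n - 1 < m" "m < Ndim n" "i \<le> j" | "m = Ndim n" using m by linarith
  then show ?thesis
  proof cases
    case 1
    have "?C = {n-m..j}" using 1 i n by (auto simp: wperm_def)
    then have "card ?C = Suc j - (n - m)" by simp
    then show ?thesis using 1 n by simp
  next
    case 2
    have "?C = {n-m..i-1} \<union> {max (i+1) (n+1-m)..j}"
      using 2 i n N by (auto simp: wperm_def split: if_splits)
    moreover have "{n-m..i-1} \<inter> {max (i+1) (n+1-m)..j} = {}" by auto
    ultimately have "card ?C = card {n-m..i-1} + card {max (i+1) (n+1-m)..j}" by (simp add: card_Un_disjoint)
    also have "\<dots> = j - 1 + m - (n - 1)" using 2 i n by (auto simp: max_def)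
    finally show ?thesis using 2 by simp
  next
    case 3
    have "?C = {1..j}" using 3 i n by (auto simp: wperm_def)
    then show ?thesis using 3 by simp
  next
    case 4
    have "?C = {1..j} - {i}" using 4 i n by (auto simp: wperm_def split: if_splits)
    then show ?thesis using 4 i by simp
  next
    case 5
    have "?C = {1..j}" using 5 i n N j by (auto simp: wperm_def split: if_splits)
    then show ?thesis using 5 N by simp
  qed
qed

lemma adapted_par_adapted_op:
  assumes "r1 + r2 + 2 \<le> n" "z1 \<in> pdisc r1" "W = chain Suc r1 z1 U"
  shows "adapted_par n r1 r2 W z1 z2 = adapted_op n r1 r2 (merge r1 z1 z2) U"
proof -
  have z: "\<forall>i<r1. cmod (z1 i) \<le> 1" by (rule pdisc_le[OF assms(2)])
  have U: "unchain r1 z1 W = U" using unchain_chain[OF z] assms(3) by simp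
  have "chain Suc r1 z1 (lift n U) = W(n := ymap n (U 1))"
    using up_lift[of r1 n z1 W] z assms(1) U by simp
  then show ?thesis unfolding adapted_par_def adapted_op_def U trunc_merge[OF assms(2)] by simp
qed

lemma adapted_par_adapted_to:
  assumes n: "n \<ge> 2" "r1 + r2 \<le> n - 2" and W: "W \<in> unitary n 1" and z: "z1 \<in> pdisc r1" "z2 \<in> pdisc r2"
  shows "adapted_to n (unchain r1 z1 W 1) r1 0 (W(n := ymap n (unchain r1 z1 W 1)))"
    "adapted_to n (unchain r1 z1 W 1) r1 r2 (adapted_par n r1 r2 W z1 z2)"
proof -
  have z1: "\<forall>i<r1. cmod (z1 i) \<le> 1" by (rule pdisc_le[OF z(1)])
  have U: "unchain r1 z1 W \<in> unitary n 1" using unchain_unitary[OF W _ z1] n by simp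
  have e: "chain Suc r1 z1 (lift n (unchain r1 z1 W)) = W(n := ymap n (unchain r1 z1 W 1))"
    using up_lift[OF _ z1, of n W] n by simp
  show 1: "adapted_to n (unchain r1 z1 W 1) r1 0 (W(n := ymap n (unchain r1 z1 W 1)))"
    using adapted_to_up(1)[OF n lift_adapted_to[OF n(1) U] z(1)] e by simp
  show "adapted_to n (unchain r1 z1 W 1) r1 r2 (adapted_par n r1 r2 W z1 z2)"
    unfolding adapted_par_def by (rule adapted_to_down(1)[OF n 1 z(2)])
qed

text \<open>V_j meets E in the span of the first j columns of \<open>W\<close>, or of the first j -
  1 once j is at least i. For m up to n - 1 the rank condition is then transversality of
  \<open>W\<close>. For m between n - 1 and N it rests on the last coordinate of v: as this is
  nonzero, a vector of V_j with vanishing N-th coordinate has no component along y v.\<close>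

lemma generic_cell:
  assumes n: "n \<ge> 2" and i: "2 \<le> i" "i \<le> n" and W: "W \<in> generic n 1"
    and z: "z1 \<in> pdisc (i - 2)" "z2 \<in> odisc (n - i)" and v: "unchain (i - 2) z1 W 1 (n - 1) \<noteq> 0"
  shows "flagof n (adapted_par n (i - 2) (n - i) W z1 z2) \<in> SchubertCell n (wperm n i) \<inter> Yvar n"
proof -
  let ?N = "Ndim n" and ?r1 = "i - 2" and ?r2 = "n - i"
  let ?G = "adapted_par n ?r1 ?r2 W z1 z2"
  define v where "v = unchain ?r1 z1 W 1"
  let ?y = "ymap n v"
  let ?H = "W(n := ?y)"
  have WF: "W \<in> unitary n 1" using W by (simp add: generic_def)
  have z2: "z2 \<in> pdisc ?r2" using z odisc_subset by blast
  have nr: "?r1 + ?r2 \<le> n - 2" using i by simp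
  have H: "adapted_to n v ?r1 0 ?H" and G: "adapted_to n v ?r1 ?r2 ?G"
    using adapted_par_adapted_to[OF n nr WF z(1) z2] unfolding v_def by auto
  have Gdef: "?G = chain (\<lambda>m. n - m) ?r2 z2 ?H" by (simp add: adapted_par_def v_def)
  have oG: "ortho ?N {1..n} ?G" using G by (simp add: adapted_to_def)
  have vE: "v \<in> Espan (n - 1)" and vv: "ip ?N v v = 1" using G by (auto simp: adapted_to_def)
  have GY: "flagof n ?G \<in> Yvar n" by (rule adapted_Y[OF n i]) (use G in \<open>auto simp: adapted_def\<close>)
  have Gl: "?G l = W l" if "l < i" for l
    using adapted_to_down(3)[OF n nr H z2, of l] that i unfolding Gdef by simp
  have onG: "onframe ?N j ?G" if "j \<le> n" for j by (rule ortho_onframe[OF oG that])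
  have onW: "onframe ?N j W" if "j \<le> n - 1" for j by (rule ortho_onframe[OF unitaryD(1)[OF WF] that])
  have WE: "W l \<in> Espan (n - 1)" for l using unitaryD(2)[OF WF] by (auto simp: Espan_def)
  have AE: "lspan j W \<subseteq> Espan (n - 1)" for j by (rule lspan_minimal[OF csubspace_Espan]) (rule WE)
  have En: "Espan (n - 1) \<subseteq> lspan n ?G" by (rule adapted_to_Espan[OF n G])
  have VE1: "lspan j ?G = lspan j W" if "j < i" for j by (rule lspan_cong) (use Gl that in auto)
  have Gi: "ip ?N (?G i) ?y \<noteq> 0"
  proof -
    have "ip ?N (?G (n - ?r2)) ?y = (\<Prod>t<?r2. sn (z2 t)) * ip ?N (?H n) ?y"
      unfolding Gdef by (rule adapted_to_down(2)[OF n nr H z2])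
    moreover have "ip ?N (?H n) ?y = 1" using ip_ymap[OF n vE, of v] vv by simp
    ultimately show ?thesis using interior_sn_prod[OF z(2)] i by simp
  qed
  have VE2: "lspan (j - 1) W = lspan j ?G \<inter> Espan (n - 1)" if j: "i \<le> j" "j \<le> n" for j
  proof (rule cdim_eq[OF csubspace_lspan csubspace_Int[OF csubspace_lspan csubspace_Espan]])
    have "W l \<in> lspan j ?G" if l: "l \<in> {1..j-1}" for l
    proof -
      have Wn: "W l \<in> lspan n ?G" using WE En by blast
      have "ip ?N (?G l') (W l) = 0" if l': "j < l'" for l'
      proof (cases "l' \<le> n")
        case False
        then show ?thesis using oG by (simp add: ortho_def ip_def)
      next
        case True
        \<comment> \<open>A column l' beyond j is a combination of y v and columns l' - 1, ..., n -
          1 of \<open>W\<close>, and l < l' - 1.\<close>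
        let ?q = "\<lambda>m::nat. n - m" and ?m = "n - l'"
        have m: "?m < ?r2" "?q ?m = l'" "?q (Suc ?m) = l' - 1" using l' j True by auto
        have col: "?G l' = (\<lambda>a. z2 ?m * chain ?q ?m z2 ?H l' a + (- sn (z2 ?m)) * ?H (l' - 1) a)"
          using chain_column[OF chains_index(3)[OF n nr] m(1), of z2 ?H] unfolding Gdef m(2) m(3) .
        have WW: "ip ?N (W k) (W l) = 0" if "k \<in> {1..n-1}" "k \<noteq> l" for k
        proof -
          have "l \<in> {1..n-1}" using l j by auto
          then show ?thesis using unitaryD(1)[OF WF] that unfolding ortho_def by simp
        qed
        have "ip ?N (?H (?q t)) (W l) = 0" if "t \<le> ?m" for t
        proof (cases "t = 0")
          case True
          then show ?thesis using ip_ymap_E[of n "W l" ?N v] Espan_D[OF WE[of l]] n by auto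
        next
          case False
          then have "?q t \<in> {1..n-1}" "?q t \<noteq> l" "?q t \<noteq> n" using that m(1) l l' \<open>l' \<le> n\<close> i by auto
          then show ?thesis using WW by simp
        qed
        then have "ip ?N (chain ?q ?m z2 ?H (?q ?m)) (W l) = 0"
          by (intro chain_lin[OF lin_closed_ip]) auto
        then have c0: "ip ?N (chain ?q ?m z2 ?H l') (W l) = 0" unfolding m(2) .
        have "l' - 1 \<in> {1..n-1}" "l' - 1 \<noteq> l" "l' - 1 \<noteq> n" using l l' True j i by auto
        then have "ip ?N (?H (l' - 1)) (W l) = 0" using WW by simp
        then show ?thesis unfolding col ip_lin1 using c0 by simp
      qed
      then show ?thesis using lspan_iff[OF oG j(2) Wn] by blast
    qed
    then have "lspan (j - 1) W \<subseteq> lspan j ?G" by (intro lspan_minimal[OF csubspace_lspan]) auto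
    then show "lspan (j - 1) W \<subseteq> lspan j ?G \<inter> Espan (n - 1)" using AE by blast
    show EN: "lspan j ?G \<inter> Espan (n - 1) \<subseteq> Espan ?N" using lspan_Espan[OF onG[OF j(2)]] by blast
    have "cdim (lspan j ?G \<inter> Espan (n - 1)) \<le> cdim (lspan j ?G)"
      by (rule cdim_mono[OF csubspace_Int[OF csubspace_lspan csubspace_Espan] csubspace_lspan _ lspan_Espan[OF onG[OF j(2)]]]) blast
    then have le: "cdim (lspan j ?G \<inter> Espan (n - 1)) \<le> j" using cdim_lspan[OF onG[OF j(2)]] by simp
    have "cdim (lspan j ?G \<inter> Espan (n - 1)) \<noteq> j"
    proof
      assume e: "cdim (lspan j ?G \<inter> Espan (n - 1)) = j"
      have "lspan j ?G \<inter> Espan (n - 1) = lspan j ?G"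
        by (rule cdim_eq[OF csubspace_Int[OF csubspace_lspan csubspace_Espan] csubspace_lspan _ lspan_Espan[OF onG[OF j(2)]]])
           (use e cdim_lspan[OF onG[OF j(2)]] in auto)
      moreover have Gij: "?G i \<in> lspan j ?G" using i j by (intro lspan_base) auto
      ultimately have "?G i \<in> Espan (n - 1)" by blast
      moreover have "?G i \<in> lspan n ?G" using Gij lspan_mono[OF j(2)] by blast
      ultimately show False using adapted_to_mem_E[OF n G] Gi by blast
    qed
    then have "cdim (lspan j ?G \<inter> Espan (n - 1)) \<le> j - 1" using le by linarith
    moreover have "cdim (lspan (j - 1) W) = j - 1" using cdim_lspan[OF onW] j by simp
    ultimately show "cdim (lspan j ?G \<inter> Espan (n - 1)) \<le> cdim (lspan (j - 1) W)" by simp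
  qed
  have VE: "lspan j ?G \<inter> Espan (n - 1) = lspan (if j < i then j else j - 1) W" if "j \<le> n" for j
    using VE1[of j] VE2[of j] AE[of j] that by (cases "j < i") auto
  have cnt: "cdim (lspan j ?G \<inter> Espan m) = card {l\<in>{1..j}. wperm n i l \<le> m}" if j: "j \<le> n" and m: "m \<le> ?N" for j m
  proof -
    let ?p = "if j < i then j else j - 1"
    have p: "?p \<le> n - 1" using j i by auto
    consider "m \<le> n - 1" | "n - 1 < m" "m < ?N" | "m = ?N" using m by linarith
    then show ?thesis
    proof cases
      case 1
      have "Espan m = Espan (n - 1) \<inter> Espan m" using 1 by (auto simp: Espan_def)
      then have "lspan j ?G \<inter> Espan m = lspan ?p W \<inter> Espan m" using VE[OF j] by blast
      then have "cdim (lspan j ?G \<inter> Espan m) = ?p + m - (n - 1)" using generic_dim[OF n W p 1] by simp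
      then show ?thesis using wperm_count[OF n i j m] 1 by simp
    next
      case 2
      have "lspan j ?G \<inter> Espan m = lspan j ?G \<inter> Espan (n - 1)"
      proof
        show "lspan j ?G \<inter> Espan m \<subseteq> lspan j ?G \<inter> Espan (n - 1)"
        proof
          fix u assume u: "u \<in> lspan j ?G \<inter> Espan m"
          have u_span: "u \<in> lspan n ?G" using u lspan_mono[OF j] by blast
          have "u ?N = 0" using u 2 by (auto simp: Espan_def)
          moreover have "?N \<notin> {1..n-1}" using n by (auto simp: Ndim_def)
          ultimately have "?y ?N * ip ?N u ?y = 0" using adapted_to_expand[OF n G u_span, of ?N] by (simp only: if_False) simp
          moreover have "?y ?N = v (n - 1)"
          proof -
            have "(n - 1) + (n - 1) = ?N" by (simp add: Ndim_def)
            then show ?thesis using ymap_at[OF n, of "n - 1" v] n by simp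
          qed
          ultimately have "ip ?N u ?y = 0" using v unfolding v_def by simp
          then show "u \<in> lspan j ?G \<inter> Espan (n - 1)" using adapted_to_mem_E[OF n G u_span] u by blast
        qed
        show "lspan j ?G \<inter> Espan (n - 1) \<subseteq> lspan j ?G \<inter> Espan m" using 2 by (auto simp: Espan_def)
      qed
      then have "cdim (lspan j ?G \<inter> Espan m) = cdim (lspan ?p W)" using VE[OF j] by simp
      also have "\<dots> = ?p" by (rule cdim_lspan[OF onW[OF p]])
      finally show ?thesis using wperm_count[OF n i j m] 2 by simp
    next
      case 3
      have "lspan j ?G \<inter> Espan m = lspan j ?G" using lspan_Espan[OF onG[OF j]] 3 by blast
      then have "cdim (lspan j ?G \<inter> Espan m) = j" using cdim_lspan[OF onG[OF j]] by simp
      moreover have "\<not> ?N \<le> n - 1" using n by (auto simp: Ndim_def)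
      ultimately show ?thesis using wperm_count[OF n i j m] 3 by simp
    qed
  qed
  have "flagof n ?G \<in> SchubertCell n (wperm n i)" unfolding SchubertCell_def
    using flagof_FlagVar[OF oG] cnt Vsp_flagof[OF oG] by auto
  then show ?thesis using GY by blast
qed

text \<open>Three assumptions of \<open>generic_cell\<close> are removed by successive limits:
  interior downward parameters, a nonzero last coordinate of v, genericity of \<open>W\<close>. The
  second is the delicate one and is handled by moving the first upward parameter.\<close>

lemma adapted_par_closure:
  assumes n: "n \<ge> 2" and i: "2 \<le> i" "i \<le> n" and W: "W \<in> unitary n 1"
    and z: "z1 \<in> pdisc (i - 2)" "z2 \<in> pdisc (n - i)"
  shows "flagof n (adapted_par n (i - 2) (n - i) W z1 z2) \<in> closure (SchubertCell n (wperm n i) \<inter> Yvar n)"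
proof -
  let ?r1 = "i - 2" and ?r2 = "n - i"
  let ?C = "closure (SchubertCell n (wperm n i) \<inter> Yvar n)"
  have cf: "continuous_on S (\<lambda>x. flagof n (adapted_par n ?r1 ?r2 (f x) (w1 x) (w2 x)))"
    if "continuous_on S f" "continuous_on S w1" "continuous_on S w2" for f w1 w2 and S :: "'z::topological_space set"
    by (rule continuous_on_compose2[OF continuous_on_flagof continuous_on_adapted_par[OF that]]) simp
  have A: "flagof n (adapted_par n ?r1 ?r2 W z1 z2) \<in> ?C"
    if W: "W \<in> generic n 1" and z: "z1 \<in> pdisc ?r1" "z2 \<in> pdisc ?r2" and v: "unchain ?r1 z1 W 1 (n - 1) \<noteq> 0" for W z1 z2
  proof -
    have "(\<lambda>z2. flagof n (adapted_par n ?r1 ?r2 W z1 z2)) ` closure (odisc ?r2) \<subseteq> ?C"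
    proof (rule image_closure_subset)
      show "continuous_on (closure (odisc ?r2)) (\<lambda>z2. flagof n (adapted_par n ?r1 ?r2 W z1 z2))"
        by (rule cf) (intro continuous_on_const continuous_on_id)+
      show "(\<lambda>z2. flagof n (adapted_par n ?r1 ?r2 W z1 z2)) ` odisc ?r2 \<subseteq> ?C"
        using generic_cell[OF n i W z(1) _ v] closure_subset by blast
    qed simp
    then show ?thesis using z(2) pdisc_closure by blast
  qed
  have B: "flagof n (adapted_par n ?r1 ?r2 W z1 z2) \<in> ?C"
    if W: "W \<in> generic n 1" and z: "z1 \<in> pdisc ?r1" "z2 \<in> pdisc ?r2" for W z1 z2
  proof (cases "unchain ?r1 z1 W 1 (n - 1) = 0")
    case False
    then show ?thesis using A[OF W z] by blast
  next
    case True
    \<comment> \<open>Transversality of the first column to the span of e_1, ..., e_{n-2}. With no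
      upward rotation v would be this column, so a vanishing last coordinate forces r1 > 0.\<close>
    have alpha: "W 1 (n - 1) \<noteq> 0"
    proof
      assume e: "W 1 (n - 1) = 0"
      have "(1::complex) = 0"
      proof (rule generic_D[OF W, of "n - 2" 1 "\<lambda>_. 1" 1])
        fix a assume a: "a > n - 2"
        show "(\<Sum>l\<in>{1..1}. 1 * W l a) = 0"
        proof (cases "a = n - 1")
          case False
          then have "a \<notin> {1..n-1}" using a by auto
          then show ?thesis using W unitaryD(2)[of W n 1 a 1] unfolding generic_def by simp
        qed (use e in simp)
      qed (use n in auto)
      then show False by simp
    qed
    then obtain r where r: "?r1 = Suc r" using True by (cases ?r1) auto
    obtain \<beta> where b: "\<forall>w. unchain (Suc r) (z1(0 := w)) W 1 = (\<lambda>a. sn w * \<beta> a + cnj w * W 1 a)"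
      using unchain_first[of r z1 W] by blast
    let ?z = "z1 0"
    have e0: "sn ?z * \<beta> (n - 1) + cnj ?z * W 1 (n - 1) = 0"
      using b[rule_format, of ?z] True r by (simp add: fun_upd_idem)
    \<comment> \<open>A path along which the coordinate becomes nonzero at once. If the parameter is
      0, so is the last coordinate of \<open>\<beta>\<close>, and moving along the reals switches on
      the other term. Otherwise turning the phase keeps the sine term and turns the other one, which
      is nonzero; times in (0, 1] do not complete a turn.\<close>
    obtain w :: "real \<Rightarrow> complex" where w: "continuous_on UNIV w" "w 0 = ?z" "\<And>t. t \<in> {0<..1} \<Longrightarrow> cmod (w t) \<le> 1"
      "\<And>t. t \<in> {0<..1} \<Longrightarrow> sn (w t) * \<beta> (n - 1) + cnj (w t) * W 1 (n - 1) \<noteq> 0"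
    proof (cases "?z = 0")
      case True
      then have "\<beta> (n - 1) = 0" using e0 by (simp add: sn_def)
      then show ?thesis using that[of of_real] True alpha by (auto intro: continuous_on_of_real continuous_on_id)
    next
      case False
      let ?w = "\<lambda>t. cis t * ?z"
      have "cmod (?w t) = cmod ?z" for t by (simp add: norm_mult)
      then have s: "sn (?w t) = sn ?z" for t by (rule sn_cong)
      have "cmod ?z \<le> 1" using pdisc_le[OF z(1)] r by simp
      moreover have "sn (?w t) * \<beta> (n - 1) + cnj (?w t) * W 1 (n - 1) \<noteq> 0" if t: "t \<in> {0<..1}" for t
      proof
        assume "sn (?w t) * \<beta> (n - 1) + cnj (?w t) * W 1 (n - 1) = 0"
        then have "sn ?z * \<beta> (n - 1) + cnj (cis t) * (cnj ?z * W 1 (n - 1)) = 0"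
          unfolding s by (simp add: mult.assoc)
        then have "cnj (cis t) * (cnj ?z * W 1 (n - 1)) = cnj ?z * W 1 (n - 1)" using e0 by (metis add_left_cancel)
        then have "cnj (cis t) = 1" using False alpha by simp
        then have "cis t = 1" by (metis complex_cnj_cnj complex_cnj_one)
        then have "sin t = 0" by (simp add: complex_eq_iff)
        moreover have "sin t > 0" using t pi_ge_two by (intro sin_gt_zero) auto
        ultimately show False by simp
      qed
      moreover have "continuous_on UNIV ?w" unfolding cis_conv_exp by (intro continuous_intros)
      ultimately show ?thesis using that[of ?w] by (auto simp: norm_mult)
    qed
    let ?f = "\<lambda>t. flagof n (adapted_par n ?r1 ?r2 W (z1(0 := w t)) z2)"
    have zt: "z1(0 := w t) \<in> pdisc ?r1" if "t \<in> {0<..1}" for t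
      unfolding pdisc_def
    proof (rule CollectI, rule allI)
      fix l
      show "cmod ((z1(0 := w t)) l) \<le> (if l < ?r1 then 1 else 0)"
        using pdiscD[OF z(1), of l] w(3)[OF that] r by (cases "l = 0") auto
    qed
    have "?f ` closure {0<..1} \<subseteq> ?C"
    proof (rule image_closure_subset)
      have "continuous_on (closure {0<..1}) (\<lambda>t. (z1(0 := w t)) l)" for l
        using continuous_on_subset[OF w(1), of "closure {0<..1}"] by (cases "l = 0") auto
      then have "continuous_on (closure {0<..1}) (\<lambda>t. z1(0 := w t))"
        by (rule continuous_on_coordinatewise_then_product)
      then show "continuous_on (closure {0<..1}) ?f"
        by (intro cf continuous_on_const)
      show "?f ` {0<..1} \<subseteq> ?C"
      proof
        fix x assume "x \<in> ?f ` {0<..1}"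
        then obtain t where t: "t \<in> {0<..1}" "x = ?f t" by blast
        have "unchain ?r1 (z1(0 := w t)) W 1 (n - 1) \<noteq> 0" unfolding r using b w(4)[OF t(1)] by simp
        then show "x \<in> ?C" using A[OF W zt[OF t(1)] z(2)] t(2) by blast
      qed
    qed simp
    moreover have "(0::real) \<in> closure {0<..1}" by simp
    ultimately have "?f 0 \<in> ?C" by blast
    then show ?thesis using w(2) by simp
  qed
  have "(\<lambda>W. flagof n (adapted_par n ?r1 ?r2 W z1 z2)) ` closure (generic n 1) \<subseteq> ?C"
  proof (rule image_closure_subset)
    show "continuous_on (closure (generic n 1)) (\<lambda>W. flagof n (adapted_par n ?r1 ?r2 W z1 z2))"
      by (rule cf) (intro continuous_on_const continuous_on_id)+
    show "(\<lambda>W. flagof n (adapted_par n ?r1 ?r2 W z1 z2)) ` generic n 1 \<subseteq> ?C" using B z by blast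
  qed simp
  then show ?thesis using W unitary_closure_1[OF n] by blast
qed

lemma flagtop_euclidean: "flagtop = euclidean"
  unfolding flagtop_def by (rule euclidean_product_topology)

lemma adapted_ortho: "G \<in> adapted n r1 r2 \<Longrightarrow> ortho (Ndim n) {1..n} G"
  by (auto simp: adapted_def adapted_to_def)

lemma adapted_mono: "r1 \<le> s1 \<Longrightarrow> r2 \<le> s2 \<Longrightarrow> adapted n r1 r2 \<subseteq> adapted n s1 s2"
  using adapted_to_weaken unfolding adapted_def by blast

text \<open>The conditions for (r1, r2) are implied by those for smaller pairs, so the set is the
  union over a rectangle, a finite cellular set. This replaces a direct proof that the conditions on
  L and E are closed.\<close>

lemma compact_flagof_adapted:
  assumes n: "n \<ge> 2" "r1 + r2 \<le> n - 2" shows "compact (flagof n ` adapted n r1 r2)"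
proof -
  let ?D = "{..r1} \<times> {..r2}"
  have X: "adapted_union n ?D = adapted n r1 r2"
  proof
    show "adapted_union n ?D \<subseteq> adapted n r1 r2" unfolding adapted_union_def using adapted_mono[of _ r1 _ r2 n] by auto
    show "adapted n r1 r2 \<subseteq> adapted_union n ?D" unfolding adapted_union_def by auto
  qed
  obtain ds where "cellular (adapted_union n ?D) ds" using cellular_adapted_union[OF n(1), of ?D] n(2) by auto
  then have "cellular (adapted n r1 r2) ds" unfolding X .
  then show ?thesis
    using cellular_homology[OF _ continuous_on_flagof, of "adapted n r1 r2" ds n] flagof_eq_iff adapted_ortho by blast
qed

text \<open>The compact set on the right contains the cell and hence its closure, and the cell is
  dense in it. It lies in \<open>Yvar n\<close>, so taking the closure there changes
  nothing.\<close>

lemma Kcomp_eq: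
  assumes n: "n \<ge> 2" and i: "2 \<le> i" "i \<le> n"
  shows "Kcomp n i = flagof n ` adapted n (i - 2) (n - i)"
proof -
  let ?S = "SchubertCell n (wperm n i) \<inter> Yvar n" and ?K = "flagof n ` adapted n (i - 2) (n - i)"
  have nr: "i - 2 + (n - i) \<le> n - 2" using i by simp
  have "Kcomp n i = Yvar n \<inter> closure ?S"
    unfolding Kcomp_def flagtop_euclidean by (simp add: closure_of_subtopology Int_commute Int_assoc)
  moreover have "closure ?S \<subseteq> ?K"
  proof (rule closure_minimal)
    show "?S \<subseteq> ?K" using cell_adapted[OF n i] by blast
    show "closed ?K" using compact_flagof_adapted[OF n nr] by (rule compact_imp_closed)
  qed
  moreover have "?K \<subseteq> Yvar n" using adapted_Y[OF n i] by blast
  moreover have "?K \<subseteq> closure ?S"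
  proof
    fix F assume "F \<in> ?K"
    then obtain G where G: "G \<in> adapted n (i - 2) (n - i)" "F = flagof n G" by blast
    obtain U z where U: "U \<in> unitary n 1" "z \<in> pdisc (i - 2 + (n - i))" "phase_eq (adapted_op n (i - 2) (n - i) z U) G"
      using adapted_cover[OF n nr G(1)] by blast
    let ?z1 = "trunc (i - 2) z" and ?z2 = "shift (i - 2) z"
    have zz: "?z1 \<in> pdisc (i - 2)" "?z2 \<in> pdisc (n - i)" using trunc_pdisc[OF U(2)] shift_pdisc[OF U(2)] by auto
    \<comment> \<open>\<open>U\<close> is the basis of E before the upward rotations,
      \<open>?W\<close> the one after them; this translates \<open>adapted_op\<close> into
      \<open>adapted_par\<close>.\<close>
    let ?W = "chain Suc (i - 2) ?z1 U"
    have W: "?W \<in> unitary n 1" using chain_unitary[OF U(1) _ pdisc_le[OF zz(1)]] i by simp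
    have "adapted_par n (i - 2) (n - i) ?W ?z1 ?z2 = adapted_op n (i - 2) (n - i) (merge (i - 2) ?z1 ?z2) U"
      by (rule adapted_par_adapted_op) (use i zz in auto)
    also have "\<dots> = adapted_op n (i - 2) (n - i) z U" unfolding adapted_op_def trunc_merge[OF zz(1)] by simp
    finally have e: "adapted_par n (i - 2) (n - i) ?W ?z1 ?z2 = adapted_op n (i - 2) (n - i) z U" .
    have "adapted_op n (i - 2) (n - i) z U \<in> adapted n (i - 2) (n - i)" using adapted_op_adapted_to(1)[OF n nr U(1,2)] unfolding adapted_def by blast
    then have "flagof n (adapted_op n (i - 2) (n - i) z U) = flagof n G"
      using flagof_eq_iff[OF adapted_ortho adapted_ortho[OF G(1)]] U(3) by blast
    then show "F \<in> closure ?S" using adapted_par_closure[OF n i W zz] e G(2) by simp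
  qed
  ultimately show ?thesis by blast
qed

text \<open>A flag determines its frame up to phases, and V_n determines v up to a phase, so the
  conditions from K^i and from K^j concern the same L. As i \<le> j, the sharper condition on L
  comes from K^i and the sharper condition on E from K^j.\<close>

lemma Kint_eq:
  assumes n: "n \<ge> 2" and i: "2 \<le> i" "i \<le> j" "j \<le> n"
  shows "Kint n i j = flagof n ` adapted n (i - 2) (n - j)"
proof -
  have K: "Kcomp n i = flagof n ` adapted n (i - 2) (n - i)" "Kcomp n j = flagof n ` adapted n (j - 2) (n - j)"
    using Kcomp_eq[OF n] i by auto
  show ?thesis unfolding Kint_def K
  proof
    show "flagof n ` adapted n (i - 2) (n - j) \<subseteq> flagof n ` adapted n (i - 2) (n - i) \<inter> flagof n ` adapted n (j - 2) (n - j)"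
    proof -
      have "adapted n (i - 2) (n - j) \<subseteq> adapted n (i - 2) (n - i)" "adapted n (i - 2) (n - j) \<subseteq> adapted n (j - 2) (n - j)"
        using i by (intro adapted_mono; simp)+
      then show ?thesis by blast
    qed
    show "flagof n ` adapted n (i - 2) (n - i) \<inter> flagof n ` adapted n (j - 2) (n - j) \<subseteq> flagof n ` adapted n (i - 2) (n - j)"
    proof
      fix F assume "F \<in> flagof n ` adapted n (i - 2) (n - i) \<inter> flagof n ` adapted n (j - 2) (n - j)"
      then obtain G G' where G: "G \<in> adapted n (i - 2) (n - i)" "F = flagof n G" "G' \<in> adapted n (j - 2) (n - j)" "F = flagof n G'" by blast
      have fe: "phase_eq G' G" using flagof_eq_iff[OF adapted_ortho[OF G(3)] adapted_ortho[OF G(1)]] G(2,4) by simp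
      then have G2: "G \<in> adapted n (j - 2) (n - j)" using adapted_phase_eq[OF G(3)] by blast
      obtain v v' where v: "adapted_to n v (i - 2) (n - i) G" "adapted_to n v' (j - 2) (n - j) G" using G(1) G2 by (auto simp: adapted_def)
      obtain s where s: "cmod s = 1" "\<forall>a. ymap n v' a = s * ymap n v a" using adapted_to_unique[OF n v phase_eq_refl] by blast
      have y: "ymap n v' = (\<lambda>a. s * ymap n v a)" using s by auto
      have "ip (Ndim n) (G l) (ymap n v) = 0" if "l + (n - j) < n" for l
      proof -
        have "ip (Ndim n) (G l) (ymap n v') = 0" using v(2) that by (simp add: adapted_to_def)
        then show ?thesis using s(1) unfolding y ip_scale2 by auto
      qed
      then have "adapted_to n v (i - 2) (n - j) G" using v(1) by (simp add: adapted_to_def)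
      then show "F \<in> flagof n ` adapted n (i - 2) (n - j)" using G(2) unfolding adapted_def by blast
    qed
  qed
qed

theorem theorem4p2:
  fixes n :: nat and ps :: "(nat \<times> nat) list"
  assumes "n \<ge> 2"
    and "\<forall>(i, j)\<in>set ps. 2 \<le> i \<and> i \<le> j \<and> j \<le> n"
  defines "D \<equiv> {(i, j). 2 \<le> i \<and> i \<le> j \<and> j \<le> n \<and>
                   (\<exists>(it, jt)\<in>set ps. i \<le> it \<and> jt \<le> j)}"
    and "X \<equiv> (\<Union>(it, jt)\<in>set ps. Kint n it jt)"
  shows "(\<forall>p::int. odd p \<longrightarrow> trivial_group (homology_group p (subtopology flagtop X))) \<and>
         (\<forall>k::nat. homology_group (2 * int k) (subtopology flagtop X)
              \<cong> free_Abelian_group {..< nat (coeff (qfact (n - 1) *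
                     (\<Sum>(i, j)\<in>D. monom 1 ((i - 2) + (n - j)))) k)})"
proof -
  \<comment> \<open>Arm and leg of a cell. In these coordinates \<open>D\<close> becomes an order
    ideal, the shape required for attaching strata from small to large.\<close>
  let ?f = "\<lambda>(i, j). (i - 2, n - j)"
  define \<Delta> where "\<Delta> = ?f ` D"
  have ps: "2 \<le> i" "i \<le> j" "j \<le> n" if "(i, j) \<in> set ps" for i j using assms(2) that by auto
  have finD: "finite D" by (rule finite_subset[of _ "{..n} \<times> {..n}"]) (auto simp: D_def)
  have inj: "inj_on ?f D" by (auto simp: inj_on_def D_def)
  have D\<Delta>: "(r1, r2) \<in> \<Delta> \<longleftrightarrow> r1 + r2 \<le> n - 2 \<and> (\<exists>(it, jt)\<in>set ps. r1 \<le> it - 2 \<and> r2 \<le> n - jt)" for r1 r2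
  proof
    assume "(r1, r2) \<in> \<Delta>"
    then obtain i j where ij: "(i, j) \<in> D" "r1 = i - 2" "r2 = n - j" unfolding \<Delta>_def by auto
    then obtain it jt where t: "2 \<le> i" "i \<le> j" "j \<le> n" "(it, jt) \<in> set ps" "i \<le> it" "jt \<le> j"
      unfolding D_def by blast
    then have "r1 + r2 \<le> n - 2" "r1 \<le> it - 2" "r2 \<le> n - jt" using ij by auto
    then show "r1 + r2 \<le> n - 2 \<and> (\<exists>(it, jt)\<in>set ps. r1 \<le> it - 2 \<and> r2 \<le> n - jt)"
      using t(4) by blast
  next
    assume a: "r1 + r2 \<le> n - 2 \<and> (\<exists>(it, jt)\<in>set ps. r1 \<le> it - 2 \<and> r2 \<le> n - jt)"
    then obtain it jt where t: "(it, jt) \<in> set ps" "r1 \<le> it - 2" "r2 \<le> n - jt" by blast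
    \<comment> \<open>Truncated subtraction can be reversed because \<open>it\<close> is at least 2
      and \<open>jt\<close> at most n.\<close>
    have "r1 + 2 \<le> it" "jt \<le> n - r2" using t ps[OF t(1)] by auto
    moreover have "r1 + 2 \<le> n - r2" using a assms(1) by linarith
    ultimately have "(r1 + 2, n - r2) \<in> D" unfolding D_def using t(1) by auto
    then have "?f (r1 + 2, n - r2) \<in> \<Delta>" unfolding \<Delta>_def by (rule imageI)
    moreover have "n - (n - r2) = r2" using a by linarith
    ultimately show "(r1, r2) \<in> \<Delta>" by simp
  qed
  have "\<exists>ds. cellular (adapted_union n \<Delta>) ds \<and> dim_poly ds = qfact (n - 1) * (\<Sum>(r1, r2)\<in>\<Delta>. monom 1 (r1 + r2))"
  proof (rule cellular_adapted_union[OF assms(1)])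
    show "finite \<Delta>" unfolding \<Delta>_def using finD by simp
    show "r1 + r2 \<le> n - 2" if "(r1, r2) \<in> \<Delta>" for r1 r2 using that unfolding D\<Delta> by (rule conjunct1)
    show "(s1, s2) \<in> \<Delta>" if "(r1, r2) \<in> \<Delta>" "s1 \<le> r1" "s2 \<le> r2" for r1 r2 s1 s2
    proof -
      note a = that(1)[unfolded D\<Delta>]
      from a obtain it jt where t: "(it, jt) \<in> set ps" "r1 \<le> it - 2" "r2 \<le> n - jt" by blast
      have "s1 + s2 \<le> n - 2" "s1 \<le> it - 2" "s2 \<le> n - jt" using t a that(2,3) by auto
      then show ?thesis unfolding D\<Delta> using t(1) by blast
    qed
  qed
  then obtain ds where ds: "cellular (adapted_union n \<Delta>) ds" "dim_poly ds = qfact (n - 1) * (\<Sum>(r1, r2)\<in>\<Delta>. monom 1 (r1 + r2))" by blast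
  have sum: "(\<Sum>(r1, r2)\<in>\<Delta>. monom (1::int) (r1 + r2)) = (\<Sum>(i, j)\<in>D. monom 1 ((i - 2) + (n - j)))"
    unfolding \<Delta>_def by (subst sum.reindex[OF inj]) (auto intro!: sum.cong)
  have Xeq: "X = flagof n ` adapted_union n \<Delta>"
  proof
    show "X \<subseteq> flagof n ` adapted_union n \<Delta>"
    proof
      fix F assume "F \<in> X"
      then obtain it jt where t: "(it, jt) \<in> set ps" "F \<in> Kint n it jt" unfolding X_def by blast
      have "it - 2 + (n - jt) \<le> n - 2" using ps[OF t(1)] by linarith
      then have "(it - 2, n - jt) \<in> \<Delta>" unfolding D\<Delta> using t(1) by blast
      moreover have "F \<in> flagof n ` adapted n (it - 2) (n - jt)" using Kint_eq[OF assms(1) ps[OF t(1)]] t(2) by blast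
      ultimately show "F \<in> flagof n ` adapted_union n \<Delta>" unfolding adapted_union_def by blast
    qed
    show "flagof n ` adapted_union n \<Delta> \<subseteq> X"
    proof
      fix F assume "F \<in> flagof n ` adapted_union n \<Delta>"
      then obtain r1 r2 G where r: "(r1, r2) \<in> \<Delta>" "G \<in> adapted n r1 r2" "F = flagof n G" unfolding adapted_union_def by blast
      obtain it jt where t: "(it, jt) \<in> set ps" "r1 \<le> it - 2" "r2 \<le> n - jt" using r(1)[unfolded D\<Delta>] by blast
      have "G \<in> adapted n (it - 2) (n - jt)" using adapted_mono[OF t(2,3)] r(2) by blast
      then have "F \<in> Kint n it jt" using Kint_eq[OF assms(1) ps[OF t(1)]] r(3) by blast
      then show "F \<in> X" unfolding X_def using t(1) by blast
    qed
  qed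
  have "even_free_homology (top_of_set (flagof n ` adapted_union n \<Delta>)) (count_list ds)"
  proof -
    have "flagof n F = flagof n G \<longleftrightarrow> phase_eq F G" if "F \<in> adapted_union n \<Delta>" "G \<in> adapted_union n \<Delta>" for F G
      using that adapted_ortho flagof_eq_iff unfolding adapted_union_def by blast
    then show ?thesis using cellular_homology[OF ds(1) continuous_on_flagof] by blast
  qed
  \<comment> \<open>The coefficient is a number of cells, so \<open>nat\<close> loses
    nothing.\<close>
  moreover have "nat (coeff (qfact (n - 1) * (\<Sum>(i, j)\<in>D. monom 1 ((i - 2) + (n - j)))) k) = count_list ds k" for k
    using coeff_dim_poly[of ds k] unfolding ds(2) sum by simp
  ultimately show ?thesis unfolding even_free_homology_def Xeq flagtop_euclidean by simp
qed

end
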